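(* Let $L$ be a one-dimensional mixed-type Kimura operator on $[0,1]$, and let $\overline L$ denote the $C^0([0,1])$-graph closure of $L$ with domain $C^{2+\gamma}([0,1])$, with adjoint $\overline L^*$ acting on $C^0([0,1])^*$. Then $$\dim\ker\overline L^*=|bP_{\mathrm{ter}}(L)| .$$
   Context: Operator. $L=a(x)x^{m(0)}(1-x)^{m(1)}\frac{d^2}{dx^2}+b(x)x^{m(0)-1}(1-x)^{m(1)-1}\frac{d}{dx}$ on $[0,1]$, with $a,b\in C^\infty([0,1])$, $a>0$, $m(i)\in\{1,2\}$. The endpoint $i$ is Kimura if $m(i)=1$ and quadratic if $m(i)=2$. At Kimura endpoints $b\frac{d}{dx}$ is inward pointing ($b(0)\ge0$, resp. $b(1)\le0$). A Kimura endpoint $0$ (resp. $1$) is tangent if $b(0)=0$ (resp. $b(1)=0$) and transverse if $b(0)>0$ (resp. $b(1)<0$). A quadratic endpoint $0$ (resp. $1$) is tangent if $b(0)/a(0)<1$ (resp. $b(1)/a(1)>-1$), transverse if $b(0)/a(0)>1$ (resp. $b(1)/a(1)<-1$), and neutral if $b(0)/a(0)=1$ (resp. $b(1)/a(1)=-1$). Terminal boundary. If $L$ is transverse to both endpoints, $bP_{\mathrm{ter}}(L)$ is the set consisting of all quadratic endpoints together with one further element $P$ (the whole interval). Otherwise $bP_{\mathrm{ter}}(L)$ is the set consisting of all quadratic endpoints and all Kimura tangent endpoints. $|\cdot|$ denotes cardinality. Space $C^{2+\gamma}([0,1])$, $0<\gamma<1$. Heat coordinates: fix an increasing coordinate $t$,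 $x=\phi(t)$, in which $L$ over $[0,1/3]$ is $t\partial_t^2+b(t)\partial_t$ with $t=0$ at $x=0$ (if $0$ is Kimura) or $\partial_t^2+b(t)\partial_t$ with $t\to-\infty$ at $x=0$ (if $0$ is quadratic), and $L$ over $[2/3,1]$ is $(1-t)\partial_t^2+b(t)\partial_t$ with $t=1$ at $x=1$ (Kimura) or $\partial_t^2+b(t)\partial_t$ with $t\to+\infty$ at $x=1$ (quadratic). $f\in C^{2+\gamma}([0,1])$ if, in heat coordinates, $f$ is $C^{2+\gamma}$ in the interior and near each end belongs to the local space $C^{2+\gamma}(U)$, given for left ends as follows (right ends are symmetric). $|\cdot|_{k+\gamma,U}$ is the usual Hölder norm. - Quadratic end, $U=(-\infty,c]$: $f\in C^2(U)$, $f,\partial_zf,\partial_z^2f$ extend continuously to $-\infty$, and $|f|_{2+\gamma,U}+\|\partial_z^2f\|_{\gamma,U}<\infty$. Here $\|g\|_{\gamma,U}=|g|_{\gamma,U}+\sup_{z_1\le z_2\le c}|\int_{z_1}^{z_2}g\,dz|$ if the endpoint is not neutral, with the additional term $\sup_{z_1\le z_2\le c}|\int_{z_1}^{z_2}\int_{-\infty}^zg(s)\,ds\,dz|$ if it is neutral. - Kimura end, $U=(0,c]$: $f\in C^1(\overline U)\cap C^2(U)$, $x\partial_x^2f$ extends continuously to $x=0$ with value $0$, and $|f|_{\gamma,U}+|\partial_xf|_{\gamma,U}+|x\partial_x^2f|_{\gamma,U}<\infty$. *)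

theory Defs
  imports "HOL-Analysis.Analysis"
begin

text \<open>The space of continuous functions on the unit interval with the supremum norm is
  obtained from the library type of bounded continuous functions, so the unit interval
  has to be a type. Every continuous function on it is bounded, by compactness.\<close>

typedef unit_interval = "{0..1::real}"
  by (rule exI[of _ 0]) simp

setup_lifting type_definition_unit_interval

instantiation unit_interval :: metric_space
begin

lift_definition dist_unit_interval :: "unit_interval \<Rightarrow> unit_interval \<Rightarrow> real" is dist .

definition uniformity_unit_interval :: "(unit_interval \<times> unit_interval) filter"
  where "uniformity_unit_interval = (INF e\<in>{0<..}. principal {(x, y). dist x y < e})"

definition open_unit_interval :: "unit_interval set \<Rightarrow> bool"
  where "open_unit_interval U \<longleftrightarrow> (\<forall>x\<in>U. eventually (\<lambda>(x', y). x' = x \<longrightarrow> y \<in> U) uniformity)"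

instance
proof
  fix x y z :: unit_interval
  show "dist x y = 0 \<longleftrightarrow> x = y" by transfer simp
  show "dist x y \<le> dist x z + dist y z" by transfer (rule dist_triangle2)
qed (simp_all add: uniformity_unit_interval_def open_unit_interval_def)

end

type_synonym C0 = "unit_interval \<Rightarrow>\<^sub>C real"

text \<open>The values outside the unit interval are unspecified and never used.\<close>

definition on_line :: "C0 \<Rightarrow> real \<Rightarrow> real" where
  "on_line f x = apply_bcontfun f (Abs_unit_interval x)"


definition smooth_on :: "real set \<Rightarrow> (real \<Rightarrow> real) \<Rightarrow> bool" where
  "smooth_on S f \<longleftrightarrow> (\<exists>D :: nat \<Rightarrow> real \<Rightarrow> real.
     (\<forall>x\<in>S. D 0 x = f x) \<and>
     (\<forall>n. \<forall>x\<in>S. (D n has_real_derivative D (Suc n) x) (at x within S)))"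

definition C2_on :: "real set \<Rightarrow> (real \<Rightarrow> real) \<Rightarrow> (real \<Rightarrow> real) \<Rightarrow> (real \<Rightarrow> real) \<Rightarrow> bool" where
  "C2_on S f f' f'' \<longleftrightarrow>
     (\<forall>x\<in>S. (f has_real_derivative f' x) (at x within S)) \<and>
     (\<forall>x\<in>S. (f' has_real_derivative f'' x) (at x within S)) \<and>
     continuous_on S f''"

definition finite_sup_norm :: "real set \<Rightarrow> (real \<Rightarrow> real) \<Rightarrow> bool" where
  "finite_sup_norm S g \<longleftrightarrow> (\<exists>C. \<forall>x\<in>S. \<bar>g x\<bar> \<le> C)"

definition finite_holder_norm :: "real \<Rightarrow> real set \<Rightarrow> (real \<Rightarrow> real) \<Rightarrow> bool" where
  "finite_holder_norm \<gamma> S g \<longleftrightarrow> finite_sup_norm S g \<and>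
     (\<exists>C. \<forall>x\<in>S. \<forall>y\<in>S. \<bar>g x - g y\<bar> \<le> C * \<bar>x - y\<bar> powr \<gamma>)"


text \<open>The exponents and the endpoints are indexed by the naturals 0 and 1.\<close>

definition mixed_kimura_operator ::
  "(real \<Rightarrow> real) \<Rightarrow> (real \<Rightarrow> real) \<Rightarrow> (nat \<Rightarrow> nat) \<Rightarrow> bool" where
  "mixed_kimura_operator a b m \<longleftrightarrow>
     smooth_on {0..1} a \<and> smooth_on {0..1} b \<and> (\<forall>x\<in>{0..1}. a x > 0) \<and>
     m 0 \<in> {1, 2} \<and> m 1 \<in> {1, 2} \<and>
     (m 0 = 1 \<longrightarrow> b 0 \<ge> 0) \<and> (m 1 = 1 \<longrightarrow> b 1 \<le> 0)"

definition kimura_L ::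
  "(real \<Rightarrow> real) \<Rightarrow> (real \<Rightarrow> real) \<Rightarrow> (nat \<Rightarrow> nat) \<Rightarrow> (real \<Rightarrow> real) \<Rightarrow> real \<Rightarrow> real" where
  "kimura_L a b m f x =
     a x * x ^ m 0 * (1 - x) ^ m 1 * deriv (deriv f) x +
     b x * x ^ (m 0 - 1) * (1 - x) ^ (m 1 - 1) * deriv f x"

definition kimura_end :: "(nat \<Rightarrow> nat) \<Rightarrow> nat \<Rightarrow> bool" where
  "kimura_end m i \<longleftrightarrow> m i = 1"

definition quadratic_end :: "(nat \<Rightarrow> nat) \<Rightarrow> nat \<Rightarrow> bool" where
  "quadratic_end m i \<longleftrightarrow> m i = 2"

definition tangent_end ::
  "(real \<Rightarrow> real) \<Rightarrow> (real \<Rightarrow> real) \<Rightarrow> (nat \<Rightarrow> nat) \<Rightarrow> nat \<Rightarrow> bool" where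
  "tangent_end a b m i \<longleftrightarrow>
     (if kimura_end m i then b (real i) = 0
      else if i = 0 then b 0 / a 0 < 1 else b 1 / a 1 > - 1)"

definition transverse_end ::
  "(real \<Rightarrow> real) \<Rightarrow> (real \<Rightarrow> real) \<Rightarrow> (nat \<Rightarrow> nat) \<Rightarrow> nat \<Rightarrow> bool" where
  "transverse_end a b m i \<longleftrightarrow>
     (if kimura_end m i then (if i = 0 then b 0 > 0 else b 1 < 0)
      else if i = 0 then b 0 / a 0 > 1 else b 1 / a 1 < - 1)"

datatype terminal_element = Endpoint nat | Whole_Interval

definition bP_ter ::
  "(real \<Rightarrow> real) \<Rightarrow> (real \<Rightarrow> real) \<Rightarrow> (nat \<Rightarrow> nat) \<Rightarrow> terminal_element set" where
  "bP_ter a b m =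
     (if transverse_end a b m 0 \<and> transverse_end a b m 1
      then insert Whole_Interval (Endpoint ` {i \<in> {0, 1}. quadratic_end m i})
      else Endpoint ` {i \<in> {0, 1}. quadratic_end m i \<or> kimura_end m i \<and> tangent_end a b m i})"


text \<open>A heat coordinate \<open>x = \<phi> t\<close> at the endpoint 0, over the open interval from 0 to 1/3:
  in the coordinate \<open>t \<in> J\<close> the operator has second-order coefficient \<open>t\<close> (Kimura) or \<open>1\<close>
  (quadratic) and some drift \<open>\<beta>\<close>. It is unique in the Kimura case, and unique up to
  translation in the quadratic case. Coordinates are taken separately at the two ends: if both
  ends are Kimura, both normalizations (\<open>t = 0\<close> at 0 and \<open>t = 1\<close> at 1) are rigid, and a single
  increasing coordinate on the whole interval need not realize both over the outer thirds.\<close>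

definition left_heat_coordinate ::
  "(real \<Rightarrow> real) \<Rightarrow> (real \<Rightarrow> real) \<Rightarrow> (nat \<Rightarrow> nat) \<Rightarrow> real set \<Rightarrow> (real \<Rightarrow> real) \<Rightarrow> bool" where
  "left_heat_coordinate a b m J \<phi> \<longleftrightarrow>
     (\<exists>d. J = (if kimura_end m 0 then {0<..<d} else {..<d})) \<and>
     (kimura_end m 0 \<longrightarrow> \<phi> 0 = 0) \<and>
     \<phi> ` J = {0<..<1/3} \<and>
     (\<exists>\<phi>' \<phi>''. C2_on J \<phi> \<phi>' \<phi>'' \<and> (\<forall>t\<in>J. \<phi>' t > 0)) \<and>
     (\<exists>\<beta>. \<forall>f. smooth_on {0<..<1} f \<longrightarrow> (\<forall>t\<in>J.
        kimura_L a b m f (\<phi> t) =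
          (if kimura_end m 0 then t else 1) * deriv (deriv (f \<circ> \<phi>)) t + \<beta> t * deriv (f \<circ> \<phi>) t))"

text \<open>The inner integral is a Henstock-Kurzweil integral over an unbounded interval, i.e.\ an
  improper integral; absolute convergence is not required.\<close>

definition finite_quadratic_holder_norm :: "real \<Rightarrow> bool \<Rightarrow> real \<Rightarrow> (real \<Rightarrow> real) \<Rightarrow> bool" where
  "finite_quadratic_holder_norm \<gamma> neutral c g \<longleftrightarrow>
     finite_holder_norm \<gamma> {..c} g \<and>
     (\<exists>C. \<forall>z1 z2. z1 \<le> z2 \<and> z2 \<le> c \<longrightarrow> \<bar>integral {z1..z2} g\<bar> \<le> C) \<and>
     (neutral \<longrightarrow>
        (\<forall>z\<le>c. g integrable_on {..z}) \<and>
        (\<exists>C. \<forall>z1 z2. z1 \<le> z2 \<and> z2 \<le> c \<longrightarrow>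
           \<bar>integral {z1..z2} (\<lambda>z. integral {..z} g)\<bar> \<le> C))"

definition quadratic_C2_holder :: "real \<Rightarrow> bool \<Rightarrow> real \<Rightarrow> (real \<Rightarrow> real) \<Rightarrow> bool" where
  "quadratic_C2_holder \<gamma> neutral c F \<longleftrightarrow> (\<exists>F' F''.
     C2_on {..c} F F' F'' \<and>
     (\<exists>l. (F \<longlongrightarrow> l) at_bot) \<and> (\<exists>l. (F' \<longlongrightarrow> l) at_bot) \<and> (\<exists>l. (F'' \<longlongrightarrow> l) at_bot) \<and>
     finite_sup_norm {..c} F \<and> finite_sup_norm {..c} F' \<and> finite_holder_norm \<gamma> {..c} F'' \<and>
     finite_quadratic_holder_norm \<gamma> neutral c F'')"

definition kimura_C2_holder :: "real \<Rightarrow> real \<Rightarrow> (real \<Rightarrow> real) \<Rightarrow> bool" where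
  "kimura_C2_holder \<gamma> c F \<longleftrightarrow> (\<exists>F' F''.
     (\<forall>t\<in>{0..c}. (F has_real_derivative F' t) (at t within {0..c})) \<and> continuous_on {0..c} F' \<and>
     C2_on {0<..c} F F' F'' \<and>
     ((\<lambda>t. t * F'' t) \<longlongrightarrow> 0) (at_right 0) \<and>
     finite_holder_norm \<gamma> {0<..c} F \<and> finite_holder_norm \<gamma> {0<..c} F' \<and>
     finite_holder_norm \<gamma> {0<..c} (\<lambda>t. t * F'' t))"

definition left_C2_holder ::
  "(real \<Rightarrow> real) \<Rightarrow> (real \<Rightarrow> real) \<Rightarrow> (nat \<Rightarrow> nat) \<Rightarrow> real \<Rightarrow> (real \<Rightarrow> real) \<Rightarrow> bool" where
  "left_C2_holder a b m \<gamma> f \<longleftrightarrow>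
     (\<exists>J \<phi>. left_heat_coordinate a b m J \<phi> \<and>
        (\<exists>c\<in>J. if kimura_end m 0 then kimura_C2_holder \<gamma> c (f \<circ> \<phi>)
               else quadratic_C2_holder \<gamma> (b 0 / a 0 = 1) c (f \<circ> \<phi>)))"

text \<open>Under the reflection of the unit interval the operator with data \<open>a\<close>, \<open>b\<close>, \<open>m\<close> becomes
  the one with data \<open>a (1 - x)\<close>, \<open>- b (1 - x)\<close>, \<open>m (1 - i)\<close>.\<close>

definition right_C2_holder ::
  "(real \<Rightarrow> real) \<Rightarrow> (real \<Rightarrow> real) \<Rightarrow> (nat \<Rightarrow> nat) \<Rightarrow> real \<Rightarrow> (real \<Rightarrow> real) \<Rightarrow> bool" where
  "right_C2_holder a b m \<gamma> f \<longleftrightarrow>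
     left_C2_holder (\<lambda>x. a (1 - x)) (\<lambda>x. - b (1 - x)) (\<lambda>i. m (1 - i)) \<gamma> (\<lambda>x. f (1 - x))"

text \<open>The interior condition is local, so it can be read in the variable \<open>x\<close>.\<close>

definition interior_C2_holder :: "real \<Rightarrow> (real \<Rightarrow> real) \<Rightarrow> bool" where
  "interior_C2_holder \<gamma> f \<longleftrightarrow> (\<forall>p q. 0 < p \<and> p < q \<and> q < 1 \<longrightarrow> (\<exists>f' f''.
     C2_on {p..q} f f' f'' \<and>
     finite_sup_norm {p..q} f \<and> finite_sup_norm {p..q} f' \<and> finite_holder_norm \<gamma> {p..q} f''))"

definition C2_holder ::
  "(real \<Rightarrow> real) \<Rightarrow> (real \<Rightarrow> real) \<Rightarrow> (nat \<Rightarrow> nat) \<Rightarrow> real \<Rightarrow> C0 set" where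
  "C2_holder a b m \<gamma> = {f. interior_C2_holder \<gamma> (on_line f) \<and>
     left_C2_holder a b m \<gamma> (on_line f) \<and> right_C2_holder a b m \<gamma> (on_line f)}"


text \<open>At the endpoints, where derivatives in \<open>x\<close> need not exist, \<open>L f\<close> is understood as the
  continuous extension from the interior.\<close>

definition graph_L ::
  "(real \<Rightarrow> real) \<Rightarrow> (real \<Rightarrow> real) \<Rightarrow> (nat \<Rightarrow> nat) \<Rightarrow> real \<Rightarrow> (C0 \<times> C0) set" where
  "graph_L a b m \<gamma> = {(f, g). f \<in> C2_holder a b m \<gamma> \<and>
     (\<forall>x\<in>{0<..<1}. on_line g x = kimura_L a b m (on_line f) x)}"

definition closure_L ::
  "(real \<Rightarrow> real) \<Rightarrow> (real \<Rightarrow> real) \<Rightarrow> (nat \<Rightarrow> nat) \<Rightarrow> real \<Rightarrow> (C0 \<times> C0) set" where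
  "closure_L a b m \<gamma> = closure (graph_L a b m \<gamma>)"

text \<open>Operators are identified with their graphs.\<close>

definition adjoint_graph ::
  "('a::real_normed_vector \<times> 'a) set \<Rightarrow> (('a \<Rightarrow>\<^sub>L real) \<times> ('a \<Rightarrow>\<^sub>L real)) set" where
  "adjoint_graph G =
     {(\<mu>, \<nu>). \<forall>(f, g)\<in>G. blinfun_apply \<mu> g = blinfun_apply \<nu> f}"

definition ker_graph :: "('a \<times> 'b::zero) set \<Rightarrow> 'a set" where
  "ker_graph G = {u. (u, 0) \<in> G}"

end

theory Submission
  imports Defs
begin

text \<open>A functional lies in the kernel of the adjoint of the closure if and only if it annihilates
  the range \<open>R\<close> of \<open>L\<close> on the Hoelder space. So the task is to find all measures that annihilate
  \<open>R\<close>. Let \<open>A\<close> and \<open>B\<close> be the second- and first-order coefficients of \<open>L\<close>, let \<open>W' = (B/A) W\<close> and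
  \<open>\<rho> = W/A\<close>. Then \<open>(W f')' = \<rho> L f\<close>. At \<open>0\<close>, \<open>W\<close> is comparable to \<open>x\<^sup>\<alpha>\<close> with \<open>\<alpha> = b(0)/a(0)\<close>, and the end is
  transverse if and only if \<open>\<alpha> > m(0) - 1\<close>, that is, if and only if \<open>\<rho>\<close> is integrable there. The end
  \<open>1\<close> is reduced to \<open>0\<close> by reflection.

  Annihilators that exist. By passing to the heat coordinate, the Hoelder space yields that \<open>f'\<close> is bounded
  near a Kimura end and that \<open>x f' \<longlonglongrightarrow> 0\<close> at a quadratic end. This suffices for two facts: \<open>L f\<close>
  vanishes at each end that is not Kimura transverse, because otherwise \<open>f'\<close> or \<open>x f'\<close> would grow
  logarithmically (\<open>graph_L_vanishes\<close>); and the flux \<open>W f'\<close> vanishes at each transverse end, so if both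
  ends are transverse then \<open>\<integral> \<rho> L f = 0\<close> (\<open>stationary_measure\<close>). The resulting point masses and the
  measure \<open>\<rho> dx\<close> are indexed by the terminal boundary.

  No further annihilators. If \<open>h\<close> has compact support in the open interval and \<open>\<integral> h \<rho> = 0\<close>, then
  \<open>f' = W\<^sup>-\<^sup>1 \<integral> h \<rho>\<close> also has compact support; hence \<open>f\<close> is constant near both ends, satisfies every
  boundary condition, and \<open>L f = h\<close> (\<open>compact_Lipschitz_in_range\<close>). An annihilator of \<open>R\<close> is therefore a
  multiple \<open>c \<rho> dx\<close> inside the interval, and \<open>c = 0\<close> if \<open>\<rho>\<close> has infinite mass, since the annihilator
  is bounded (\<open>annihilator_on_compact\<close>). Thus functions that are constant near the ends
  suffice at every end that is not Kimura transverse. What remains is a combination of two point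
  masses. At a Kimura transverse end the point mass is excluded by a single function: in the heat coordinate \<open>t\<close> it is \<open>- (c - t)\<^sup>4\<close>, and
  \<open>L\<close> does not annihilate it at the end (\<open>kimura_transverse_test_function\<close>).\<close>

section \<open>Continuous functions on the unit interval and their dual\<close>

lemma continuous_Abs_unit_interval: "continuous_on {0..1} Abs_unit_interval"
proof -
  have "dist (Abs_unit_interval x) (Abs_unit_interval y) = dist x y"
    if "x \<in> {0..1}" "y \<in> {0..1}" for x y
    using that by (simp add: dist_unit_interval.rep_eq Abs_unit_interval_inverse)
  then show ?thesis
    unfolding continuous_on_iff by metis
qed

lemma continuous_Rep_unit_interval: "continuous_on UNIV Rep_unit_interval"
  unfolding continuous_on_iff by (auto simp: dist_unit_interval.rep_eq)

lemma continuous_on_line: "continuous_on {0..1} (on_line g)"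
proof -
  have "continuous_on (Abs_unit_interval ` {0..1}) (apply_bcontfun g)"
    by (rule continuous_on_apply_bcontfun)
  then have "continuous_on {0..1} (apply_bcontfun g \<circ> Abs_unit_interval)"
    by (rule continuous_on_compose[OF continuous_Abs_unit_interval])
  then show ?thesis by (simp add: on_line_def comp_def)
qed

lemma on_line_linear [simp]:
  "on_line (f + g) x = on_line f x + on_line g x"
  "on_line (f - g) x = on_line f x - on_line g x"
  "on_line (k *\<^sub>R f) x = k * on_line f x"
  by (simp_all add: on_line_def)

lemma norm_ge_on_line: "\<bar>on_line g x\<bar> \<le> norm g"
  using norm_bounded[of g "Abs_unit_interval x"] by (simp add: on_line_def)

lemma norm_le_of_on_line:
  assumes "\<And>x. x \<in> {0..1} \<Longrightarrow> \<bar>on_line g x\<bar> \<le> C"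
  shows "norm g \<le> C"
proof (rule norm_bound)
  fix x :: unit_interval
  show "norm (apply_bcontfun g x) \<le> C"
    using assms[OF Rep_unit_interval[of x]] by (simp add: on_line_def Rep_unit_interval_inverse)
qed

definition of_line :: "(real \<Rightarrow> real) \<Rightarrow> C0" where
  "of_line f = Bcontfun (f \<circ> Rep_unit_interval)"

lemma on_line_of_line [simp]:
  assumes "continuous_on {0..1} f" and "x \<in> {0..1}"
  shows "on_line (of_line f) x = f x"
proof -
  have range: "range Rep_unit_interval = {0..1}"
    using type_definition.Rep_range[OF type_definition_unit_interval] .
  have "continuous_on UNIV (f \<circ> Rep_unit_interval)"
    by (rule continuous_on_compose[OF continuous_Rep_unit_interval]) (use assms(1) range in auto)
  moreover have "bounded (range (f \<circ> Rep_unit_interval))"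
    unfolding image_comp[symmetric] range
    by (rule compact_imp_bounded[OF compact_continuous_image[OF assms(1)]]) simp
  ultimately have "f \<circ> Rep_unit_interval \<in> bcontfun"
    by (simp add: bcontfun_def)
  then show ?thesis
    using assms(2)
    by (simp add: of_line_def on_line_def Bcontfun_inverse Abs_unit_interval_inverse)
qed

definition point_mass :: "real \<Rightarrow> C0 \<Rightarrow>\<^sub>L real" where
  "point_mass x = Blinfun (\<lambda>g. on_line g x)"

lemma point_mass_apply [simp]: "blinfun_apply (point_mass x) g = on_line g x"
proof -
  have "bounded_linear (\<lambda>g. on_line g x)"
    by (rule bounded_linear_intro[where K=1]) (simp_all add: norm_ge_on_line)
  then show ?thesis by (simp add: point_mass_def bounded_linear_Blinfun_apply)
qed

text \<open>The value is used only if \<open>\<rho>\<close> is absolutely integrable; otherwise the functional need not be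
  bounded and the definition is junk.\<close>

definition density_functional :: "(real \<Rightarrow> real) \<Rightarrow> C0 \<Rightarrow>\<^sub>L real" where
  "density_functional \<rho> = Blinfun (\<lambda>g. integral {0..1} (\<lambda>x. on_line g x * \<rho> x))"

lemma density_integrable:
  assumes "\<rho> absolutely_integrable_on {0..1}"
  shows "(\<lambda>x. on_line g x * \<rho> x) absolutely_integrable_on {0..1}"
proof (rule absolutely_integrable_bounded_measurable_product_real[OF _ _ _ assms])
  show "on_line g \<in> borel_measurable (lebesgue_on {0..1})"
    by (rule continuous_imp_measurable_on_sets_lebesgue[OF continuous_on_line]) simp
  show "bounded (on_line g ` {0..1})"
    by (rule compact_imp_bounded[OF compact_continuous_image[OF continuous_on_line]]) simp
qed simp

lemma density_functional_apply:
  assumes "\<rho> absolutely_integrable_on {0..1}"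
  shows "blinfun_apply (density_functional \<rho>) g = integral {0..1} (\<lambda>x. on_line g x * \<rho> x)"
proof -
  have int: "(\<lambda>x. on_line g x * \<rho> x) integrable_on {0..1}" for g
    using density_integrable[OF assms, of g] by (rule set_lebesgue_integral_eq_integral(1))
  have abs: "(\<lambda>x. \<bar>\<rho> x\<bar>) integrable_on {0..1}"
    using assms by (simp add: absolutely_integrable_on_def)
  have "bounded_linear (\<lambda>g. integral {0..1} (\<lambda>x. on_line g x * \<rho> x))"
  proof (rule bounded_linear_intro[where K="integral {0..1} (\<lambda>x. \<bar>\<rho> x\<bar>)"])
    fix f g :: C0 and k :: real
    show "integral {0..1} (\<lambda>x. on_line (f + g) x * \<rho> x)
        = integral {0..1} (\<lambda>x. on_line f x * \<rho> x) + integral {0..1} (\<lambda>x. on_line g x * \<rho> x)"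
      using integral_add[OF int[of f] int[of g]] by (simp add: algebra_simps)
    show "integral {0..1} (\<lambda>x. on_line (k *\<^sub>R f) x * \<rho> x)
        = k *\<^sub>R integral {0..1} (\<lambda>x. on_line f x * \<rho> x)"
      by (simp add: mult.assoc)
    have "(\<lambda>x. norm f * \<bar>\<rho> x\<bar>) integrable_on {0..1}"
      by (rule integrable_on_mult_right[OF abs])
    then have "norm (integral {0..1} (\<lambda>x. on_line f x * \<rho> x))
        \<le> integral {0..1} (\<lambda>x. norm f * \<bar>\<rho> x\<bar>)"
      by (rule integral_norm_bound_integral[OF int])
        (simp add: abs_mult mult_right_mono norm_ge_on_line)
    then show "norm (integral {0..1} (\<lambda>x. on_line f x * \<rho> x))
        \<le> norm f * integral {0..1} (\<lambda>x. \<bar>\<rho> x\<bar>)" by simp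
  qed
  then show ?thesis by (simp add: density_functional_def bounded_linear_Blinfun_apply)
qed

text \<open>Polynomials are Lipschitz on the unit interval and dense by Weierstrass, so a bounded
  functional is determined by its values on Lipschitz functions.\<close>

lemma functional_zero_if_zero_on_Lipschitz:
  fixes \<nu> :: "C0 \<Rightarrow>\<^sub>L real"
  assumes zero: "\<And>g C. C-lipschitz_on {0..1} (on_line g) \<Longrightarrow> blinfun_apply \<nu> g = 0"
  shows "\<nu> = 0"
proof (rule blinfun_eqI)
  fix g
  have "\<bar>blinfun_apply \<nu> g\<bar> \<le> norm \<nu> * e" if "e > 0" for e
  proof -
    obtain p where p: "real_polynomial_function p"
      and close: "\<And>x. x \<in> {0..1} \<Longrightarrow> \<bar>on_line g x - p x\<bar> < e"
      using Stone_Weierstrass_real_polynomial_function[OF _ continuous_on_line \<open>e > 0\<close>]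
      by (metis compact_Icc)
    obtain p' where p': "real_polynomial_function p'"
      "\<And>x. (p has_real_derivative p' x) (at x)"
      using has_real_derivative_polynomial_function[OF p] by auto
    have "compact (p' ` {0..1})"
      by (rule compact_continuous_image)
        (use p'(1) continuous_on_polymonial_function real_polynomial_function_eq in blast)+
    then have "bounded (p' ` {0..1})" by (rule compact_imp_bounded)
    then obtain C where C: "\<And>x. x \<in> {0..1} \<Longrightarrow> \<bar>p' x\<bar> \<le> C"
      unfolding bounded_iff by (metis imageI real_norm_def)
    have cont: "continuous_on {0..1} p"
      using p'(2) by (meson DERIV_continuous_on has_field_derivative_at_within)
    have "C-lipschitz_on {0..1} (on_line (of_line p))"
    proof (rule lipschitz_onI)
      fix x y :: real assume xy: "x \<in> {0..1}" "y \<in> {0..1}"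
      have "\<bar>p x - p y\<bar> \<le> C * \<bar>x - y\<bar>"
        using field_differentiable_bound[of "{0..1}" p p' C x y] p'(2) C xy
        by (auto intro: has_field_derivative_at_within)
      then show "dist (on_line (of_line p) x) (on_line (of_line p) y) \<le> C * dist x y"
        using xy cont by (simp add: dist_real_def)
    qed (use C[of 0] in auto)
    then have "blinfun_apply \<nu> (of_line p) = 0" by (rule zero)
    then have "\<bar>blinfun_apply \<nu> g\<bar> = norm (blinfun_apply \<nu> (g - of_line p))"
      by (simp add: blinfun.diff_right)
    also have "\<dots> \<le> norm \<nu> * norm (g - of_line p)" by (rule norm_blinfun)
    also have "\<dots> \<le> norm \<nu> * e"
      by (rule mult_left_mono, rule norm_le_of_on_line)
        (use close cont in \<open>auto intro: less_imp_le\<close>)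
    finally show ?thesis .
  qed
  then have "eventually (\<lambda>e. \<bar>blinfun_apply \<nu> g\<bar> \<le> norm \<nu> * e) (at_right 0)"
    unfolding eventually_at_right_field by (intro exI[of _ 1]) auto
  moreover have "((\<lambda>e. norm \<nu> * e) \<longlongrightarrow> norm \<nu> * 0) (at_right 0)"
    by (intro tendsto_intros)
  ultimately have "\<bar>blinfun_apply \<nu> g\<bar> \<le> norm \<nu> * 0"
    by (intro tendsto_lowerbound) auto
  then show "blinfun_apply \<nu> g = blinfun_apply 0 g" by simp
qed

text \<open>Testing against a biorthogonal family in the predual gives both independence and
  the dimension of an annihilator.\<close>

lemma dim_eq_card_biorthogonal:
  fixes v :: "'i \<Rightarrow> 'a::real_normed_vector \<Rightarrow>\<^sub>L real" and w :: "'i \<Rightarrow> 'a"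
  assumes "finite S"
    and dual: "\<And>s t. s \<in> S \<Longrightarrow> t \<in> S \<Longrightarrow> blinfun_apply (v s) (w t) = (if s = t then 1 else 0)"
    and mem: "\<And>s. s \<in> S \<Longrightarrow> v s \<in> V"
    and sub: "\<And>\<mu>. \<mu> \<in> V \<Longrightarrow> \<exists>c. \<mu> = (\<Sum>s\<in>S. c s *\<^sub>R v s)"
  shows "dim V = card S"
proof (rule dim_unique)
  have inj: "inj_on v S"
    by (rule inj_onI) (metis dual zero_neq_one)
  show "card (v ` S) = card S" using inj by (rule card_image)
  show "v ` S \<subseteq> V" using mem by auto
  show "V \<subseteq> span (v ` S)"
  proof
    fix \<mu> assume "\<mu> \<in> V"
    then obtain c where "\<mu> = (\<Sum>s\<in>S. c s *\<^sub>R v s)" using sub by blast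
    then show "\<mu> \<in> span (v ` S)" by (metis (no_types, lifting) imageI span_base span_scale span_sum)
  qed
  show "independent (v ` S)"
  proof (rule independent_if_scalars_zero)
    show "finite (v ` S)" using \<open>finite S\<close> by simp
    fix f x assume *: "(\<Sum>x\<in>v ` S. f x *\<^sub>R x) = 0" and "x \<in> v ` S"
    then obtain t where t: "t \<in> S" "x = v t" by auto
    have "(\<Sum>s\<in>S. f (v s) *\<^sub>R v s) = 0"
      using * by (simp add: sum.reindex[OF inj])
    then have "blinfun_apply (\<Sum>s\<in>S. f (v s) *\<^sub>R v s) (w t) = 0"
      by simp
    then have "(\<Sum>s\<in>S. f (v s) * blinfun_apply (v s) (w t)) = 0"
      by (simp add: blinfun.sum_left blinfun.scaleR_left)
    also have "(\<Sum>s\<in>S. f (v s) * blinfun_apply (v s) (w t)) = (\<Sum>s\<in>S. if s = t then f (v t) else 0)"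
      by (rule sum.cong) (use dual t in auto)
    finally show "f x = 0" using t \<open>finite S\<close> by (simp add: sum.delta)
  qed
qed

text \<open>Since \<open>\<mu>\<close> is continuous, annihilating the range of an operator and of its closure is the same.\<close>

lemma mem_ker_adjoint_closure_iff:
  "\<mu> \<in> ker_graph (adjoint_graph (closure G)) \<longleftrightarrow> (\<forall>(f, g)\<in>G. blinfun_apply \<mu> g = 0)"
proof
  assume "\<mu> \<in> ker_graph (adjoint_graph (closure G))"
  then show "\<forall>(f, g)\<in>G. blinfun_apply \<mu> g = 0"
    using closure_subset[of G] by (fastforce simp: ker_graph_def adjoint_graph_def)
next
  assume *: "\<forall>(f, g)\<in>G. blinfun_apply \<mu> g = 0"
  have "closed {p. blinfun_apply \<mu> (snd p) = 0}"
    by (intro closed_Collect_eq continuous_intros)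
  moreover have "G \<subseteq> {p. blinfun_apply \<mu> (snd p) = 0}" using * by auto
  ultimately have "closure G \<subseteq> {p. blinfun_apply \<mu> (snd p) = 0}" by (rule closure_minimal[rotated])
  then show "\<mu> \<in> ker_graph (adjoint_graph (closure G))"
    by (auto simp: ker_graph_def adjoint_graph_def)
qed

section \<open>Hoelder norms and twice continuously differentiable functions\<close>

text \<open>At distance at most \<open>1\<close> the Lipschitz bound dominates because \<open>\<gamma> < 1\<close>; at larger distance the
  bound \<open>2 M\<close> on the oscillation does.\<close>

lemma finite_holder_norm_Lipschitz:
  assumes "0 < \<gamma>" "\<gamma> < 1"
    and M: "\<And>x. x \<in> S \<Longrightarrow> \<bar>g x\<bar> \<le> M"
    and K: "\<And>x y. x \<in> S \<Longrightarrow> y \<in> S \<Longrightarrow> \<bar>g x - g y\<bar> \<le> K * \<bar>x - y\<bar>"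
  shows "finite_holder_norm \<gamma> S g"
  unfolding finite_holder_norm_def finite_sup_norm_def
proof (intro conjI exI ballI)
  show "x \<in> S \<Longrightarrow> \<bar>g x\<bar> \<le> M" for x by (rule M)
  fix x y assume xy: "x \<in> S" "y \<in> S"
  have M0: "0 \<le> M" using M[OF xy(1)] by linarith
  show "\<bar>g x - g y\<bar> \<le> (\<bar>K\<bar> + 2 * M) * \<bar>x - y\<bar> powr \<gamma>"
  proof (cases "\<bar>x - y\<bar> \<le> 1")
    case True
    have "\<bar>g x - g y\<bar> \<le> \<bar>K\<bar> * \<bar>x - y\<bar>"
      using K[OF xy] by (smt (verit) mult_right_mono abs_ge_zero)
    also have "\<dots> \<le> \<bar>K\<bar> * \<bar>x - y\<bar> powr \<gamma>"
      using powr_mono'[of \<gamma> 1 "\<bar>x - y\<bar>"] True assms by (intro mult_left_mono) auto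
    also have "\<dots> \<le> (\<bar>K\<bar> + 2 * M) * \<bar>x - y\<bar> powr \<gamma>"
      using M0 by (intro mult_right_mono) auto
    finally show ?thesis .
  next
    case False
    have "\<bar>g x - g y\<bar> \<le> 2 * M * 1" using M[OF xy(1)] M[OF xy(2)] by linarith
    also have "\<dots> \<le> (\<bar>K\<bar> + 2 * M) * \<bar>x - y\<bar> powr \<gamma>"
      using M0 False ge_one_powr_ge_zero[of "\<bar>x - y\<bar>" \<gamma>] assms by (intro mult_mono) auto
    finally show ?thesis .
  qed
qed

lemma finite_holder_norm_C1:
  assumes "0 < \<gamma>" "\<gamma> < 1"
    and d: "\<And>x. x \<in> {p..q} \<Longrightarrow> (g has_real_derivative g' x) (at x within {p..q})"
    and c: "continuous_on {p..q} g'"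
  shows "finite_holder_norm \<gamma> {p..q} g"
proof -
  have "bounded (g ` {p..q})" "bounded (g' ` {p..q})"
    using c DERIV_continuous_on[OF d] by (auto intro!: compact_imp_bounded compact_continuous_image)
  then obtain M K where M: "\<And>x. x \<in> {p..q} \<Longrightarrow> \<bar>g x\<bar> \<le> M"
    and K: "\<And>x. x \<in> {p..q} \<Longrightarrow> \<bar>g' x\<bar> \<le> K"
    unfolding bounded_iff by (metis imageI real_norm_def)
  show ?thesis
  proof (rule finite_holder_norm_Lipschitz[OF assms(1,2) M])
    fix x y assume "x \<in> {p..q}" "y \<in> {p..q}"
    then show "\<bar>g x - g y\<bar> \<le> K * \<bar>x - y\<bar>"
      using field_differentiable_bound[of "{p..q}" g g' K x y] d K by auto
  qed
qed

lemma finite_holder_norm_add: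
  assumes "finite_holder_norm \<gamma> S f" "finite_holder_norm \<gamma> S g"
  shows "finite_holder_norm \<gamma> S (\<lambda>x. f x + g x)"
proof -
  obtain M C where f: "\<And>x. x \<in> S \<Longrightarrow> \<bar>f x\<bar> \<le> M"
    "\<And>x y. x \<in> S \<Longrightarrow> y \<in> S \<Longrightarrow> \<bar>f x - f y\<bar> \<le> C * \<bar>x - y\<bar> powr \<gamma>"
    using assms(1) unfolding finite_holder_norm_def finite_sup_norm_def by metis
  obtain N D where g: "\<And>x. x \<in> S \<Longrightarrow> \<bar>g x\<bar> \<le> N"
    "\<And>x y. x \<in> S \<Longrightarrow> y \<in> S \<Longrightarrow> \<bar>g x - g y\<bar> \<le> D * \<bar>x - y\<bar> powr \<gamma>"
    using assms(2) unfolding finite_holder_norm_def finite_sup_norm_def by metis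
  show ?thesis
    unfolding finite_holder_norm_def finite_sup_norm_def
  proof (intro conjI exI ballI)
    show "\<bar>f x + g x\<bar> \<le> M + N" if "x \<in> S" for x using f(1)[OF that] g(1)[OF that] by linarith
    show "\<bar>f x + g x - (f y + g y)\<bar> \<le> (C + D) * \<bar>x - y\<bar> powr \<gamma>" if "x \<in> S" "y \<in> S" for x y
      using f(2)[OF that] g(2)[OF that] by (simp add: distrib_right)
  qed
qed

lemma finite_holder_norm_mult:
  assumes "finite_holder_norm \<gamma> S f" "finite_holder_norm \<gamma> S g"
  shows "finite_holder_norm \<gamma> S (\<lambda>x. f x * g x)"
proof -
  obtain M C where f: "\<And>x. x \<in> S \<Longrightarrow> \<bar>f x\<bar> \<le> M"
    "\<And>x y. x \<in> S \<Longrightarrow> y \<in> S \<Longrightarrow> \<bar>f x - f y\<bar> \<le> C * \<bar>x - y\<bar> powr \<gamma>"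
    using assms(1) unfolding finite_holder_norm_def finite_sup_norm_def by metis
  obtain N D where g: "\<And>x. x \<in> S \<Longrightarrow> \<bar>g x\<bar> \<le> N"
    "\<And>x y. x \<in> S \<Longrightarrow> y \<in> S \<Longrightarrow> \<bar>g x - g y\<bar> \<le> D * \<bar>x - y\<bar> powr \<gamma>"
    using assms(2) unfolding finite_holder_norm_def finite_sup_norm_def by metis
  show ?thesis
    unfolding finite_holder_norm_def finite_sup_norm_def
  proof (intro conjI exI ballI)
    fix x assume x: "x \<in> S"
    have "0 \<le> M" using f(1)[OF x] by linarith
    then show "\<bar>f x * g x\<bar> \<le> M * N"
      unfolding abs_mult using f(1)[OF x] g(1)[OF x] by (intro mult_mono) auto
    fix y assume y: "y \<in> S"
    have "\<bar>f x * g x - f y * g y\<bar> = \<bar>f x * (g x - g y) + (f x - f y) * g y\<bar>"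
      by (simp add: algebra_simps)
    also have "\<dots> \<le> \<bar>f x\<bar> * \<bar>g x - g y\<bar> + \<bar>f x - f y\<bar> * \<bar>g y\<bar>"
      by (metis abs_mult abs_triangle_ineq)
    also have "\<dots> \<le> M * (D * \<bar>x - y\<bar> powr \<gamma>) + (C * \<bar>x - y\<bar> powr \<gamma>) * N"
      using f(1)[OF x] f(2)[OF x y] g(1)[OF y] g(2)[OF x y]
      by (intro add_mono mult_mono) linarith+
    finally show "\<bar>f x * g x - f y * g y\<bar> \<le> (M * D + C * N) * \<bar>x - y\<bar> powr \<gamma>"
      by (simp add: algebra_simps)
  qed
qed

lemma has_real_derivative_cong_on:
  assumes "(g has_real_derivative D) (at x within S)" "x \<in> S" "\<And>y. y \<in> S \<Longrightarrow> f y = g y"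
  shows "(f has_real_derivative D) (at x within S)"
  using has_field_derivative_transform_within[OF assms(1), of 1 f] assms(2,3) by auto

lemma C2_on_cong:
  assumes "C2_on S g g' g''" "\<And>x. x \<in> S \<Longrightarrow> f x = g x"
  shows "C2_on S f g' g''"
  using assms unfolding C2_on_def by (meson has_real_derivative_cong_on)

lemma C2_on_subset: "C2_on S f f' f'' \<Longrightarrow> T \<subseteq> S \<Longrightarrow> C2_on T f f' f''"
  unfolding C2_on_def by (meson DERIV_subset continuous_on_subset subsetD)

lemma C2_on_mult:
  assumes "C2_on S f f' f''" "C2_on S g g' g''"
  shows "C2_on S (\<lambda>x. f x * g x) (\<lambda>x. f' x * g x + f x * g' x)
    (\<lambda>x. f'' x * g x + 2 * f' x * g' x + f x * g'' x)"
proof -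
  have "continuous_on S f" "continuous_on S f'" "continuous_on S g" "continuous_on S g'"
    using assms unfolding C2_on_def by (blast intro: DERIV_continuous_on)+
  then show ?thesis
    using assms unfolding C2_on_def by (auto intro!: derivative_eq_intros continuous_intros)
qed

lemma C2_on_open_deriv:
  assumes "open S" "C2_on S f f' f''" "x \<in> S"
  shows "deriv f x = f' x" "deriv (deriv f) x = f'' x"
    "(f has_real_derivative f' x) (at x)" "(f' has_real_derivative f'' x) (at x)"
proof -
  have f: "\<And>y. y \<in> S \<Longrightarrow> (f has_real_derivative f' y) (at y within S)"
    and f': "\<And>y. y \<in> S \<Longrightarrow> (f' has_real_derivative f'' y) (at y within S)"
    using assms(2) by (auto simp: C2_on_def)
  have d: "(f has_real_derivative f' y) (at y)" if "y \<in> S" for y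
    using f[OF that] by (simp only: at_within_open[OF that assms(1)])
  show d': "(f' has_real_derivative f'' x) (at x)"
    using f'[OF assms(3)] by (simp only: at_within_open[OF assms(3,1)])
  show "deriv f x = f' x" "(f has_real_derivative f' x) (at x)"
    using d[OF assms(3)] by (auto intro: DERIV_imp_deriv)
  have "(deriv f has_real_derivative f'' x) (at x)"
    by (rule has_field_derivative_transform_within_open[OF d' assms(1,3)])
      (simp add: DERIV_imp_deriv[OF d])
  then show "deriv (deriv f) x = f'' x" by (rule DERIV_imp_deriv)
qed

lemma C2_on_compose:
  assumes "open S" "open T" "C2_on S f f' f''" "C2_on T \<phi> \<phi>' \<phi>''" "\<phi> ` T \<subseteq> S"
  shows "C2_on T (f \<circ> \<phi>) (\<lambda>t. f' (\<phi> t) * \<phi>' t) (\<lambda>t. f'' (\<phi> t) * \<phi>' t ^ 2 + f' (\<phi> t) * \<phi>'' t)"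
proof -
  have c: "continuous_on T \<phi>" "continuous_on T \<phi>'" "continuous_on T \<phi>''"
    using assms(4) unfolding C2_on_def by (blast intro: DERIV_continuous_on)+
  have "continuous_on S f'" "continuous_on S f''"
    using assms(3) unfolding C2_on_def by (blast intro: DERIV_continuous_on)+
  then have "continuous_on T (\<lambda>t. f' (\<phi> t))" "continuous_on T (\<lambda>t. f'' (\<phi> t))"
    using c(1) assms(5) by (auto intro: continuous_on_compose2)
  then have "continuous_on T (\<lambda>t. f'' (\<phi> t) * \<phi>' t ^ 2 + f' (\<phi> t) * \<phi>'' t)"
    using c by (intro continuous_intros)
  moreover have "(f \<circ> \<phi> has_real_derivative f' (\<phi> t) * \<phi>' t) (at t within T)"
    "((\<lambda>t. f' (\<phi> t) * \<phi>' t) has_real_derivative f'' (\<phi> t) * \<phi>' t ^ 2 + f' (\<phi> t) * \<phi>'' t) (at t within T)"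
    if t: "t \<in> T" for t
  proof -
    have x: "\<phi> t \<in> S" using assms(5) t by auto
    note F = C2_on_open_deriv[OF assms(1,3) x] and P = C2_on_open_deriv[OF assms(2,4) t]
    show "(f \<circ> \<phi> has_real_derivative f' (\<phi> t) * \<phi>' t) (at t within T)"
      by (rule has_field_derivative_at_within[OF DERIV_chain[OF F(3) P(3)]])
    have "((\<lambda>t. f' (\<phi> t)) has_real_derivative f'' (\<phi> t) * \<phi>' t) (at t)"
      by (rule DERIV_chain2[OF F(4) P(3)])
    from DERIV_mult[OF this P(4)]
    have "((\<lambda>t. f' (\<phi> t) * \<phi>' t) has_real_derivative f'' (\<phi> t) * \<phi>' t ^ 2 + f' (\<phi> t) * \<phi>'' t) (at t)"
      by (rule DERIV_cong) (simp add: power2_eq_square algebra_simps)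
    then show "((\<lambda>t. f' (\<phi> t) * \<phi>' t) has_real_derivative f'' (\<phi> t) * \<phi>' t ^ 2 + f' (\<phi> t) * \<phi>'' t) (at t within T)"
      by (rule has_field_derivative_at_within)
  qed
  ultimately show ?thesis unfolding C2_on_def by simp
qed

lemma smooth_on_C2:
  assumes "smooth_on S f"
  obtains f' f'' where "C2_on S f f' f''"
proof -
  obtain D where D: "\<forall>x\<in>S. D 0 x = f x"
    "\<forall>n. \<forall>x\<in>S. (D n has_real_derivative D (Suc n) x) (at x within S)"
    using assms unfolding smooth_on_def by blast
  have "(f has_real_derivative D 1 x) (at x within S)" if "x \<in> S" for x
    by (rule has_real_derivative_cong_on[of "D 0"]) (use D that in auto)
  moreover have "continuous_on S (D (Suc (Suc 0)))"
    using D(2) by (intro DERIV_continuous_on) auto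
  ultimately show ?thesis using D(2) by (intro that) (auto simp: C2_on_def)
qed

text \<open>If \<open>x u'\<close> had a limit \<open>l > 0\<close>, then \<open>u - (l/2) ln x\<close> would increase near \<open>0\<close>, and \<open>u\<close> would tend to
  \<open>-\<infinity>\<close>. This is the mechanism that forces \<open>L f\<close> to vanish at an end.\<close>

lemma bounded_imp_log_slope_zero:
  assumes d: "\<And>x. 0 < x \<Longrightarrow> x < e \<Longrightarrow> (u has_real_derivative u' x) (at x)"
    and bd: "\<And>x. 0 < x \<Longrightarrow> x < e \<Longrightarrow> \<bar>u x\<bar> \<le> M" and e: "0 < e"
    and lim: "((\<lambda>x. x * u' x) \<longlongrightarrow> l) (at_right 0)"
  shows "l = 0"
proof -
  have no: "\<not> l > 0"
    if d: "\<And>x. 0 < x \<Longrightarrow> x < e \<Longrightarrow> (u has_real_derivative u' x) (at x)"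
      and bd: "\<And>x. 0 < x \<Longrightarrow> x < e \<Longrightarrow> \<bar>u x\<bar> \<le> M"
      and lim: "((\<lambda>x. x * u' x) \<longlongrightarrow> l) (at_right 0)" for u u' l
  proof
    assume "l > 0"
    then have "eventually (\<lambda>x. x * u' x > l / 2) (at_right 0)"
      using lim by (intro order_tendstoD) auto
    then obtain \<delta> where \<delta>: "\<delta> > 0" "\<And>x. 0 < x \<Longrightarrow> x < \<delta> \<Longrightarrow> x * u' x > l / 2"
      unfolding eventually_at_right_field by auto
    define x1 where "x1 = min e \<delta> / 2"
    have x1: "0 < x1" "x1 < e" "x1 < \<delta>" using e \<delta>(1) by (auto simp: x1_def)
    have step: "u x - l / 2 * ln x \<le> u x1 - l / 2 * ln x1" if "0 < x" "x \<le> x1" for x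
    proof (rule DERIV_nonneg_imp_nondecreasing[OF that(2)])
      fix y assume y: "x \<le> y" "y \<le> x1"
      then have y': "0 < y" "y < e" "y < \<delta>" using that x1 by auto
      have "((\<lambda>x. u x - l / 2 * ln x) has_real_derivative u' y - l / 2 * (1 / y)) (at y)"
        using d[OF y'(1,2)] y' by (auto intro!: derivative_eq_intros)
      moreover have "0 \<le> u' y - l / 2 * (1 / y)"
        using \<delta>(2)[OF y'(1,3)] y' by (simp add: field_simps)
      ultimately show "\<exists>z. ((\<lambda>x. u x - l / 2 * ln x) has_real_derivative z) (at y) \<and> 0 \<le> z"
        by blast
    qed
    define K where "K = 2 / l * (2 * M + 1)"
    \<comment> \<open>At this point \<open>(l/2) ln x\<close> is \<open>2 M + 1\<close> below its value at \<open>x1\<close>, more than \<open>u\<close> can decrease.\<close>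
    define x where "x = x1 * exp (- K)"
    have M: "0 \<le> M" using bd[OF x1(1,2)] by linarith
    then have "0 < x" "x \<le> x1"
      using x1 \<open>l > 0\<close> by (auto simp: x_def K_def mult_le_cancel_left1)
    moreover from this have "\<bar>u x\<bar> \<le> M" "\<bar>u x1\<bar> \<le> M" using bd x1 by auto
    moreover have "l / 2 * ln x = l / 2 * ln x1 - (2 * M + 1)"
      using x1 \<open>l > 0\<close> by (simp add: x_def ln_mult K_def field_simps)
    ultimately show False using step[of x] by linarith
  qed
  have "\<not> l > 0" by (rule no[OF d bd lim])
  moreover have "\<not> - l > 0"
  proof (rule no)
    show "((\<lambda>x. - u x) has_real_derivative - u' x) (at x)" if "0 < x" "x < e" for x
      using d[OF that] by (rule DERIV_minus)
    show "((\<lambda>x. x * - u' x) \<longlongrightarrow> - l) (at_right 0)"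
      using tendsto_minus[OF lim] by simp
  qed (use bd in auto)
  ultimately show ?thesis by linarith
qed

lemma tendsto_mult_zero_bounded:
  fixes f g :: "'a \<Rightarrow> real"
  assumes f: "(f \<longlongrightarrow> 0) F" and g: "eventually (\<lambda>x. \<bar>g x\<bar> \<le> M) F"
  shows "((\<lambda>x. f x * g x) \<longlongrightarrow> 0) F"
proof (rule Lim_null_comparison)
  show "eventually (\<lambda>x. norm (f x * g x) \<le> \<bar>f x\<bar> * M) F"
    using g by eventually_elim (simp add: abs_mult mult_left_mono)
  show "((\<lambda>x. \<bar>f x\<bar> * M) \<longlongrightarrow> 0) F"
    using tendsto_mult_right[OF tendsto_rabs_zero[OF f], of M] by simp
qed

text \<open>By the mean value theorem \<open>F'\<close> takes the value \<open>F(t) - F(t - 1)\<close> between \<open>t - 1\<close> and \<open>t\<close>, which tends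
  to \<open>0\<close>. This is what membership in the quadratic space says about \<open>F'\<close> at the end.\<close>

lemma tendsto_deriv_zero_at_bot:
  fixes F :: "real \<Rightarrow> real"
  assumes d: "\<And>t. t < c \<Longrightarrow> (F has_real_derivative F' t) (at t)"
    and F: "(F \<longlongrightarrow> l) at_bot" and F': "(F' \<longlongrightarrow> k) at_bot"
  shows "k = 0"
proof -
  have "((\<lambda>t. F (t - 1)) \<longlongrightarrow> l) at_bot"
  proof (rule filterlim_compose[OF F])
    have "\<exists>N. \<forall>n\<le>N. n - 1 \<le> Z" for Z :: real
      by (rule exI[of _ Z]) auto
    then show "filterlim (\<lambda>t::real. t - 1) at_bot at_bot"
      unfolding filterlim_at_bot eventually_at_bot_linorder by blast
  qed
  from tendsto_diff[OF F this] have diff: "((\<lambda>t. F t - F (t - 1)) \<longlongrightarrow> 0) at_bot" by simp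
  have "\<exists>z. t < c \<longrightarrow> t - 1 < z \<and> z < t \<and> F t - F (t - 1) = F' z" for t
    using MVT2[of "t - 1" t F F'] d by force
  then obtain z where z: "\<And>t. t < c \<Longrightarrow> t - 1 < z t \<and> z t < t \<and> F t - F (t - 1) = F' (z t)"
    by metis
  have "filterlim z at_bot at_bot"
    unfolding filterlim_at_bot eventually_at_bot_linorder
  proof
    fix Z
    show "\<exists>N. \<forall>n\<le>N. z n \<le> Z"
    proof (intro exI allI impI)
      fix n assume "n \<le> min Z (c - 1)"
      then show "z n \<le> Z" using z[of n] by auto
    qed
  qed
  then have "((\<lambda>t. F' (z t)) \<longlongrightarrow> k) at_bot" by (rule filterlim_compose[OF F'])
  moreover have "eventually (\<lambda>t. F' (z t) = F t - F (t - 1)) at_bot"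
    using z unfolding eventually_at_bot_linorder by (intro exI[of _ "c - 1"]) force
  ultimately have "((\<lambda>t. F t - F (t - 1)) \<longlongrightarrow> k) at_bot"
    by (simp cong: tendsto_cong)
  with diff show ?thesis using tendsto_unique trivial_limit_at_bot_linorder by blast
qed

section \<open>The coefficients and the speed measure near an end\<close>

text \<open>\<open>W\<close> solves \<open>W' = (B/A) W\<close>: the common powers of \<open>x\<close> and \<open>1 - x\<close> in \<open>B\<close> and \<open>A\<close> cancel except for one
  factor each. The function \<open>1/W\<close> is the derivative of the scale function of the diffusion.\<close>

definition integrating_factor :: "(real \<Rightarrow> real) \<Rightarrow> (real \<Rightarrow> real) \<Rightarrow> (real \<Rightarrow> real) \<Rightarrow> bool" where
  "integrating_factor a b W \<longleftrightarrow> (\<forall>x\<in>{0<..<1}. 0 < W x \<and>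
     (W has_real_derivative b x / (a x * x * (1 - x)) * W x) (at x))"

locale kimura_operator =
  fixes a b :: "real \<Rightarrow> real" and m :: "nat \<Rightarrow> nat"
  assumes mixed: "mixed_kimura_operator a b m"
begin

definition diffusion :: "real \<Rightarrow> real" where
  "diffusion x = a x * x ^ m 0 * (1 - x) ^ m 1"

definition drift :: "real \<Rightarrow> real" where
  "drift x = b x * x ^ (m 0 - 1) * (1 - x) ^ (m 1 - 1)"

text \<open>The exponent of the integrating factor at \<open>0\<close>.\<close>

definition end_exponent :: real where
  "end_exponent = b 0 / a 0"

lemma kimura_L_eq:
  "kimura_L a b m f x = diffusion x * deriv (deriv f) x + drift x * deriv f x"
  by (simp add: kimura_L_def diffusion_def drift_def)

lemma m_cases: "m 0 = 1 \<or> m 0 = 2" "m 1 = 1 \<or> m 1 = 2"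
  using mixed by (auto simp: mixed_kimura_operator_def)

lemma a_pos: "x \<in> {0..1} \<Longrightarrow> 0 < a x"
  using mixed by (auto simp: mixed_kimura_operator_def)

lemma C2_a: obtains a' a'' where "C2_on {0..1} a a' a''"
  using mixed smooth_on_C2 unfolding mixed_kimura_operator_def by metis

lemma C2_b: obtains b' b'' where "C2_on {0..1} b b' b''"
  using mixed smooth_on_C2 unfolding mixed_kimura_operator_def by metis

lemma continuous_a: "continuous_on {0..1} a"
  using C2_a unfolding C2_on_def by (metis DERIV_continuous_on)

lemma continuous_b: "continuous_on {0..1} b"
  using C2_b unfolding C2_on_def by (metis DERIV_continuous_on)

lemma tendsto_at_zero:
  assumes "continuous_on {0..1} (f :: real \<Rightarrow> real)"
  shows "(f \<longlongrightarrow> f 0) (at_right 0)"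
proof -
  have "(f \<longlongrightarrow> f 0) (at 0 within {0..1})"
    using assms by (simp add: continuous_on_def)
  then show ?thesis
    by (simp add: at_within_Icc_at_right)
qed

lemma diffusion_pos: "x \<in> {0<..<1} \<Longrightarrow> 0 < diffusion x"
  using a_pos[of x] by (simp add: diffusion_def)

lemma continuous_diffusion: "continuous_on {0..1} diffusion"
  unfolding diffusion_def by (intro continuous_intros continuous_a)

lemma diffusion_bounds:
  obtains c C where "0 < c" "\<And>x. x \<in> {0<..1/2} \<Longrightarrow> c * x ^ m 0 \<le> diffusion x"
    "\<And>x. x \<in> {0<..1/2} \<Longrightarrow> diffusion x \<le> C * x ^ m 0"
proof -
  have cont: "continuous_on {0..1/2} (\<lambda>x. a x * (1 - x) ^ m 1)"
    by (intro continuous_intros continuous_on_subset[OF continuous_a]) auto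
  have ne: "compact {0..1/2::real}" "{0..1/2::real} \<noteq> {}" by auto
  obtain p where p: "p \<in> {0..1/2}" "\<And>x. x \<in> {0..1/2} \<Longrightarrow> a p * (1 - p) ^ m 1 \<le> a x * (1 - x) ^ m 1"
    using continuous_attains_inf[OF ne cont] by metis
  obtain q where q: "\<And>x. x \<in> {0..1/2} \<Longrightarrow> a x * (1 - x) ^ m 1 \<le> a q * (1 - q) ^ m 1"
    using continuous_attains_sup[OF ne cont] by metis
  show ?thesis
  proof (rule that)
    show "0 < a p * (1 - p) ^ m 1" using p(1) a_pos[of p] by auto
    fix x :: real assume x: "x \<in> {0<..1/2}"
    have eq: "diffusion x = (a x * (1 - x) ^ m 1) * x ^ m 0" by (simp add: diffusion_def)
    show "(a p * (1 - p) ^ m 1) * x ^ m 0 \<le> diffusion x"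
      unfolding eq by (rule mult_right_mono) (use x p(2)[of x] in auto)
    show "diffusion x \<le> (a q * (1 - q) ^ m 1) * x ^ m 0"
      unfolding eq by (rule mult_right_mono) (use x q[of x] in auto)
  qed
qed

lemma transverse_left_iff: "transverse_end a b m 0 \<longleftrightarrow> real (m 0) - 1 < end_exponent"
  using m_cases(1) a_pos[of 0]
  by (auto simp: transverse_end_def kimura_end_def end_exponent_def zero_less_divide_iff)

lemma kimura_not_transverse_left: "m 0 = 1 \<Longrightarrow> \<not> transverse_end a b m 0 \<Longrightarrow> b 0 = 0"
  using mixed by (auto simp: mixed_kimura_operator_def transverse_end_def kimura_end_def)

text \<open>The drift ratio \<open>b / (a (1 - x))\<close> differs from its boundary value by \<open>O(x)\<close>, so
  \<open>ln W - \<alpha> ln x\<close> has bounded derivative near \<open>0\<close>.\<close>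

lemma integrating_factor_bounds:
  assumes W: "integrating_factor a b W"
  obtains c C where "0 < c" "\<And>x. x \<in> {0<..1/2} \<Longrightarrow> c * x powr end_exponent \<le> W x"
    "\<And>x. x \<in> {0<..1/2} \<Longrightarrow> W x \<le> C * x powr end_exponent"
proof -
  obtain a' a'' where a': "C2_on {0..1} a a' a''" by (rule C2_a)
  obtain b' b'' where b': "C2_on {0..1} b b' b''" by (rule C2_b)
  define h where "h = (\<lambda>x. b x / (a x * (1 - x)))"
  define h' where "h' = (\<lambda>x. (b' x * (a x * (1 - x)) - b x * (a' x * (1 - x) - a x)) / (a x * (1 - x)) ^ 2)"
  have nz: "a x * (1 - x) \<noteq> 0" if "x \<in> {0..1/2}" for x
    using that a_pos[of x] by auto
  have sub: "{0..1/2::real} \<subseteq> {0..1}" by auto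
  note a2 = C2_on_subset[OF a' sub] and b2 = C2_on_subset[OF b' sub]
  have dh: "(h has_real_derivative h' x) (at x within {0..1/2})" if "x \<in> {0..1/2}" for x
    unfolding h_def h'_def using a2 b2 nz[OF that] that unfolding C2_on_def
    by (auto intro!: derivative_eq_intros simp: power2_eq_square algebra_simps)
  have "continuous_on {0..1/2} a" "continuous_on {0..1/2} b" "continuous_on {0..1/2} a'" "continuous_on {0..1/2} b'"
    using a2 b2 unfolding C2_on_def by (blast intro: DERIV_continuous_on)+
  then have "continuous_on {0..1/2} h'"
    unfolding h'_def using nz by (intro continuous_intros) auto
  then have "bounded (h' ` {0..1/2})" by (intro compact_imp_bounded compact_continuous_image) auto
  then obtain Q where Q: "\<And>x. x \<in> {0..1/2} \<Longrightarrow> \<bar>h' x\<bar> \<le> Q"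
    unfolding bounded_iff by (metis imageI real_norm_def)
  have Lip: "\<bar>h x - h 0\<bar> \<le> Q * x" if "x \<in> {0..1/2}" for x
    using field_differentiable_bound[of "{0..1/2}" h h' Q x 0] dh Q that by auto
  have h0: "h 0 = end_exponent" by (simp add: h_def end_exponent_def)
  define v where "v = (\<lambda>x. ln (W x) - end_exponent * ln x)"
  have dv: "(v has_real_derivative (h x - h 0) / x) (at x)" if "x \<in> {0<..1/2}" for x
  proof -
    have x: "0 < W x" "(W has_real_derivative b x / (a x * x * (1 - x)) * W x) (at x)"
      using W that by (auto simp: integrating_factor_def)
    have "(v has_real_derivative (b x / (a x * x * (1 - x)) * W x) / W x - end_exponent * (1 / x)) (at x)"
      unfolding v_def using x that by (auto intro!: derivative_eq_intros)
    then show ?thesis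
      by (rule DERIV_cong) (use that x nz[of x] h0 in \<open>simp add: h_def field_simps\<close>)
  qed
  have vb: "\<bar>v x - v (1/2)\<bar> \<le> Q" if "x \<in> {0<..1/2}" for x
  proof -
    have "norm (v x - v (1/2)) \<le> Q * norm (x - 1/2)"
    proof (rule field_differentiable_bound[where S = "{0<..1/2}"])
      fix z :: real assume z: "z \<in> {0<..1/2}"
      show "(v has_real_derivative (h z - h 0) / z) (at z within {0<..1/2})"
        using dv[OF z] by (rule has_field_derivative_at_within)
      show "norm ((h z - h 0) / z) \<le> Q"
        using Lip[of z] z by (simp add: field_simps)
    qed (use that in auto)
    also have "\<dots> \<le> Q * 1" using that Q[of 0] by (intro mult_left_mono) auto
    finally show ?thesis by simp
  qed
  have eq: "W x = exp (v x) * x powr end_exponent" if "x \<in> {0<..1/2}" for x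
    using W that by (simp add: v_def integrating_factor_def powr_def exp_diff)
  show ?thesis
  proof (rule that[of "exp (v (1/2) - Q)" "exp (v (1/2) + Q)"])
    fix x :: real assume x: "x \<in> {0<..1/2}"
    show "exp (v (1/2) - Q) * x powr end_exponent \<le> W x"
      unfolding eq[OF x] by (rule mult_right_mono) (use vb[OF x] in auto)
    show "W x \<le> exp (v (1/2) + Q) * x powr end_exponent"
      unfolding eq[OF x] by (rule mult_right_mono) (use vb[OF x] in auto)
  qed simp
qed

text \<open>The density of the speed measure, up to a constant factor.\<close>

definition speed_density :: "(real \<Rightarrow> real) \<Rightarrow> real \<Rightarrow> real" where
  "speed_density W x = W x / diffusion x"

text \<open>Here \<open>\<alpha> \<le> m(0) - 1\<close>, and \<open>\<rho>\<close> is comparable to \<open>x\<close> to the power \<open>\<alpha> - m(0)\<close>.\<close>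

lemma speed_density_large_left:
  assumes W: "integrating_factor a b W" and nt: "\<not> transverse_end a b m 0"
  obtains c where "0 < c" "\<And>x. x \<in> {0<..1/2} \<Longrightarrow> c / x \<le> speed_density W x"
proof -
  obtain c where c: "0 < c" "\<And>x. x \<in> {0<..1/2} \<Longrightarrow> c * x powr end_exponent \<le> W x"
    using integrating_factor_bounds[OF W] by metis
  obtain c0 C where C: "0 < c0" "\<And>x. x \<in> {0<..1/2} \<Longrightarrow> c0 * x ^ m 0 \<le> diffusion x"
    "\<And>x. x \<in> {0<..1/2} \<Longrightarrow> diffusion x \<le> C * x ^ m 0"
    using diffusion_bounds by metis
  have "0 < C" using C(1) C(2,3)[of "1/2"]
    by (smt (verit) greaterThanAtMost_iff half_gt_zero_iff mult_pos_pos mult_nonpos_nonneg zero_less_power zero_le_power)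
  show ?thesis
  proof (rule that)
    show "0 < c / C" using c \<open>0 < C\<close> by simp
    fix x :: real assume x: "x \<in> {0<..1/2}"
    have e: "end_exponent \<le> real (m 0 - 1)"
      using nt m_cases(1) unfolding transverse_left_iff by auto
    have "x ^ m 0 = x powr real (m 0 - 1) * x"
      using x m_cases(1) by (auto simp: powr_realpow power2_eq_square)
    moreover have "x powr real (m 0 - 1) \<le> x powr end_exponent"
      using x e by (intro powr_mono') auto
    ultimately have "c / C / x * (C * x ^ m 0) \<le> c * x powr end_exponent"
      using x c \<open>0 < C\<close> by (simp add: field_simps)
    also have "\<dots> \<le> W x" by (rule c(2)[OF x])
    finally have *: "c / C / x * (C * x ^ m 0) \<le> W x" .
    have "c / C / x * diffusion x \<le> c / C / x * (C * x ^ m 0)"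
      using x c \<open>0 < C\<close> C(3)[OF x] by (intro mult_left_mono) auto
    with * have "c / C / x * diffusion x \<le> W x" by simp
    then show "c / C / x \<le> speed_density W x"
      using diffusion_pos[of x] x by (simp add: speed_density_def pos_le_divide_eq)
  qed
qed

lemma speed_density_continuous:
  assumes W: "integrating_factor a b W"
  shows "continuous_on {0<..<1} (speed_density W)" "continuous_on {0<..<1} W"
proof -
  show w: "continuous_on {0<..<1} W"
    using W unfolding integrating_factor_def
    by (meson DERIV_isCont continuous_at_imp_continuous_on)
  have "continuous_on {0<..<1} diffusion"
    by (rule continuous_on_subset[OF continuous_diffusion]) auto
  moreover have "diffusion x \<noteq> 0" if "x \<in> {0<..<1}" for x
    using diffusion_pos[OF that] by simp
  ultimately show "continuous_on {0<..<1} (speed_density W)"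
    unfolding speed_density_def using w by (intro continuous_intros) auto
qed

lemma speed_density_nonneg: "integrating_factor a b W \<Longrightarrow> x \<in> {0<..<1} \<Longrightarrow> 0 < speed_density W x"
  using diffusion_pos[of x] by (simp add: speed_density_def integrating_factor_def)

lemma speed_density_integrable_left:
  assumes W: "integrating_factor a b W" and tr: "transverse_end a b m 0"
  shows "speed_density W absolutely_integrable_on {0..1/2}"
proof -
  obtain C where C: "\<And>x. x \<in> {0<..1/2} \<Longrightarrow> W x \<le> C * x powr end_exponent"
    using integrating_factor_bounds[OF W] by metis
  obtain c0 where c0: "0 < c0" "\<And>x. x \<in> {0<..1/2} \<Longrightarrow> c0 * x ^ m 0 \<le> diffusion x"
    using diffusion_bounds by metis
  have bound: "speed_density W x \<le> C / c0 * x powr (end_exponent - m 0)" if x: "x \<in> {0<..1/2}" for x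
  proof -
    have "speed_density W x \<le> (C * x powr end_exponent) / (c0 * x ^ m 0)"
      unfolding speed_density_def
    proof (rule frac_le)
      show "0 \<le> C * x powr end_exponent"
        using C[OF x] W x by (smt (verit) integrating_factor_def greaterThanAtMost_iff greaterThanLessThan_iff half_bounded_equal)
      show "0 < c0 * x ^ m 0" using c0(1) x by simp
    qed (use C c0 x in auto)
    also have "\<dots> = C / c0 * x powr (end_exponent - m 0)"
      using x by (simp add: powr_diff powr_realpow)
    finally show ?thesis .
  qed
  have "(\<lambda>x. x powr (end_exponent - m 0)) integrable_on {0<..1/2}"
    using tr unfolding transverse_left_iff by (intro integrable_on_powr_from_0') auto
  then have dom: "(\<lambda>x. C / c0 * x powr (end_exponent - m 0)) integrable_on {0<..1/2}"
    by (rule integrable_on_mult_right)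
  have "speed_density W absolutely_integrable_on {0<..1/2}"
  proof (rule measurable_bounded_by_integrable_imp_absolutely_integrable[OF _ _ dom])
    show "speed_density W \<in> borel_measurable (lebesgue_on {0<..1/2})"
      by (rule continuous_imp_measurable_on_sets_lebesgue)
        (auto intro: continuous_on_subset[OF speed_density_continuous(1)[OF W]])
    show "norm (speed_density W x) \<le> C / c0 * x powr (end_exponent - m 0)" if "x \<in> {0<..1/2}" for x
      using bound[OF that] speed_density_nonneg[OF W, of x] that by auto
  qed simp
  then show ?thesis
    by (rule absolutely_integrable_spike_set) (auto intro: negligible_subset[of "{0}"])
qed

end

section \<open>Boundary behaviour in heat coordinates\<close>

lemma smooth_on_id: "smooth_on S (\<lambda>x. x)"
  unfolding smooth_on_def
proof (intro exI[of _ "\<lambda>n x. if n = 0 then x else if n = 1 then 1 else 0"] conjI ballI allI)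
  fix n x show "((\<lambda>x. if n = 0 then x else if n = 1 then 1 else 0) has_real_derivative
      (if Suc n = 0 then x else if Suc n = 1 then 1 else 0)) (at x within S)"
    by (cases n) auto
qed simp

lemma smooth_on_square: "smooth_on S (\<lambda>x. x\<^sup>2)"
  unfolding smooth_on_def
proof (intro exI[of _ "\<lambda>n x. if n = 0 then x\<^sup>2 else if n = 1 then 2 * x else if n = 2 then 2 else 0"]
    conjI ballI allI)
  fix n :: nat and x
  consider "n = 0" | "n = 1" | "n \<ge> 2" by linarith
  then show "((\<lambda>x. if n = 0 then x\<^sup>2 else if n = 1 then 2 * x else if n = 2 then 2 else 0) has_real_derivative
      (if Suc n = 0 then x\<^sup>2 else if Suc n = 1 then 2 * x else if Suc n = 2 then 2 else 0)) (at x within S)"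
    by cases (auto intro!: derivative_eq_intros)
qed simp

context kimura_operator
begin

text \<open>Comparing second-order coefficients: applying the defining identity to \<open>x\<close> and \<open>x\<^sup>2\<close>
  isolates \<open>A(\<phi>) = s \<phi>'\<^sup>2\<close>, where \<open>s\<close> is the normal form of the second-order coefficient.\<close>

lemma heat_coordinate_slope:
  assumes H: "left_heat_coordinate a b m J \<phi>"
  obtains \<phi>' where
    "\<And>t. t \<in> J \<Longrightarrow> (\<phi> has_real_derivative \<phi>' t) (at t)" "\<And>t. t \<in> J \<Longrightarrow> 0 < \<phi>' t"
    "\<And>t. t \<in> J \<Longrightarrow> diffusion (\<phi> t) = (if m 0 = 1 then t else 1) * \<phi>' t ^ 2"
proof -
  obtain d where J: "J = (if kimura_end m 0 then {0<..<d} else {..<d})"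
    using H unfolding left_heat_coordinate_def by blast
  then have openJ: "open J" by simp
  have img: "\<phi> ` J \<subseteq> {0<..<1}" using H unfolding left_heat_coordinate_def by auto
  obtain \<phi>' \<phi>'' where p: "C2_on J \<phi> \<phi>' \<phi>''" and pos: "\<And>t. t \<in> J \<Longrightarrow> 0 < \<phi>' t"
    using H unfolding left_heat_coordinate_def by blast
  obtain \<beta> where \<beta>: "\<And>f t. smooth_on {0<..<1} f \<Longrightarrow> t \<in> J \<Longrightarrow> kimura_L a b m f (\<phi> t) =
      (if kimura_end m 0 then t else 1) * deriv (deriv (f \<circ> \<phi>)) t + \<beta> t * deriv (f \<circ> \<phi>) t"
    using H unfolding left_heat_coordinate_def by blast
  show ?thesis
  proof (rule that)
    show "(\<phi> has_real_derivative \<phi>' t) (at t)" if "t \<in> J" for t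
      by (rule C2_on_open_deriv(3)[OF openJ p that])
    show "0 < \<phi>' t" if "t \<in> J" for t by (rule pos[OF that])
    fix t assume t: "t \<in> J"
    define s where "s = (if kimura_end m 0 then t else 1)"
    have c1: "C2_on {0<..<1} (\<lambda>x::real. x) (\<lambda>x. 1) (\<lambda>x. 0)"
      by (auto simp: C2_on_def)
    have c2: "C2_on {0<..<1} (\<lambda>x::real. x\<^sup>2) (\<lambda>x. 2 * x) (\<lambda>x. 2)"
      by (auto simp: C2_on_def intro!: derivative_eq_intros)
    have x: "\<phi> t \<in> {0<..<1}" using img t by auto
    note o = open_greaterThanLessThan[of "0::real" 1]
    note d1 = C2_on_open_deriv(1,2)[OF o c1 x] C2_on_open_deriv(1,2)[OF openJ C2_on_compose[OF o openJ c1 p img] t]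
    note d2 = C2_on_open_deriv(1,2)[OF o c2 x] C2_on_open_deriv(1,2)[OF openJ C2_on_compose[OF o openJ c2 p img] t]
    have "drift (\<phi> t) = s * \<phi>'' t + \<beta> t * \<phi>' t"
      using \<beta>[OF smooth_on_id t] unfolding kimura_L_eq d1 s_def[symmetric] by simp
    moreover have "diffusion (\<phi> t) * 2 + drift (\<phi> t) * (2 * \<phi> t)
        = s * (2 * \<phi>' t ^ 2 + 2 * \<phi> t * \<phi>'' t) + \<beta> t * (2 * \<phi> t * \<phi>' t)"
      using \<beta>[OF smooth_on_square t] unfolding kimura_L_eq d2 s_def[symmetric] by simp
    ultimately have "diffusion (\<phi> t) * 2 = s * (2 * \<phi>' t ^ 2)"
      by (simp add: algebra_simps)
    then show "diffusion (\<phi> t) = (if m 0 = 1 then t else 1) * \<phi>' t ^ 2"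
      by (simp add: s_def kimura_end_def)
  qed
qed

lemma heat_coordinate_increasing:
  assumes H: "left_heat_coordinate a b m J \<phi>" and st: "s \<in> J" "t \<in> J" "s < t"
  shows "\<phi> s < \<phi> t"
proof -
  obtain \<phi>' where d: "\<And>t. t \<in> J \<Longrightarrow> (\<phi> has_real_derivative \<phi>' t) (at t)"
    and pos: "\<And>t. t \<in> J \<Longrightarrow> 0 < \<phi>' t"
    using heat_coordinate_slope[OF H] by metis
  obtain d' where "J = (if kimura_end m 0 then {0<..<d'} else {..<d'})"
    using H unfolding left_heat_coordinate_def by blast
  then have "{s..t} \<subseteq> J" using st by (auto split: if_splits)
  then show ?thesis
    using d pos by (intro DERIV_pos_imp_increasing[OF st(3)]) (meson atLeastAtMost_iff subsetD)
qed

lemma heat_coordinate_preimage: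
  assumes H: "left_heat_coordinate a b m J \<phi>" and c: "c \<in> J" and x: "0 < x" "x < \<phi> c"
  obtains t where "t \<in> J" "t < c" "x = \<phi> t"
proof -
  have img: "\<phi> ` J = {0<..<1/3}" using H unfolding left_heat_coordinate_def by blast
  then have "\<phi> c < 1/3" using c by auto
  then have "x \<in> \<phi> ` J" unfolding img using x by auto
  then obtain t where t: "t \<in> J" "x = \<phi> t" by blast
  have "t < c"
    using heat_coordinate_increasing[OF H c t(1)] x t by (cases t c rule: linorder_cases) auto
  then show ?thesis by (rule that[OF t(1) _ t(2)])
qed

text \<open>\<open>\<phi>'\<close> is bounded below up to the boundary: \<open>\<surd>\<phi>\<close> grows at least like \<open>\<surd>t\<close>
  because \<open>(\<surd>\<phi>)' = \<surd>(A(\<phi>)/\<phi>) (\<surd>t)'\<close>. Hence boundedness of \<open>(f \<circ> \<phi>)'\<close> passes to \<open>f'\<close>.\<close>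

lemma left_C2_holder_kimura_bound:
  assumes f: "left_C2_holder a b m \<gamma> f" and m: "m 0 = 1"
    and df: "\<And>x. x \<in> {0<..<1} \<Longrightarrow> (f has_real_derivative f' x) (at x)"
  obtains e M where "0 < e" "e < 1" "\<And>x. 0 < x \<Longrightarrow> x < e \<Longrightarrow> \<bar>f' x\<bar> \<le> M"
proof -
  have K: "kimura_end m 0" using m by (simp add: kimura_end_def)
  obtain J \<phi> c where H: "left_heat_coordinate a b m J \<phi>" and c: "c \<in> J"
    and "kimura_C2_holder \<gamma> c (f \<circ> \<phi>)"
    using f K unfolding left_C2_holder_def by auto
  then obtain F' F'' where F: "C2_on {0<..c} (f \<circ> \<phi>) F' F''" and cF: "continuous_on {0..c} F'"
    unfolding kimura_C2_holder_def by blast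
  obtain \<phi>' where d: "\<And>t. t \<in> J \<Longrightarrow> (\<phi> has_real_derivative \<phi>' t) (at t)"
    and pos: "\<And>t. t \<in> J \<Longrightarrow> 0 < \<phi>' t"
    and A: "\<And>t. t \<in> J \<Longrightarrow> diffusion (\<phi> t) = t * \<phi>' t ^ 2"
    using heat_coordinate_slope[OF H] m by auto
  obtain d0 where J: "J = {0<..<d0}"
    using H K unfolding left_heat_coordinate_def by auto
  have img: "\<phi> ` J = {0<..<1/3}" using H unfolding left_heat_coordinate_def by blast
  have ph: "0 < \<phi> t" "\<phi> t < 1/3" if "t \<in> J" for t using img that by auto
  obtain c0 where c0: "0 < c0" "\<And>x. x \<in> {0<..1/2} \<Longrightarrow> c0 * x \<le> diffusion x"
    using diffusion_bounds m by (metis power_one_right)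
  have low: "c0 * \<phi> t \<le> t * \<phi>' t ^ 2" if "t \<in> J" for t
    using c0(2)[of "\<phi> t"] A[OF that] ph[OF that] by auto
  define u where "u = (\<lambda>t. sqrt (\<phi> t) - sqrt c0 * sqrt t)"
  have step: "u s \<le> u t" if st: "s \<in> J" "t \<in> J" "s \<le> t" for s t
  proof (rule DERIV_nonneg_imp_nondecreasing[OF st(3)])
    fix y assume "s \<le> y" "y \<le> t"
    then have y: "y \<in> J" "0 < y" using st J by auto
    have "sqrt c0 * sqrt (\<phi> y) \<le> sqrt y * \<phi>' y"
      using real_sqrt_le_mono[OF low[OF y(1)]] pos[OF y(1)] by (simp add: real_sqrt_mult)
    then have "sqrt c0 / sqrt y \<le> \<phi>' y / sqrt (\<phi> y)"
      using y ph[OF y(1)] by (simp add: field_simps)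
    moreover have "(u has_real_derivative (\<phi>' y / sqrt (\<phi> y) - sqrt c0 / sqrt y) / 2) (at y)"
      unfolding u_def using d[OF y(1)] ph[OF y(1)] y(2)
      by (auto intro!: derivative_eq_intros simp: field_simps)
    ultimately show "\<exists>z. (u has_real_derivative z) (at y) \<and> 0 \<le> z"
      by (intro exI[of _ "(\<phi>' y / sqrt (\<phi> y) - sqrt c0 / sqrt y) / 2"]) simp
  qed
  have unn: "0 \<le> u t" if t: "t \<in> J" for t
  proof -
    have "eventually (\<lambda>s. - sqrt c0 * sqrt s \<le> u t) (at_right 0)"
      unfolding eventually_at_right_field
    proof (intro exI[of _ t] conjI allI impI)
      show "0 < t" using t J by auto
      fix s assume "0 < s" "s < t"
      then have "s \<in> J" "s \<le> t" using t J by auto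
      from step[OF this(1) t this(2)] ph[OF this(1)]
      have "u s \<le> u t" "0 \<le> sqrt (\<phi> s)" by auto
      then show "- sqrt c0 * sqrt s \<le> u t" unfolding u_def by linarith
    qed
    moreover have "((\<lambda>s. - sqrt c0 * sqrt s) \<longlongrightarrow> - sqrt c0 * sqrt 0) (at_right 0)"
      by (intro tendsto_intros)
    ultimately have "- sqrt c0 * sqrt 0 \<le> u t"
      by (intro tendsto_upperbound) auto
    then show ?thesis by simp
  qed
  have slope: "c0 \<le> \<phi>' t" if t: "t \<in> J" for t
  proof -
    have t0: "0 < t" using t J by auto
    have "sqrt (c0 * t) \<le> sqrt (\<phi> t)" using unn[OF t] by (simp add: u_def real_sqrt_mult)
    then have "c0 * t \<le> \<phi> t" by simp
    then have "c0 * (c0 * t) \<le> c0 * \<phi> t" using c0(1) by simp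
    also have "\<dots> \<le> t * \<phi>' t ^ 2" by (rule low[OF t])
    finally have "c0\<^sup>2 \<le> \<phi>' t ^ 2" using t0 by (simp add: power2_eq_square)
    then show ?thesis by (rule power2_le_imp_le) (use pos[OF t] in simp)
  qed
  have "bounded (F' ` {0..c})" using cF by (intro compact_imp_bounded compact_continuous_image) auto
  then obtain M where M: "\<And>t. t \<in> {0..c} \<Longrightarrow> \<bar>F' t\<bar> \<le> M"
    unfolding bounded_iff by (metis imageI real_norm_def)
  show ?thesis
  proof (rule that[of "\<phi> c" "M / c0"])
    show "0 < \<phi> c" "\<phi> c < 1" using ph[OF c] by auto
    fix x assume "0 < x" "x < \<phi> c"
    then obtain t where t: "t \<in> J" "t < c" "x = \<phi> t" by (rule heat_coordinate_preimage[OF H c])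
    have t0: "0 < t" using t J by auto
    have "C2_on {0<..<c} (f \<circ> \<phi>) F' F''" by (rule C2_on_subset[OF F]) auto
    then have "(f \<circ> \<phi> has_real_derivative F' t) (at t)"
      using C2_on_open_deriv(3)[of "{0<..<c}"] t t0 by auto
    moreover have "(f \<circ> \<phi> has_real_derivative f' (\<phi> t) * \<phi>' t) (at t)"
      by (rule DERIV_chain[OF df d[OF t(1)]]) (use ph[OF t(1)] in auto)
    ultimately have "F' t = f' x * \<phi>' t" using DERIV_unique t(3) by blast
    then have "\<bar>f' x\<bar> * \<phi>' t = \<bar>F' t\<bar>" using pos[OF t(1)] by (simp add: abs_mult)
    also have "\<dots> \<le> M" using M t t0 by auto
    finally have "\<bar>f' x\<bar> * \<phi>' t \<le> M" .
    moreover have "\<bar>f' x\<bar> * c0 \<le> \<bar>f' x\<bar> * \<phi>' t" using slope[OF t(1)] by (intro mult_left_mono) auto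
    ultimately show "\<bar>f' x\<bar> \<le> M / c0" using c0(1) by (simp add: field_simps)
  qed
qed

text \<open>At a quadratic end \<open>\<phi>' = \<surd>A(\<phi>)\<close> is at least a multiple of \<open>\<phi>\<close>, so \<open>x f'\<close> is controlled by
  \<open>(f \<circ> \<phi>)'\<close>, which tends to \<open>0\<close>.\<close>

lemma left_C2_holder_quadratic_limit:
  assumes f: "left_C2_holder a b m \<gamma> f" and m: "m 0 = 2"
    and df: "\<And>x. x \<in> {0<..<1} \<Longrightarrow> (f has_real_derivative f' x) (at x)"
  shows "((\<lambda>x. x * f' x) \<longlongrightarrow> 0) (at_right 0)"
proof -
  have K: "\<not> kimura_end m 0" using m by (simp add: kimura_end_def)
  obtain J \<phi> c where H: "left_heat_coordinate a b m J \<phi>" and c: "c \<in> J"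
    and "quadratic_C2_holder \<gamma> (b 0 / a 0 = 1) c (f \<circ> \<phi>)"
    using f K unfolding left_C2_holder_def by auto
  then obtain F' F'' l k where F: "C2_on {..c} (f \<circ> \<phi>) F' F''"
    and l: "((f \<circ> \<phi>) \<longlongrightarrow> l) at_bot" and k: "(F' \<longlongrightarrow> k) at_bot"
    unfolding quadratic_C2_holder_def by blast
  obtain \<phi>' where d: "\<And>t. t \<in> J \<Longrightarrow> (\<phi> has_real_derivative \<phi>' t) (at t)"
    and pos: "\<And>t. t \<in> J \<Longrightarrow> 0 < \<phi>' t"
    and A: "\<And>t. t \<in> J \<Longrightarrow> diffusion (\<phi> t) = \<phi>' t ^ 2"
    using heat_coordinate_slope[OF H] m by auto
  obtain d0 where J: "J = {..<d0}"
    using H K unfolding left_heat_coordinate_def by auto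
  have img: "\<phi> ` J = {0<..<1/3}" using H unfolding left_heat_coordinate_def by blast
  have ph: "0 < \<phi> t" "\<phi> t < 1/3" if "t \<in> J" for t using img that by auto
  obtain c0 where c0: "0 < c0" "\<And>x. x \<in> {0<..1/2} \<Longrightarrow> c0 * x\<^sup>2 \<le> diffusion x"
    using diffusion_bounds m by metis
  have slope: "sqrt c0 * \<phi> t \<le> \<phi>' t" if "t \<in> J" for t
  proof (rule power2_le_imp_le)
    show "(sqrt c0 * \<phi> t)\<^sup>2 \<le> \<phi>' t ^ 2"
      using c0(1) c0(2)[of "\<phi> t"] A[OF that] ph[OF that] by (simp add: power_mult_distrib)
  qed (use pos[OF that] in simp)
  have "C2_on {..<c} (f \<circ> \<phi>) F' F''" by (rule C2_on_subset[OF F]) auto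
  then have dF: "(f \<circ> \<phi> has_real_derivative F' t) (at t)" if "t < c" for t
    using C2_on_open_deriv(3)[of "{..<c}"] that by auto
  have "k = 0" by (rule tendsto_deriv_zero_at_bot[OF dF l k])
  show ?thesis
  proof (rule tendstoI)
    fix \<epsilon> :: real assume "0 < \<epsilon>"
    then have "eventually (\<lambda>t. \<bar>F' t\<bar> < \<epsilon> * sqrt c0) at_bot"
      using tendstoD[OF k, of "\<epsilon> * sqrt c0"] c0(1) by (simp add: \<open>k = 0\<close>)
    then obtain T where T: "\<And>t. t \<le> T \<Longrightarrow> \<bar>F' t\<bar> < \<epsilon> * sqrt c0"
      unfolding eventually_at_bot_linorder by blast
    define t0 where "t0 = min T c"
    have t0: "t0 \<in> J" using c J by (auto simp: t0_def)
    show "eventually (\<lambda>x. dist (x * f' x) 0 < \<epsilon>) (at_right 0)"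
      unfolding eventually_at_right_field
    proof (intro exI[of _ "\<phi> t0"] conjI allI impI)
      show "0 < \<phi> t0" using ph[OF t0] by simp
      fix x assume "0 < x" "x < \<phi> t0"
      then obtain t where t: "t \<in> J" "t < t0" "x = \<phi> t" by (rule heat_coordinate_preimage[OF H t0])
      have "(f \<circ> \<phi> has_real_derivative f' (\<phi> t) * \<phi>' t) (at t)"
        by (rule DERIV_chain[OF df d[OF t(1)]]) (use ph[OF t(1)] in auto)
      then have "F' t = f' x * \<phi>' t" using DERIV_unique[OF dF[of t]] t by (auto simp: t0_def)
      then have "\<bar>f' x\<bar> * \<phi>' t < \<epsilon> * sqrt c0" using T[of t] pos[OF t(1)] t by (simp add: abs_mult t0_def)
      moreover have "\<bar>f' x\<bar> * (sqrt c0 * x) \<le> \<bar>f' x\<bar> * \<phi>' t"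
        using slope[OF t(1)] t(3) by (intro mult_left_mono) auto
      ultimately have "\<bar>f' x\<bar> * x * sqrt c0 < \<epsilon> * sqrt c0" by (simp add: mult_ac)
      then show "dist (x * f' x) 0 < \<epsilon>" using c0(1) \<open>0 < x\<close> by (simp add: abs_mult mult_ac)
    qed
  qed
qed

text \<open>Let \<open>u = f'\<close> at a Kimura tangent end and \<open>u = x f'\<close> at a quadratic end. Then \<open>u\<close> is bounded, and the
  equation \<open>g = A f'' + B f'\<close> gives \<open>x u' \<longlonglongrightarrow> g(0)/a(0)\<close>, because the drift terms tend to \<open>0\<close>.\<close>

lemma L_vanishes_left:
  assumes f: "left_C2_holder a b m \<gamma> f"
    and df: "\<And>x. x \<in> {0<..<1} \<Longrightarrow> (f has_real_derivative f' x) (at x)"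
    and ddf: "\<And>x. x \<in> {0<..<1} \<Longrightarrow> (f' has_real_derivative f'' x) (at x)"
    and g: "continuous_on {0..1} g"
    and eq: "\<And>x. x \<in> {0<..<1} \<Longrightarrow> g x = diffusion x * f'' x + drift x * f' x"
    and nt: "m 0 = 1 \<Longrightarrow> b 0 = 0"
  shows "g 0 = 0"
proof -
  define k where "k = (\<lambda>x. a x * (1 - x) ^ m 1)"
  define h where "h = (\<lambda>x. b x * (1 - x) ^ (m 1 - 1))"
  have ck: "continuous_on {0..1} k" "continuous_on {0..1} h"
    unfolding k_def h_def by (intro continuous_intros continuous_a continuous_b)+
  have k0: "k 0 = a 0" "h 0 = b 0" by (auto simp: k_def h_def)
  have lim: "(k \<longlongrightarrow> a 0) (at_right 0)" "(h \<longlongrightarrow> b 0) (at_right 0)" "(g \<longlongrightarrow> g 0) (at_right 0)"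
    using tendsto_at_zero[OF ck(1)] tendsto_at_zero[OF ck(2)] tendsto_at_zero[OF g] k0 by auto
  have a0: "0 < a 0" using a_pos by auto
  have kpos: "0 < k x" if "x \<in> {0<..<1}" for x using that a_pos[of x] by (simp add: k_def)
  have ev: "eventually (\<lambda>x. x \<in> {0<..<1}) (at_right (0::real))"
    unfolding eventually_at_right_field by (intro exI[of _ 1]) auto
  have "g 0 / a 0 = 0"
  proof (cases "m 0 = 1")
    case True
    obtain e M where e: "0 < e" "e < 1" and M: "\<And>x. 0 < x \<Longrightarrow> x < e \<Longrightarrow> \<bar>f' x\<bar> \<le> M"
      using left_C2_holder_kimura_bound[OF f True df] by blast
    have "((\<lambda>x. h x * f' x) \<longlongrightarrow> 0) (at_right 0)"
    proof (rule tendsto_mult_zero_bounded)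
      show "(h \<longlongrightarrow> 0) (at_right 0)" using lim(2) nt[OF True] by simp
      show "eventually (\<lambda>x. \<bar>f' x\<bar> \<le> M) (at_right 0)"
        unfolding eventually_at_right_field using e M by (intro exI[of _ e]) auto
    qed
    then have "((\<lambda>x. (g x - h x * f' x) / k x) \<longlongrightarrow> (g 0 - 0) / a 0) (at_right 0)"
      by (intro tendsto_intros) (use lim a0 in auto)
    moreover have "eventually (\<lambda>x. (g x - h x * f' x) / k x = x * f'' x) (at_right 0)"
      using ev
    proof eventually_elim
      case (elim x)
      have "g x = k x * x * f'' x + h x * f' x"
        using eq[OF elim] True by (simp add: diffusion_def drift_def k_def h_def mult_ac)
      then show ?case using kpos[OF elim] by (simp add: field_simps)
    qed
    ultimately have "((\<lambda>x. x * f'' x) \<longlongrightarrow> (g 0 - 0) / a 0) (at_right 0)"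
      by (rule Lim_transform_eventually)
    then have "((\<lambda>x. x * f'' x) \<longlongrightarrow> g 0 / a 0) (at_right 0)" by simp
    then show ?thesis
      by (rule bounded_imp_log_slope_zero[where u = f' and e = e and M = M, rotated 3])
        (use e M ddf in auto)
  next
    case False
    then have m: "m 0 = 2" using m_cases by auto
    have xf: "((\<lambda>x. x * f' x) \<longlongrightarrow> 0) (at_right 0)"
      by (rule left_C2_holder_quadratic_limit[OF f m df])
    then have "eventually (\<lambda>x. \<bar>x * f' x\<bar> < 1) (at_right 0)"
      using tendstoD[OF xf, of 1] by simp
    then obtain e where e: "0 < e" "\<And>x. 0 < x \<Longrightarrow> x < e \<Longrightarrow> \<bar>x * f' x\<bar> < 1"
      unfolding eventually_at_right_field by auto
    have "((\<lambda>x. x * f' x + (g x - h x * (x * f' x)) / k x) \<longlongrightarrow> 0 + (g 0 - b 0 * 0) / a 0) (at_right 0)"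
      using lim a0 xf by (intro tendsto_intros) auto
    moreover have "eventually (\<lambda>x. x * f' x + (g x - h x * (x * f' x)) / k x = x * (f' x + x * f'' x)) (at_right 0)"
      using ev
    proof eventually_elim
      case (elim x)
      have "g x = k x * (x * x * f'' x) + h x * (x * f' x)"
        using eq[OF elim] m by (simp add: diffusion_def drift_def k_def h_def mult_ac power2_eq_square)
      then have "(g x - h x * (x * f' x)) / k x = x * x * f'' x" using kpos[OF elim] by simp
      then show ?case by (simp add: algebra_simps)
    qed
    ultimately have "((\<lambda>x. x * (f' x + x * f'' x)) \<longlongrightarrow> 0 + (g 0 - b 0 * 0) / a 0) (at_right 0)"
      by (rule Lim_transform_eventually)
    then have "((\<lambda>x. x * (f' x + x * f'' x)) \<longlongrightarrow> g 0 / a 0) (at_right 0)" by simp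
    then show ?thesis
    proof (rule bounded_imp_log_slope_zero[where u = "\<lambda>x. x * f' x" and e = "min e 1" and M = 1, rotated 3])
      fix x assume x: "0 < x" "x < min e 1"
      show "((\<lambda>x. x * f' x) has_real_derivative f' x + x * f'' x) (at x)"
        using ddf[of x] x by (auto intro!: derivative_eq_intros)
      show "\<bar>x * f' x\<bar> \<le> 1" using e(2)[of x] x by auto
    qed (use e in auto)
  qed
  then show ?thesis using a0 by simp
qed

text \<open>With \<open>k = m(0) - 1\<close>, \<open>W f'\<close> is the product of \<open>W/x\<^sup>k\<close>, which tends to \<open>0\<close> as \<open>\<alpha> > k\<close>, and of \<open>x\<^sup>k f'\<close>,
  which is bounded.\<close>

lemma flux_vanishes_left:
  assumes f: "left_C2_holder a b m \<gamma> f"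
    and df: "\<And>x. x \<in> {0<..<1} \<Longrightarrow> (f has_real_derivative f' x) (at x)"
    and W: "integrating_factor a b W" and tr: "transverse_end a b m 0"
  shows "((\<lambda>x. W x * f' x) \<longlongrightarrow> 0) (at_right 0)"
proof -
  obtain C where C: "\<And>x. x \<in> {0<..1/2} \<Longrightarrow> W x \<le> C * x powr end_exponent"
    using integrating_factor_bounds[OF W] by metis
  define k where "k = m 0 - 1"
  have k: "real k < end_exponent" "m 0 = Suc k"
    using tr m_cases(1) unfolding transverse_left_iff k_def by auto
  obtain e M where e: "0 < e" "\<And>x. 0 < x \<Longrightarrow> x < e \<Longrightarrow> \<bar>x ^ k * f' x\<bar> \<le> M"
  proof (cases "m 0 = 1")
    case True
    obtain e M where "0 < e" "\<And>x. 0 < x \<Longrightarrow> x < e \<Longrightarrow> \<bar>f' x\<bar> \<le> M"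
      using left_C2_holder_kimura_bound[OF f True df] by blast
    moreover have "k = 0" using True k(2) by simp
    ultimately show ?thesis using that[of e M] by simp
  next
    case False
    then have m: "m 0 = 2" using m_cases by auto
    have "eventually (\<lambda>x. \<bar>x * f' x\<bar> < 1) (at_right 0)"
      using tendstoD[OF left_C2_holder_quadratic_limit[OF f m df], of 1] by simp
    then obtain e where "0 < e" "\<And>x. 0 < x \<Longrightarrow> x < e \<Longrightarrow> \<bar>x * f' x\<bar> < 1"
      unfolding eventually_at_right_field by auto
    moreover have "k = 1" using m k(2) by simp
    ultimately show ?thesis using that[of e 1] by (simp add: less_imp_le)
  qed
  have "((\<lambda>x. (W x / x ^ k) * (x ^ k * f' x)) \<longlongrightarrow> 0) (at_right 0)"
  proof (rule tendsto_mult_zero_bounded)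
    show "eventually (\<lambda>x. \<bar>x ^ k * f' x\<bar> \<le> M) (at_right 0)"
      unfolding eventually_at_right_field using e by (intro exI[of _ e]) auto
    show "((\<lambda>x. W x / x ^ k) \<longlongrightarrow> 0) (at_right 0)"
    proof (rule tendsto_sandwich[of "\<lambda>x. 0" _ _ "\<lambda>x. C * x powr (end_exponent - k)"])
      have "((\<lambda>x. C * x powr (end_exponent - k)) \<longlongrightarrow> C * 0 powr (end_exponent - k)) (at_right 0)"
        using k(1) by (intro tendsto_intros) (auto simp: eventually_at_right_field intro: exI[of _ 1])
      then show "((\<lambda>x. C * x powr (end_exponent - k)) \<longlongrightarrow> 0) (at_right 0)" by simp
      have rng: "W x / x ^ k \<le> C * x powr (end_exponent - k)" "0 \<le> W x / x ^ k" if "0 < x" "x < 1/2" for x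
      proof -
        have "W x / x ^ k \<le> C * x powr end_exponent / x ^ k"
          using C[of x] that by (intro divide_right_mono) auto
        then show "W x / x ^ k \<le> C * x powr (end_exponent - k)"
          using that by (simp add: powr_diff powr_realpow)
        have "0 < W x" using W that by (auto simp: integrating_factor_def)
        then show "0 \<le> W x / x ^ k" using that by simp
      qed
      then show "eventually (\<lambda>x. 0 \<le> W x / x ^ k) (at_right 0)"
        "eventually (\<lambda>x. W x / x ^ k \<le> C * x powr (end_exponent - k)) (at_right 0)"
        unfolding eventually_at_right_field by (auto intro!: exI[of _ "1/2"])
    qed simp
  qed
  moreover have "eventually (\<lambda>x. (W x / x ^ k) * (x ^ k * f' x) = W x * f' x) (at_right 0)"
    unfolding eventually_at_right_field by (intro exI[of _ 1]) auto
  ultimately show ?thesis by (rule Lim_transform_eventually)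
qed

end

section \<open>Construction of heat coordinates\<close>

lemma antiderivative_exists:
  assumes "continuous_on {0<..<1} (h :: real \<Rightarrow> real)"
  obtains H where "\<And>x. x \<in> {0<..<1} \<Longrightarrow> (H has_real_derivative h x) (at x)"
proof -
  have "isCont h x" if "0 < x" "x < 1" for x
    using assms that by (simp add: continuous_on_eq_continuous_at)
  then have "\<exists>F. \<forall>x::real. 0 < ereal x \<longrightarrow> ereal x < 1 \<longrightarrow> (F has_vector_derivative h x) (at x)"
    by (intro einterval_antiderivative) auto
  then obtain F where "\<forall>x::real. 0 < ereal x \<longrightarrow> ereal x < 1 \<longrightarrow> (F has_vector_derivative h x) (at x)"
    by blast
  then show ?thesis
    by (intro that[of F]) (auto simp: has_real_derivative_iff_has_vector_derivative)
qed

lemma C2_on_power: "C2_on S (\<lambda>x::real. x ^ n) (\<lambda>x. real n * x ^ (n - 1)) (\<lambda>x. real n * (real (n - 1) * x ^ (n - 2)))"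
  unfolding C2_on_def
proof (intro conjI ballI)
  fix x
  show "((\<lambda>x::real. x ^ n) has_real_derivative real n * x ^ (n - 1)) (at x within S)"
    by (auto intro!: derivative_eq_intros)
  show "((\<lambda>x. real n * x ^ (n - 1)) has_real_derivative real n * (real (n - 1) * x ^ (n - 2))) (at x within S)"
    by (auto intro!: derivative_eq_intros simp: numeral_2_eq_2)
qed (intro continuous_intros)

lemma C2_on_reflected_power:
  "C2_on S (\<lambda>x::real. (1 - x) ^ n) (\<lambda>x. - (real n * (1 - x) ^ (n - 1)))
    (\<lambda>x. real n * (real (n - 1) * (1 - x) ^ (n - 2)))"
  unfolding C2_on_def
proof (intro conjI ballI)
  fix x
  show "((\<lambda>x::real. (1 - x) ^ n) has_real_derivative - (real n * (1 - x) ^ (n - 1))) (at x within S)"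
    by (auto intro!: derivative_eq_intros)
  show "((\<lambda>x. - (real n * (1 - x) ^ (n - 1))) has_real_derivative real n * (real (n - 1) * (1 - x) ^ (n - 2))) (at x within S)"
    by (auto intro!: derivative_eq_intros simp: numeral_2_eq_2)
qed (intro continuous_intros)

lemma kimura_C2_holder_cong:
  assumes "kimura_C2_holder \<gamma> c G" and eq: "\<And>t. t \<in> {0..c} \<Longrightarrow> F t = G t"
  shows "kimura_C2_holder \<gamma> c F"
proof -
  obtain G' G'' where G: "\<forall>t\<in>{0..c}. (G has_real_derivative G' t) (at t within {0..c})"
    "continuous_on {0..c} G'" "C2_on {0<..c} G G' G''" "((\<lambda>t. t * G'' t) \<longlongrightarrow> 0) (at_right 0)"
    "finite_holder_norm \<gamma> {0<..c} G" "finite_holder_norm \<gamma> {0<..c} G'"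
    "finite_holder_norm \<gamma> {0<..c} (\<lambda>t. t * G'' t)"
    using assms(1) unfolding kimura_C2_holder_def by blast
  have "\<forall>t\<in>{0..c}. (F has_real_derivative G' t) (at t within {0..c})"
    using G(1) eq has_real_derivative_cong_on by blast
  moreover have "C2_on {0<..c} F G' G''"
    by (rule C2_on_cong[OF G(3)]) (use eq in auto)
  moreover have "finite_holder_norm \<gamma> {0<..c} F"
    using G(5) eq unfolding finite_holder_norm_def finite_sup_norm_def by simp
  ultimately show ?thesis
    unfolding kimura_C2_holder_def using G by blast
qed

lemma quadratic_C2_holder_cong:
  assumes "quadratic_C2_holder \<gamma> n c G" and eq: "\<And>t. t \<le> c \<Longrightarrow> F t = G t"
  shows "quadratic_C2_holder \<gamma> n c F"
proof -
  obtain G' G'' l where G: "C2_on {..c} G G' G''" "(G \<longlongrightarrow> l) at_bot" "finite_sup_norm {..c} G"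
    and rest: "(\<exists>l. (G' \<longlongrightarrow> l) at_bot)" "(\<exists>l. (G'' \<longlongrightarrow> l) at_bot)"
     "finite_sup_norm {..c} G'" "finite_holder_norm \<gamma> {..c} G''"
     "finite_quadratic_holder_norm \<gamma> n c G''"
    using assms(1) unfolding quadratic_C2_holder_def by blast
  have "C2_on {..c} F G' G''"
    by (rule C2_on_cong[OF G(1)]) (use eq in auto)
  moreover have "(F \<longlongrightarrow> l) at_bot"
    by (rule Lim_transform_eventually[OF G(2)])
      (use eq in \<open>auto simp: eventually_at_bot_linorder intro!: exI[of _ c]\<close>)
  moreover have "finite_sup_norm {..c} F"
    using G(3) eq unfolding finite_sup_norm_def by simp
  ultimately show ?thesis
    unfolding quadratic_C2_holder_def using rest by blast
qed

text \<open>Besides the test function for transverse ends, this covers the constants (\<open>K = 0\<close>).\<close>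

lemma kimura_C2_holder_polynomial:
  assumes \<gamma>: "0 < \<gamma>" "\<gamma> < 1" and c: "0 < c"
  shows "kimura_C2_holder \<gamma> c (\<lambda>t. K * (c - t) ^ 4 + C)"
proof -
  have holder: "finite_holder_norm \<gamma> {0<..c} g"
    if "\<And>t. (g has_real_derivative g' t) (at t)" "continuous_on UNIV g'" for g g'
  proof -
    have "finite_holder_norm \<gamma> {0..c} g"
      by (rule finite_holder_norm_C1[OF \<gamma>, where g' = g'])
        (use that in \<open>auto intro: has_field_derivative_at_within continuous_on_subset\<close>)
    then show ?thesis unfolding finite_holder_norm_def finite_sup_norm_def by fastforce
  qed
  have d1: "((\<lambda>t. K * (c - t) ^ 4 + C) has_real_derivative - (4 * K * (c - t) ^ 3)) (at t within S)" for t S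
    by (auto intro!: derivative_eq_intros)
  have d2: "((\<lambda>t. - (4 * K * (c - t) ^ 3)) has_real_derivative 12 * K * (c - t) ^ 2) (at t within S)" for t S
    by (auto intro!: derivative_eq_intros)
  have d3: "((\<lambda>t. t * (12 * K * (c - t) ^ 2)) has_real_derivative 12 * K * (c - t) ^ 2 - 24 * K * t * (c - t)) (at t)" for t
    by (auto intro!: derivative_eq_intros simp: algebra_simps)
  have lim: "((\<lambda>t. t * (12 * K * (c - t) ^ 2)) \<longlongrightarrow> 0 * (12 * K * (c - 0) ^ 2)) (at_right 0)"
    by (intro tendsto_intros)
  show ?thesis
    unfolding kimura_C2_holder_def
    by (rule exI[of _ "\<lambda>t. - (4 * K * (c - t) ^ 3)"], rule exI[of _ "\<lambda>t. 12 * K * (c - t) ^ 2"],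
        intro conjI ballI d1 holder[OF d1] holder[OF d2] holder[OF d3])
      (use lim in \<open>auto simp: C2_on_def intro!: d1 d2 continuous_intros\<close>)
qed

lemma quadratic_C2_holder_const: "quadratic_C2_holder \<gamma> n c (\<lambda>t. C)"
proof -
  have z: "finite_holder_norm \<gamma> {..c} (\<lambda>t. 0)"
    unfolding finite_holder_norm_def finite_sup_norm_def by (auto intro!: exI[of _ 0])
  then have "finite_quadratic_holder_norm \<gamma> n c (\<lambda>t. 0)"
    unfolding finite_quadratic_holder_norm_def by (auto intro: integrable_0)
  then show ?thesis
    unfolding quadratic_C2_holder_def using z
    by (intro exI[of _ "\<lambda>t. 0"]) (auto simp: C2_on_def finite_sup_norm_def)
qed

lemma left_C2_holder_cong:
  assumes "left_C2_holder a b m \<gamma> f" and eq: "\<And>x. x \<in> {0..1} \<Longrightarrow> g x = f x"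
  shows "left_C2_holder a b m \<gamma> g"
proof -
  obtain J \<phi> c where H: "left_heat_coordinate a b m J \<phi>" and c: "c \<in> J"
    and f: "if kimura_end m 0 then kimura_C2_holder \<gamma> c (f \<circ> \<phi>)
               else quadratic_C2_holder \<gamma> (b 0 / a 0 = 1) c (f \<circ> \<phi>)"
    using assms(1) unfolding left_C2_holder_def by blast
  obtain d where J: "J = (if kimura_end m 0 then {0<..<d} else {..<d})"
    using H unfolding left_heat_coordinate_def by blast
  have img: "\<phi> ` J = {0<..<1/3}" and "kimura_end m 0 \<longrightarrow> \<phi> 0 = 0"
    using H unfolding left_heat_coordinate_def by blast+
  have eqJ: "(g \<circ> \<phi>) t = (f \<circ> \<phi>) t" if "t \<in> J" for t
  proof -
    have "\<phi> t \<in> {0<..<1/3}" using img that by blast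
    then show ?thesis using eq by simp
  qed
  have "if kimura_end m 0 then kimura_C2_holder \<gamma> c (g \<circ> \<phi>)
               else quadratic_C2_holder \<gamma> (b 0 / a 0 = 1) c (g \<circ> \<phi>)"
  proof (cases "kimura_end m 0")
    case True
    have "kimura_C2_holder \<gamma> c (g \<circ> \<phi>)"
    proof (rule kimura_C2_holder_cong)
      show "kimura_C2_holder \<gamma> c (f \<circ> \<phi>)" using f True by simp
      fix t assume t: "t \<in> {0..c}"
      show "(g \<circ> \<phi>) t = (f \<circ> \<phi>) t"
      proof (cases "t = 0")
        case True
        then show ?thesis using \<open>kimura_end m 0\<close> \<open>kimura_end m 0 \<longrightarrow> \<phi> 0 = 0\<close> eq by simp
      next
        case False
        then show ?thesis using t c J \<open>kimura_end m 0\<close> by (intro eqJ) auto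
      qed
    qed
    then show ?thesis using True by simp
  next
    case False
    have "quadratic_C2_holder \<gamma> (b 0 / a 0 = 1) c (g \<circ> \<phi>)"
      by (rule quadratic_C2_holder_cong[of _ _ _ "f \<circ> \<phi>"]) (use f False c J eqJ in auto)
    then show ?thesis using False by simp
  qed
  then show ?thesis using H c unfolding left_C2_holder_def by blast
qed

context kimura_operator
begin

lemma diffusion_C2:
  obtains A' A'' where "C2_on {0..1} diffusion A' A''" "m 0 = 1 \<Longrightarrow> A' 0 = a 0"
proof -
  obtain a' a'' where "C2_on {0..1} a a' a''" by (rule C2_a)
  note C2 = C2_on_mult[OF C2_on_mult[OF this C2_on_power[of _ "m 0"]] C2_on_reflected_power[of _ "m 1"]]
  have eq: "diffusion = (\<lambda>x. a x * x ^ m 0 * (1 - x) ^ m 1)"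
    by (rule ext) (rule diffusion_def)
  show ?thesis by (rule that[OF C2[folded eq]]) simp
qed

text \<open>\<open>w = 1/\<surd>A\<close> is the derivative of the inverse heat coordinate \<open>T\<close> at a quadratic end; at a Kimura end
  the derivative is \<open>w \<surd>T\<close>.\<close>

lemma inverse_sqrt_diffusion:
  obtains w w' w'' A' where "C2_on {0<..<1} w w' w''"
    "\<And>x. x \<in> {0<..<1} \<Longrightarrow> 0 < w x" "\<And>x. x \<in> {0<..<1} \<Longrightarrow> w x = 1 / sqrt (diffusion x)"
    "\<And>x. x \<in> {0<..<1} \<Longrightarrow> diffusion x * w x ^ 2 = 1"
    "continuous_on {0..1} A'"
    "\<And>x. x \<in> {0<..<1} \<Longrightarrow> diffusion x * w' x = - A' x * w x / 2" "m 0 = 1 \<Longrightarrow> A' 0 = a 0"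
proof -
  obtain A' A'' where A: "C2_on {0..1} diffusion A' A''" "m 0 = 1 \<Longrightarrow> A' 0 = a 0"
    using diffusion_C2 by blast
  define w where "w = (\<lambda>x. 1 / sqrt (diffusion x))"
  define w' where "w' = (\<lambda>x. - (A' x * w x ^ 3) / 2)"
  define w'' where "w'' = (\<lambda>x. - (A'' x * w x ^ 3 + A' x * (3 * w x ^ 2 * w' x)) / 2)"
  have A01: "C2_on {0<..<1} diffusion A' A''" by (rule C2_on_subset[OF A(1)]) auto
  note dA = C2_on_open_deriv(3,4)[OF open_greaterThanLessThan A01]
  have wpos: "0 < w x" "diffusion x * w x ^ 2 = 1" if "x \<in> {0<..<1}" for x
    using diffusion_pos[OF that] by (auto simp: w_def power_divide)
  have dw: "(w has_real_derivative w' x) (at x)" if "x \<in> {0<..<1}" for x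
  proof -
    have p: "0 < diffusion x" by (rule diffusion_pos[OF that])
    have "(w has_real_derivative - (A' x * (inverse (sqrt (diffusion x)) / 2)) / (sqrt (diffusion x) * sqrt (diffusion x))) (at x)"
      unfolding w_def using p dA(1)[OF that] by (auto intro!: derivative_eq_intros)
    then show ?thesis
      by (rule DERIV_cong) (use p in \<open>simp add: w'_def w_def power3_eq_cube field_simps\<close>)
  qed
  have dw': "(w' has_real_derivative w'' x) (at x)" if "x \<in> {0<..<1}" for x
    unfolding w'_def w''_def using dw[OF that] dA(2)[OF that]
    by (auto intro!: derivative_eq_intros simp: w'_def power2_eq_square field_simps)
  have "continuous_on {0<..<1} w" "continuous_on {0<..<1} w'"
    using dw dw' by (meson DERIV_isCont continuous_at_imp_continuous_on)+
  moreover have "continuous_on {0<..<1} A'" "continuous_on {0<..<1} A''"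
    using A01 unfolding C2_on_def by (blast intro: DERIV_continuous_on)+
  ultimately have "continuous_on {0<..<1} w''"
    unfolding w''_def by (intro continuous_intros) auto
  then have "C2_on {0<..<1} w w' w''"
    using dw dw' by (auto simp: C2_on_def intro: has_field_derivative_at_within)
  moreover have "diffusion x * w' x = - A' x * w x / 2" if "x \<in> {0<..<1}" for x
  proof -
    have "diffusion x * w' x = - A' x * w x * (diffusion x * w x ^ 2) / 2"
      by (simp add: w'_def power2_eq_square power3_eq_cube)
    then show ?thesis using wpos(2)[OF that] by simp
  qed
  moreover have "continuous_on {0..1} A'"
    using A(1) unfolding C2_on_def by (blast intro: DERIV_continuous_on)
  ultimately show ?thesis
    using wpos A(2) by (intro that[of w w' w'' A']) (auto simp: w_def)
qed

text \<open>The drift of \<open>L\<close> in the coordinate \<open>\<phi>\<close> may be any function, so only the second-order coefficient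
  restricts a heat coordinate; for the inverse function \<open>T\<close> the condition is \<open>A T'\<^sup>2 = T\<close> or \<open>A T'\<^sup>2 = 1\<close>.\<close>

lemma heat_coordinate_from_inverse:
  assumes T: "C2_on {0<..<1/3} T T' T''" and pos: "\<And>x. x \<in> {0<..<1/3} \<Longrightarrow> 0 < T' x"
    and slope: "\<And>x. x \<in> {0<..<1/3} \<Longrightarrow> diffusion x * T' x ^ 2 = (if m 0 = 1 then T x else 1)"
    and img: "T ` {0<..<1/3} = J" and J: "J = (if m 0 = 1 then {0<..<d} else {..<d})"
  obtains \<phi> where "left_heat_coordinate a b m J \<phi>"
    "\<And>x. x \<in> {0<..<1/3} \<Longrightarrow> \<phi> (T x) = x" "m 0 = 1 \<Longrightarrow> \<phi> 0 = 0"
proof -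
  let ?I = "{0<..<1/3::real}"
  have oI: "open ?I" by simp
  have oJ: "open J" using J by simp
  note dT = C2_on_open_deriv(3,4)[OF oI T]
  have mono: "T x < T y" if "x \<in> ?I" "y \<in> ?I" "x < y" for x y
  proof (rule DERIV_pos_imp_increasing[OF that(3)])
    fix z assume "x \<le> z" "z \<le> y"
    then have z: "z \<in> ?I" using that by auto
    show "\<exists>D. (T has_real_derivative D) (at z) \<and> 0 < D" using dT(1)[OF z] pos[OF z] by blast
  qed
  have inj: "inj_on T ?I"
    by (rule inj_onI) (metis mono less_irrefl linorder_neqE_linordered_idom)
  define \<phi> where "\<phi> = (\<lambda>t. if t \<in> J then inv_into ?I T t else 0)"
  have \<phi>T: "\<phi> (T x) = x" if "x \<in> ?I" for x
    using that img inj by (auto simp: \<phi>_def)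
  have \<phi>J: "\<phi> t \<in> ?I" "T (\<phi> t) = t" if "t \<in> J" for t
    using that img inv_into_into[of t T ?I] f_inv_into_f[of t T ?I] by (auto simp: \<phi>_def)
  have image: "\<phi> ` J = ?I" using \<phi>J \<phi>T img by force
  define \<phi>' where "\<phi>' = (\<lambda>t. inverse (T' (\<phi> t)))"
  define \<phi>'' where "\<phi>'' = (\<lambda>t. - (T'' (\<phi> t) * \<phi>' t) * (\<phi>' t * \<phi>' t))"
  have d\<phi>: "(\<phi> has_real_derivative \<phi>' t) (at t)" if t: "t \<in> J" for t
    unfolding \<phi>'_def
  proof (rule has_field_derivative_inverse_basic)
    show "(T has_real_derivative T' (\<phi> t)) (at (\<phi> t))" by (rule dT(1)[OF \<phi>J(1)[OF t]])
    show "T' (\<phi> t) \<noteq> 0" using pos[OF \<phi>J(1)[OF t]] by simp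
    obtain p q where pq: "0 < p" "p < \<phi> t" "\<phi> t < q" "q < 1/3"
      using \<phi>J(1)[OF t] dense by (metis greaterThanLessThan_iff)
    have "isCont \<phi> (T (\<phi> t))"
    proof (rule isCont_inverse_function2[OF pq(2,3)])
      fix z assume "p \<le> z" "z \<le> q"
      then have "z \<in> ?I" using pq by auto
      then show "\<phi> (T z) = z" "isCont T z" using \<phi>T dT(1) DERIV_isCont by blast+
    qed
    then show "isCont \<phi> t" using \<phi>J(2)[OF t] by simp
  qed (use oJ t \<phi>J in auto)
  have \<phi>'pos: "0 < \<phi>' t" if "t \<in> J" for t using pos[OF \<phi>J(1)[OF that]] by (simp add: \<phi>'_def)
  have d\<phi>': "(\<phi>' has_real_derivative \<phi>'' t) (at t)" if t: "t \<in> J" for t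
  proof -
    have "((\<lambda>t. T' (\<phi> t)) has_real_derivative T'' (\<phi> t) * \<phi>' t) (at t)"
      by (rule DERIV_chain2[OF dT(2)[OF \<phi>J(1)[OF t]] d\<phi>[OF t]])
    then show ?thesis
      unfolding \<phi>'_def \<phi>''_def using pos[OF \<phi>J(1)[OF t]]
      by (auto intro!: derivative_eq_intros simp: field_simps)
  qed
  have c: "continuous_on J \<phi>" "continuous_on J \<phi>'"
    using d\<phi> d\<phi>' by (meson DERIV_isCont continuous_at_imp_continuous_on)+
  have "continuous_on ?I T''" using T by (simp add: C2_on_def)
  then have "continuous_on J (\<lambda>t. T'' (\<phi> t))"
    by (rule continuous_on_compose2[OF _ c(1)]) (use \<phi>J in auto)
  then have "continuous_on J \<phi>''" unfolding \<phi>''_def using c by (intro continuous_intros)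
  then have C2: "C2_on J \<phi> \<phi>' \<phi>''"
    using d\<phi> d\<phi>' by (auto simp: C2_on_def intro: has_field_derivative_at_within)
  define s where "s = (\<lambda>t::real. if kimura_end m 0 then t else 1)"
  define \<beta> where "\<beta> = (\<lambda>t. (drift (\<phi> t) - s t * \<phi>'' t) / \<phi>' t)"
  have L: "kimura_L a b m f (\<phi> t) = s t * deriv (deriv (f \<circ> \<phi>)) t + \<beta> t * deriv (f \<circ> \<phi>) t"
    if f: "smooth_on {0<..<1} f" and t: "t \<in> J" for f t
  proof -
    obtain f' f'' where f: "C2_on {0<..<1} f f' f''" using smooth_on_C2[OF f] .
    have o: "open {0<..<1::real}" by simp
    have x: "\<phi> t \<in> {0<..<1}" using \<phi>J(1)[OF t] by auto
    have "\<phi> ` J \<subseteq> {0<..<1}" using image by auto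
    note d = C2_on_open_deriv(1,2)[OF o f x] C2_on_open_deriv(1,2)[OF oJ C2_on_compose[OF o oJ f C2 this] t]
    have "diffusion (\<phi> t) * T' (\<phi> t) ^ 2 = s t"
      using slope[OF \<phi>J(1)[OF t]] \<phi>J(2)[OF t] by (simp add: s_def kimura_end_def)
    then have A: "diffusion (\<phi> t) = s t * \<phi>' t ^ 2"
      using pos[OF \<phi>J(1)[OF t]] by (simp add: \<phi>'_def field_simps)
    have "\<beta> t * \<phi>' t = drift (\<phi> t) - s t * \<phi>'' t" using \<phi>'pos[OF t] by (simp add: \<beta>_def)
    then have "\<beta> t * (f' (\<phi> t) * \<phi>' t) = (drift (\<phi> t) - s t * \<phi>'' t) * f' (\<phi> t)"
      by (metis mult.assoc mult.commute)
    then show ?thesis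
      unfolding kimura_L_eq d by (simp add: A algebra_simps)
  qed
  have "left_heat_coordinate a b m J \<phi>"
    unfolding left_heat_coordinate_def
  proof (intro conjI)
    show "\<exists>d. J = (if kimura_end m 0 then {0<..<d} else {..<d})"
      using J by (auto simp: kimura_end_def)
    show "kimura_end m 0 \<longrightarrow> \<phi> 0 = 0" using J by (auto simp: \<phi>_def kimura_end_def)
    show "\<phi> ` J = ?I" by (rule image)
    show "\<exists>\<phi>' \<phi>''. C2_on J \<phi> \<phi>' \<phi>'' \<and> (\<forall>t\<in>J. \<phi>' t > 0)" using C2 \<phi>'pos by blast
    show "\<exists>\<beta>. \<forall>f. smooth_on {0<..<1} f \<longrightarrow> (\<forall>t\<in>J. kimura_L a b m f (\<phi> t) =
          (if kimura_end m 0 then t else 1) * deriv (deriv (f \<circ> \<phi>)) t + \<beta> t * deriv (f \<circ> \<phi>) t)"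
      using L unfolding s_def by blast
  qed
  moreover have "\<phi> 0 = 0" if "m 0 = 1" using that J by (auto simp: \<phi>_def)
  ultimately show ?thesis using \<phi>T that by blast
qed

end

lemma has_real_derivative_max_power:
  fixes y :: real
  assumes n: "2 \<le> n"
  shows "((\<lambda>y. max 0 y ^ n) has_real_derivative real n * max 0 y ^ (n - 1)) (at y)"
proof (cases y "0 :: real" rule: linorder_cases)
  case less
  have "((\<lambda>y::real. 0) has_real_derivative 0) (at y)" by simp
  then have "((\<lambda>y. max 0 y ^ n) has_real_derivative 0) (at y)"
    by (rule has_field_derivative_transform_within_open[where S = "{..<0}"]) (use less n in auto)
  moreover have "max 0 y ^ (n - 1) = 0" using less n by simp
  ultimately show ?thesis by (simp only: mult_zero_right)
next
  case equal
  obtain k where k: "n = Suc k" "k \<noteq> 0" using n by (cases n) auto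
  have "((\<lambda>h::real. max 0 h ^ n / h) \<longlongrightarrow> 0) (at 0)"
  proof (rule Lim_null_comparison)
    show "eventually (\<lambda>h::real. norm (max 0 h ^ n / h) \<le> max 0 h ^ (n - 1)) (at 0)"
    proof (rule always_eventually, rule allI)
      fix h :: real
      show "norm (max 0 h ^ n / h) \<le> max 0 h ^ (n - 1)"
        using k by (cases "h > 0") (auto simp: max_def abs_mult)
    qed
    have "((\<lambda>h::real. max 0 h ^ (n - 1)) \<longlongrightarrow> max 0 0 ^ (n - 1)) (at 0)"
      by (intro tendsto_intros)
    moreover have "max 0 0 ^ (n - 1) = (0::real)" using k by simp
    ultimately show "((\<lambda>h::real. max 0 h ^ (n - 1)) \<longlongrightarrow> 0) (at 0)" by (simp only:)
  qed
  then show ?thesis using equal k by (simp add: DERIV_def power_0_left)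
next
  case greater
  have "((\<lambda>y. y ^ n) has_real_derivative real n * y ^ (n - 1)) (at y)"
    by (auto intro!: derivative_eq_intros)
  then have "((\<lambda>y. max 0 y ^ n) has_real_derivative real n * y ^ (n - 1)) (at y)"
    by (rule has_field_derivative_transform_within_open[where S = "{0<..}"]) (use greater in auto)
  then show ?thesis using greater by simp
qed

lemma increasing_if_deriv_pos_inside:
  fixes y :: "real \<Rightarrow> real"
  assumes d: "\<And>x. x \<in> {0<..<1} \<Longrightarrow> (y has_real_derivative D x) (at x)"
    "\<And>x. x \<in> {0<..<1} \<Longrightarrow> 0 < D x"
    and c: "continuous_on {0..<1} y" and st: "0 \<le> s" "s < t" "t < 1"
  shows "y s < y t"
proof (rule DERIV_pos_imp_increasing_open[OF st(2)])
  fix x assume "s < x" "x < t"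
  then have x: "x \<in> {0<..<1}" using st by auto
  show "\<exists>z. (y has_real_derivative z) (at x) \<and> 0 < z" using d[OF x] by blast
qed (use st in \<open>auto intro: continuous_on_subset[OF c]\<close>)

context kimura_operator
begin

text \<open>At a Kimura end the inverse heat coordinate is \<open>T = y\<^sup>2\<close> with \<open>y = \<integral> w/2\<close>, an improper integral that
  the substitution \<open>x = \<sigma>\<^sup>2\<close> makes proper.\<close>

lemma kimura_heat_root:
  assumes m: "m 0 = 1" and w: "\<And>x. x \<in> {0<..<1} \<Longrightarrow> w x = 1 / sqrt (diffusion x)"
  obtains y where "\<And>x. x \<in> {0<..<1} \<Longrightarrow> (y has_real_derivative w x / 2) (at x)"
    "\<And>x. x \<in> {0<..<1} \<Longrightarrow> 0 < y x" "y 0 = 0" "continuous_on {0..<1} y"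
    "((\<lambda>x. y x * w x) \<longlongrightarrow> 1 / a 0) (at_right 0)"
proof -
  define q where "q = (\<lambda>s. 1 / sqrt (a (s\<^sup>2) * (1 - s\<^sup>2) ^ m 1))"
  define h where "h = (\<lambda>s. integral {0..s} q)"
  define y where "y = (\<lambda>x. h (sqrt x))"
  have sq: "s\<^sup>2 \<in> {0..1}" "s\<^sup>2 < 1" if "0 \<le> s" "s < 1" for s :: real
    using that power_strict_mono[of s 1 2] by auto
  have qpos: "0 < q s" "a (s\<^sup>2) * (1 - s\<^sup>2) ^ m 1 > 0" if "0 \<le> s" "s < 1" for s
    using sq[OF that] a_pos[of "s\<^sup>2"] by (auto simp: q_def)
  have cq: "continuous_on {0..c} q" if "c < 1" for c
  proof -
    have "continuous_on {0..c} (\<lambda>s. a (s\<^sup>2))"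
      by (rule continuous_on_compose2[OF continuous_a]) (use that sq in \<open>auto intro!: continuous_intros\<close>)
    then show ?thesis
      unfolding q_def
    proof (intro continuous_intros ballI)
      fix s assume "s \<in> {0..c}"
      then show "sqrt (a (s\<^sup>2) * (1 - s\<^sup>2) ^ m 1) \<noteq> 0" using qpos(2)[of s] that
        by (metis atLeastAtMost_iff le_less_trans less_irrefl real_sqrt_gt_0_iff)
    qed
  qed
  have dh: "(h has_real_derivative q s) (at s within {0..c})" if "s \<in> {0..c}" "c < 1" for s c
    unfolding h_def by (rule integral_has_real_derivative[OF cq]) (use that in auto)
  have dh': "(h has_real_derivative q s) (at s)" if "0 < s" "s < 1" for s
    using dh[of s "(s + 1) / 2"] that by (simp add: at_within_Icc_at)
  have h0: "h 0 = 0" by (simp add: h_def)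
  have hc: "continuous_on {0..c} h" if "c < 1" for c
    using dh that by (meson DERIV_continuous_on)
  have hc1: "continuous_on {0..<1} h"
    unfolding continuous_on_eq_continuous_within
  proof
    fix s :: real assume s: "s \<in> {0..<1}"
    define c where "c = (s + 1) / 2"
    have c: "s < c" "c < 1" using s by (auto simp: c_def)
    have "continuous (at s within {0..c}) h"
      using hc[OF c(2)] s c by (auto simp: continuous_on_eq_continuous_within)
    moreover have "at s within {0..<1} = at s within {0..c}"
      by (rule at_within_nhd[where S = "{..<c}"]) (use s c in auto)
    ultimately show "continuous (at s within {0..<1}) h" by simp
  qed
  have wq: "w x = q (sqrt x) / sqrt x" if "x \<in> {0<..<1}" for x
    using that by (simp add: w q_def diffusion_def m real_sqrt_mult mult_ac)
  show ?thesis
  proof (rule that[of y])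
    fix x :: real assume x: "x \<in> {0<..<1}"
    then have sx: "0 < sqrt x" "sqrt x < 1" by auto
    have "(sqrt has_real_derivative 1 / (2 * sqrt x)) (at x)"
      using x by (auto intro!: derivative_eq_intros simp: field_simps)
    from DERIV_chain2[OF dh'[OF sx] this]
    show "(y has_real_derivative w x / 2) (at x)"
      unfolding y_def by (rule DERIV_cong) (use wq[OF x] in simp)
    have "h 0 < h (sqrt x)"
      by (rule increasing_if_deriv_pos_inside[OF dh' qpos(1) hc1]) (use sx in auto)
    then show "0 < y x" by (simp add: y_def h0)
  next
    show "y 0 = 0" by (simp add: y_def h0)
    show "continuous_on {0..<1} y"
      unfolding y_def by (rule continuous_on_compose2[OF hc1]) (auto intro!: continuous_intros)
    have "((\<lambda>s. (h s - h 0) / (s - 0)) \<longlongrightarrow> q 0) (at 0 within {0..1/2})"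
      using dh[of 0 "1/2"] by (simp add: has_field_derivative_iff)
    then have hq: "((\<lambda>s. h s / s) \<longlongrightarrow> q 0) (at_right 0)"
      by (simp add: h0 at_within_Icc_at_right)
    have "(q \<longlongrightarrow> q 0) (at 0 within {0..1/2})"
      using cq[of "1/2"] by (simp add: continuous_on_def)
    then have qq: "(q \<longlongrightarrow> q 0) (at_right 0)" by (simp add: at_within_Icc_at_right)
    have "filterlim sqrt (at_right 0) (at_right (0::real))"
      unfolding filterlim_at
      by (auto intro!: tendsto_eq_intros simp: eventually_at_right_field intro: exI[of _ 1])
    from filterlim_compose[OF hq this] filterlim_compose[OF qq this]
    have "((\<lambda>x. h (sqrt x) / sqrt x * q (sqrt x)) \<longlongrightarrow> q 0 * q 0) (at_right 0)"
      by (rule tendsto_mult)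
    moreover have "eventually (\<lambda>x. h (sqrt x) / sqrt x * q (sqrt x) = y x * w x) (at_right 0)"
      unfolding eventually_at_right_field
      by (rule exI[of _ 1]) (auto simp: y_def wq)
    ultimately have "((\<lambda>x. y x * w x) \<longlongrightarrow> q 0 * q 0) (at_right 0)"
      by (rule Lim_transform_eventually)
    moreover have "q 0 * q 0 = 1 / a 0" using a_pos[of 0] by (simp add: q_def)
    ultimately show "((\<lambda>x. y x * w x) \<longlongrightarrow> 1 / a 0) (at_right 0)" by simp
  qed
qed

lemma kimura_heat_inverse:
  assumes m: "m 0 = 1" and w: "C2_on {0<..<1} w w' w''"
    "\<And>x. x \<in> {0<..<1} \<Longrightarrow> 0 < w x" "\<And>x. x \<in> {0<..<1} \<Longrightarrow> diffusion x * w x ^ 2 = 1"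
    and y: "\<And>x. x \<in> {0<..<1} \<Longrightarrow> (y has_real_derivative w x / 2) (at x)"
    "\<And>x. x \<in> {0<..<1} \<Longrightarrow> 0 < y x" "y 0 = 0" "continuous_on {0..<1} y"
  obtains d \<phi> where "left_heat_coordinate a b m {0<..<d} \<phi>" "\<phi> 0 = 0"
    "\<And>x. x \<in> {0<..<1/3} \<Longrightarrow> (y x)\<^sup>2 \<in> {0<..<d} \<and> \<phi> ((y x)\<^sup>2) = x"
proof -
  note dw = C2_on_open_deriv(3,4)[OF open_greaterThanLessThan w(1)]
  have mono: "y s < y t" if "0 \<le> s" "s < t" "t < 1" for s t
    by (rule increasing_if_deriv_pos_inside[OF y(1) _ y(4) that]) (use w(2) in auto)
  have nonneg: "0 \<le> y s" if "0 \<le> s" "s < 1" for s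
    using y(2)[of s] y(3) that by (cases "s = 0") (auto intro: less_imp_le)
  define T where "T = (\<lambda>x. (y x)\<^sup>2)"
  have Tmono: "T s < T t" if "0 \<le> s" "s < t" "t < 1" for s t
    unfolding T_def using mono[OF that] nonneg[of s] that by (intro power_strict_mono) auto
  have dT: "(T has_real_derivative y x * w x) (at x)" if "x \<in> {0<..<1}" for x
    unfolding T_def using y(1)[OF that] by (auto intro!: derivative_eq_intros)
  have dT': "((\<lambda>x. y x * w x) has_real_derivative w x ^ 2 / 2 + y x * w' x) (at x)" if "x \<in> {0<..<1}" for x
    using y(1)[OF that] dw(1)[OF that] by (auto intro!: derivative_eq_intros simp: power2_eq_square)
  have cT: "continuous_on {0..<1} T" unfolding T_def by (intro continuous_intros y(4))
  have "continuous_on {0<..<1} w" "continuous_on {0<..<1} w'" "continuous_on {0<..<1} y"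
    using dw y(1) by (meson DERIV_isCont continuous_at_imp_continuous_on)+
  then have "continuous_on {0<..<1} (\<lambda>x. w x ^ 2 / 2 + y x * w' x)" by (intro continuous_intros) auto
  then have "C2_on {0<..<1} T (\<lambda>x. y x * w x) (\<lambda>x. w x ^ 2 / 2 + y x * w' x)"
    using dT dT' by (auto simp: C2_on_def intro: has_field_derivative_at_within)
  then have C2: "C2_on {0<..<1/3} T (\<lambda>x. y x * w x) (\<lambda>x. w x ^ 2 / 2 + y x * w' x)"
    by (rule C2_on_subset) auto
  have img: "T ` {0<..<1/3} = {0<..<T (1/3)}"
  proof (intro equalityI subsetI)
    fix t assume "t \<in> T ` {0<..<1/3}"
    then obtain x where "x \<in> {0<..<1/3}" "t = T x" by auto
    then show "t \<in> {0<..<T (1/3)}"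
      using Tmono[of 0 x] Tmono[of x "1/3"] y(3) by (auto simp: T_def)
  next
    fix t assume t: "t \<in> {0<..<T (1/3)}"
    have "\<exists>x\<ge>0. x \<le> 1/3 \<and> T x = t"
      by (rule IVT') (use t y(3) in \<open>auto simp: T_def intro: continuous_on_subset[OF cT[unfolded T_def]]\<close>)
    then obtain x where x: "0 \<le> x" "x \<le> 1/3" "T x = t" by auto
    moreover have "x \<noteq> 0" using x(3) t y(3) by (auto simp: T_def)
    moreover have "x \<noteq> 1/3" using x(3) t by force
    ultimately show "t \<in> T ` {0<..<1/3}" by force
  qed
  have slope: "diffusion x * (y x * w x)\<^sup>2 = (if m 0 = 1 then T x else 1)" if "x \<in> {0<..<1/3}" for x
    using w(3)[of x] that m by (simp add: T_def power_mult_distrib mult.left_commute)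
  have pos: "0 < y x * w x" if "x \<in> {0<..<1/3}" for x using y(2)[of x] w(2)[of x] that by auto
  have J: "{0<..<T (1/3)} = (if m 0 = 1 then {0<..<T (1/3)} else {..<T (1/3)})" using m by simp
  obtain \<phi> where \<phi>: "left_heat_coordinate a b m {0<..<T (1/3)} \<phi>"
    "\<And>x. x \<in> {0<..<1/3} \<Longrightarrow> \<phi> (T x) = x" "m 0 = 1 \<Longrightarrow> \<phi> 0 = 0"
    by (rule heat_coordinate_from_inverse[OF C2 pos slope img J]) blast+
  have "(y x)\<^sup>2 \<in> {0<..<T (1/3)}" if "x \<in> {0<..<1/3}" for x
    using img that unfolding T_def by auto
  then show ?thesis using that[OF \<phi>(1)] \<phi>(2,3) m unfolding T_def by blast
qed

text \<open>The inverse heat coordinate is an antiderivative of \<open>w\<close>. It tends to \<open>-\<infinity>\<close> at \<open>0\<close> since \<open>w\<close> is at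
  least a multiple of \<open>1/x\<close>.\<close>

lemma quadratic_heat_exists:
  assumes m: "m 0 = 2"
  obtains J \<phi> where "left_heat_coordinate a b m J \<phi>"
proof -
  obtain w w' w'' where w: "C2_on {0<..<1} w w' w''"
    "\<And>x. x \<in> {0<..<1} \<Longrightarrow> 0 < w x" "\<And>x. x \<in> {0<..<1} \<Longrightarrow> w x = 1 / sqrt (diffusion x)"
    "\<And>x. x \<in> {0<..<1} \<Longrightarrow> diffusion x * w x ^ 2 = 1"
    by (rule inverse_sqrt_diffusion) (rule that, blast+)
  have "continuous_on {0<..<1} w" using w(1) unfolding C2_on_def by (blast intro: DERIV_continuous_on)
  then obtain T where dT: "\<And>x. x \<in> {0<..<1} \<Longrightarrow> (T has_real_derivative w x) (at x)"
    using antiderivative_exists by blast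
  have "C2_on {0<..<1} T w w'"
    using dT w(1) unfolding C2_on_def by (auto intro: has_field_derivative_at_within DERIV_continuous_on)
  then have C2: "C2_on {0<..<1/3} T w w'" by (rule C2_on_subset) auto
  have mono: "T s < T t" if "0 < s" "s < t" "t < 1" for s t
  proof (rule DERIV_pos_imp_increasing[OF that(2)])
    fix z assume "s \<le> z" "z \<le> t"
    then have z: "z \<in> {0<..<1}" using that by auto
    show "\<exists>D. (T has_real_derivative D) (at z) \<and> 0 < D" using dT[OF z] w(2)[OF z] by blast
  qed
  obtain C0 where C0: "\<And>x. x \<in> {0<..1/2} \<Longrightarrow> diffusion x \<le> C0 * x ^ m 0"
    using diffusion_bounds by metis
  define C where "C = max C0 1"
  have C: "1 \<le> C" "diffusion x \<le> C * x\<^sup>2" if "x \<in> {0<..1/2}" for x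
    using C0[OF that] m mult_right_mono[of C0 C "x\<^sup>2"] by (simp_all add: C_def)
  have C1: "1 \<le> C" by (simp add: C_def)
  have low: "1 / (C * x) \<le> w x" if x: "x \<in> {0<..1/2}" for x
  proof -
    have "C * x\<^sup>2 \<le> C * (C * x\<^sup>2)"
      using mult_right_mono[of 1 C "C * x\<^sup>2"] C1 by simp
    moreover have "C * (C * x\<^sup>2) = (C * x)\<^sup>2" by (simp add: power2_eq_square)
    ultimately have "diffusion x \<le> (C * x)\<^sup>2" using C(2)[OF x] by linarith
    then have "sqrt (diffusion x) \<le> C * x"
      using x C1 by (intro real_le_lsqrt) auto
    then show ?thesis
      using w(3)[of x] diffusion_pos[of x] x C1 by (auto intro!: divide_left_mono)
  qed
  have step: "T s - ln s / C \<le> T (1/3) - ln (1/3) / C" if s: "0 < s" "s \<le> 1/3" for s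
  proof (rule DERIV_nonneg_imp_nondecreasing[OF s(2)])
    fix z :: real assume z: "s \<le> z" "z \<le> 1/3"
    then have z': "z \<in> {0<..1/2}" "z \<in> {0<..<1}" "0 < z" using s by auto
    have "((\<lambda>s. T s - ln s / C) has_real_derivative w z - 1 / (C * z)) (at z)"
      using dT[OF z'(2)] z'(3) C1 by (auto intro!: derivative_eq_intros simp: field_simps)
    then show "\<exists>D. ((\<lambda>s. T s - ln s / C) has_real_derivative D) (at z) \<and> 0 \<le> D"
      using low[OF z'(1)] by (intro exI[of _ "w z - 1 / (C * z)"]) simp
  qed
  have img: "T ` {0<..<1/3} = {..<T (1/3)}"
  proof (intro equalityI subsetI)
    fix t assume "t \<in> T ` {0<..<1/3}"
    then show "t \<in> {..<T (1/3)}" using mono[of _ "1/3"] by auto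
  next
    fix t assume t: "t \<in> {..<T (1/3)}"
    define s where "s = 1/3 * exp (- (C * (T (1/3) - t)))"
    have "0 \<le> C * (T (1/3) - t)" using t C1 by simp
    then have s: "0 < s" "s \<le> 1/3" by (auto simp: s_def)
    have "ln s = ln (1/3) - C * (T (1/3) - t)" by (simp add: s_def ln_mult ln_div)
    then have "ln s / C = ln (1/3) / C - (T (1/3) - t)" using C1 by (simp add: field_simps)
    then have "T s \<le> t" using step[OF s] by linarith
    have "continuous_on {s..1/3} T"
      using dT s by (intro DERIV_continuous_on[of _ _ w]) (auto intro: has_field_derivative_at_within)
    then obtain x where x: "s \<le> x" "x \<le> 1/3" "T x = t"
      using IVT'[of T s t "1/3"] \<open>T s \<le> t\<close> t s by auto
    then have "x \<noteq> 1/3" using t by force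
    then show "t \<in> T ` {0<..<1/3}" using x s by force
  qed
  have pos: "0 < w x" and slope: "diffusion x * w x ^ 2 = (if m 0 = 1 then T x else 1)"
    if "x \<in> {0<..<1/3}" for x
    using w(2)[of x] w(4)[of x] that m by auto
  have J: "{..<T (1/3)} = (if m 0 = 1 then {0<..<T (1/3)} else {..<T (1/3)})" using m by simp
  show ?thesis
    by (rule heat_coordinate_from_inverse[OF C2 pos slope img J]) (assumption+, rule that, blast+)
qed

lemma heat_coordinate_exists: obtains J \<phi> where "left_heat_coordinate a b m J \<phi>"
proof (cases "m 0 = 1")
  case True
  obtain w w' w'' where w: "C2_on {0<..<1} w w' w''"
    "\<And>x. x \<in> {0<..<1} \<Longrightarrow> 0 < w x" "\<And>x. x \<in> {0<..<1} \<Longrightarrow> w x = 1 / sqrt (diffusion x)"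
    "\<And>x. x \<in> {0<..<1} \<Longrightarrow> diffusion x * w x ^ 2 = 1"
    by (rule inverse_sqrt_diffusion) (rule that, blast+)
  obtain y where y: "\<And>x. x \<in> {0<..<1} \<Longrightarrow> (y has_real_derivative w x / 2) (at x)"
    "\<And>x. x \<in> {0<..<1} \<Longrightarrow> 0 < y x" "y 0 = 0" "continuous_on {0..<1} y"
    by (rule kimura_heat_root[OF True w(3)]) (assumption, rule that, blast+)
  show ?thesis by (rule kimura_heat_inverse[OF True w(1,2,4) y]) (assumption+, rule that, blast+)
next
  case False
  then show ?thesis using m_cases(1) quadratic_heat_exists that by blast
qed

text \<open>All derivatives of a function that is constant near the end vanish there, so it meets the boundary
  condition for every type of end; the Hoelder conditions are tested on a small
  neighbourhood of the end.\<close>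

lemma left_C2_holder_const:
  assumes \<gamma>: "0 < \<gamma>" "\<gamma> < 1" and e: "0 < e" and f: "\<And>x. x \<in> {0..e} \<Longrightarrow> f x = C"
  shows "left_C2_holder a b m \<gamma> f"
proof -
  obtain J \<phi> where H: "left_heat_coordinate a b m J \<phi>" by (rule heat_coordinate_exists)
  obtain d where J: "J = (if kimura_end m 0 then {0<..<d} else {..<d})"
    using H unfolding left_heat_coordinate_def by blast
  have img: "\<phi> ` J = {0<..<1/3}" and phi0: "kimura_end m 0 \<longrightarrow> \<phi> 0 = 0"
    using H unfolding left_heat_coordinate_def by blast+
  have "min e (1/4) \<in> \<phi> ` J" unfolding img using e by auto
  then obtain c where c: "c \<in> J" "\<phi> c = min e (1/4)" by (metis imageE)
  have val: "f (\<phi> t) = C" if "t \<in> J" "t \<le> c" for t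
  proof -
    have "\<phi> t \<in> {0<..<1/3}" using img that(1) by blast
    moreover have "\<phi> t \<le> \<phi> c"
      using heat_coordinate_increasing[OF H that(1) c(1)] that(2) by (cases "t = c") auto
    ultimately show ?thesis using c(2) by (intro f) auto
  qed
  have "if kimura_end m 0 then kimura_C2_holder \<gamma> c (f \<circ> \<phi>)
               else quadratic_C2_holder \<gamma> (b 0 / a 0 = 1) c (f \<circ> \<phi>)"
  proof (cases "kimura_end m 0")
    case True
    then have "0 < c" using c J by auto
    have "kimura_C2_holder \<gamma> c (f \<circ> \<phi>)"
    proof (rule kimura_C2_holder_cong[OF kimura_C2_holder_polynomial[OF \<gamma> \<open>0 < c\<close>, of 0 C]])
      fix t assume t: "t \<in> {0..c}"
      show "(f \<circ> \<phi>) t = 0 * (c - t) ^ 4 + C"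
      proof (cases "t = 0")
        case True
        then show ?thesis using phi0 \<open>kimura_end m 0\<close> f[of 0] e by simp
      next
        case False
        then have "t \<in> J" using t c J \<open>kimura_end m 0\<close> by auto
        then show ?thesis using val t by auto
      qed
    qed
    then show ?thesis using True by simp
  next
    case False
    have "quadratic_C2_holder \<gamma> (b 0 / a 0 = 1) c (f \<circ> \<phi>)"
      by (rule quadratic_C2_holder_cong[OF quadratic_C2_holder_const[where C = C]])
        (use val J c False in auto)
    then show ?thesis using False by simp
  qed
  then show ?thesis unfolding left_C2_holder_def using H c(1) by blast
qed

text \<open>At a Kimura transverse end \<open>L f\<close> need not vanish: in the heat coordinate \<open>t\<close> the function
  \<open>- (c - t)\<^sup>4\<close>, cut off at \<open>t = c\<close>, is three times continuously differentiable and \<open>L\<close> maps it to a function with value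
  \<open>4 c\<^sup>3 b(0)/a(0)\<close> at the end.\<close>

lemma kimura_transverse_test_function:
  assumes \<gamma>: "0 < \<gamma>" "\<gamma> < 1" and m: "m 0 = 1" and b: "0 < b 0"
  obtains f f' f'' f''' g where "continuous_on {0..1} f" "left_C2_holder a b m \<gamma> f"
    "\<And>x. x \<in> {0<..<1} \<Longrightarrow> (f has_real_derivative f' x) (at x)" "C2_on {0<..<1} f' f'' f'''"
    "\<And>x. x \<in> {1/4..1} \<Longrightarrow> f x = 0"
    "continuous_on {0..1} g" "g 0 \<noteq> 0" "g 1 = 0"
    "\<And>x. x \<in> {0<..<1} \<Longrightarrow> g x = diffusion x * f'' x + drift x * f' x"
proof -
  obtain w w' w'' A' where w: "C2_on {0<..<1} w w' w''"
    "\<And>x. x \<in> {0<..<1} \<Longrightarrow> 0 < w x" "\<And>x. x \<in> {0<..<1} \<Longrightarrow> w x = 1 / sqrt (diffusion x)"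
    "\<And>x. x \<in> {0<..<1} \<Longrightarrow> diffusion x * w x ^ 2 = 1"
    and A': "continuous_on {0..1} A'"
    "\<And>x. x \<in> {0<..<1} \<Longrightarrow> diffusion x * w' x = - A' x * w x / 2" "m 0 = 1 \<Longrightarrow> A' 0 = a 0"
    by (rule inverse_sqrt_diffusion) (rule that, blast+)
  obtain y where y: "\<And>x. x \<in> {0<..<1} \<Longrightarrow> (y has_real_derivative w x / 2) (at x)"
    "\<And>x. x \<in> {0<..<1} \<Longrightarrow> 0 < y x" "y 0 = 0" "continuous_on {0..<1} y"
    "((\<lambda>x. y x * w x) \<longlongrightarrow> 1 / a 0) (at_right 0)"
    by (rule kimura_heat_root[OF m w(3)]) (assumption, rule that, blast+)
  obtain d \<phi> where \<phi>: "left_heat_coordinate a b m {0<..<d} \<phi>" "\<phi> 0 = 0"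
    "\<And>x. x \<in> {0<..<1/3} \<Longrightarrow> (y x)\<^sup>2 \<in> {0<..<d} \<and> \<phi> ((y x)\<^sup>2) = x"
    by (rule kimura_heat_inverse[OF m w(1,2,4) y(1-4)]) (assumption+, rule that, blast+)
  note dw = C2_on_open_deriv(3,4)[OF open_greaterThanLessThan w(1)]
  have mono: "y s < y t" if "0 \<le> s" "s < t" "t < 1" for s t
    by (rule increasing_if_deriv_pos_inside[OF y(1) _ y(4) that]) (use w(2) in auto)
  define c where "c = (y (1/4))\<^sup>2"
  have cd: "c \<in> {0<..<d}" using \<phi>(3)[of "1/4"] by (simp add: c_def)
  define M where "M = (\<lambda>x. max 0 (c - (y x)\<^sup>2))"
  define T1 where "T1 = (\<lambda>x. y x * w x)"
  define T2 where "T2 = (\<lambda>x. w x ^ 2 / 2 + y x * w' x)"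
  define T3 where "T3 = (\<lambda>x. 3/2 * (w x * w' x) + y x * w'' x)"
  have M0: "M x = 0" if "1/4 \<le> x" "x < 1" for x
  proof -
    have "1/4 = x \<or> 1/4 < x" using that by linarith
    then have "y (1/4) \<le> y x" using mono[of "1/4" x] that(2) by (elim disjE) (simp_all only: order_refl less_imp_le)
    then have "c \<le> (y x)\<^sup>2" unfolding c_def using y(2)[of "1/4"] by (intro power_mono) auto
    then show ?thesis by (simp add: M_def)
  qed
  have dT: "((\<lambda>x. c - (y x)\<^sup>2) has_real_derivative - T1 x) (at x)" if "x \<in> {0<..<1}" for x
    unfolding T1_def using y(1)[OF that] by (auto intro!: derivative_eq_intros)
  have dT1: "(T1 has_real_derivative T2 x) (at x)" if "x \<in> {0<..<1}" for x
    unfolding T1_def T2_def using y(1)[OF that] dw(1)[OF that]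
    by (auto intro!: derivative_eq_intros simp: power2_eq_square)
  have dT2: "(T2 has_real_derivative T3 x) (at x)" if "x \<in> {0<..<1}" for x
    unfolding T2_def T3_def using y(1)[OF that] dw[OF that]
    by (auto intro!: derivative_eq_intros simp: field_simps)
  have dM: "((\<lambda>x. M x ^ n) has_real_derivative - (real n * M x ^ (n - 1) * T1 x)) (at x)"
    if "2 \<le> n" "x \<in> {0<..<1}" for n x
    using DERIV_chain2[OF has_real_derivative_max_power[OF that(1)] dT[OF that(2)]]
    by (simp add: M_def)
  have cy: "continuous_on {0<..<1} w" "continuous_on {0<..<1} w'" "continuous_on {0<..<1} y"
    using dw y(1) by (meson DERIV_isCont continuous_at_imp_continuous_on)+
  moreover have "continuous_on {0<..<1} w''" using w(1) by (simp add: C2_on_def)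
  ultimately have cT: "continuous_on {0<..<1} T1" "continuous_on {0<..<1} T2" "continuous_on {0<..<1} T3" "continuous_on {0<..<1} M"
    unfolding T1_def T2_def T3_def M_def by (intro continuous_intros; simp)+
  \<comment> \<open>\<open>y\<close> is unspecified at \<open>1\<close>, so the vanishing of \<open>M\<close> beyond \<open>1/4\<close> is made explicit. The fourth power makes \<open>f''\<close> continuously differentiable.\<close>
  define f where "f = (\<lambda>x. if x \<le> 1/4 then - (M x ^ 4) else 0)"
  define f' where "f' = (\<lambda>x. 4 * M x ^ 3 * T1 x)"
  define f'' where "f'' = (\<lambda>x. - 12 * M x ^ 2 * T1 x ^ 2 + 4 * M x ^ 3 * T2 x)"
  define f''' where "f''' = (\<lambda>x. 24 * M x * T1 x ^ 3 - 36 * M x ^ 2 * T1 x * T2 x + 4 * M x ^ 3 * T3 x)"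
  have feq: "f x = - (M x ^ 4)" if "x \<in> {0..<1}" for x
    using M0[of x] that by (auto simp: f_def)
  have df: "(f has_real_derivative f' x) (at x)" if x: "x \<in> {0<..<1}" for x
  proof -
    have "((\<lambda>x. - (M x ^ 4)) has_real_derivative f' x) (at x)"
      unfolding f'_def using DERIV_minus[OF dM[of 4, OF _ x]] by simp
    then show ?thesis
      by (rule has_field_derivative_transform_within_open[where S = "{0<..<1}"]) (use x feq in auto)
  qed
  have df': "(f' has_real_derivative f'' x) (at x)" if x: "x \<in> {0<..<1}" for x
    unfolding f'_def f''_def
    by (rule DERIV_cong, rule derivative_intros, rule derivative_intros, rule derivative_intros,
        rule dM[of 3, OF _ x], simp, rule dT1[OF x])
      (simp add: power2_eq_square algebra_simps)
  have df'': "(f'' has_real_derivative f''' x) (at x)" if x: "x \<in> {0<..<1}" for x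
    unfolding f''_def f'''_def
    by (rule DERIV_cong, (rule derivative_intros dM[of 3, OF _ x] dM[of 2, OF _ x] dT1[OF x] dT2[OF x] | simp)+)
      (simp add: power2_eq_square power3_eq_cube algebra_simps)
  have "continuous_on {0<..<1} f'''" unfolding f'''_def by (intro continuous_intros cT)
  then have C2: "C2_on {0<..<1} f' f'' f'''"
    using df' df'' by (auto simp: C2_on_def intro: has_field_derivative_at_within)
  define k where "k = (\<lambda>x. 1/2 + y x * w x * (drift x - A' x / 2))"
  have Lf: "diffusion x * f'' x + drift x * f' x = - 12 * M x ^ 2 * (y x)\<^sup>2 + 4 * M x ^ 3 * k x"
    if x: "x \<in> {0<..<1}" for x
  proof -
    have "diffusion x * T1 x ^ 2 = (diffusion x * w x ^ 2) * (y x)\<^sup>2"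
      by (simp add: T1_def power_mult_distrib)
    then have 1: "diffusion x * T1 x ^ 2 = (y x)\<^sup>2" using w(4)[OF x] by simp
    have "diffusion x * T2 x + drift x * T1 x = diffusion x * w x ^ 2 / 2 + y x * (diffusion x * w' x) + drift x * (y x * w x)"
      by (simp add: T1_def T2_def algebra_simps)
    then have 2: "diffusion x * T2 x + drift x * T1 x = k x"
      unfolding k_def w(4)[OF x] A'(2)[OF x] by (simp add: algebra_simps)
    have "diffusion x * f'' x + drift x * f' x
        = - 12 * M x ^ 2 * (diffusion x * T1 x ^ 2) + 4 * M x ^ 3 * (diffusion x * T2 x + drift x * T1 x)"
      by (simp add: f'_def f''_def algebra_simps)
    then show ?thesis unfolding 1 2 .
  qed
  have cdrift: "continuous_on {0..1} drift" unfolding drift_def by (intro continuous_intros continuous_b)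
  have "((\<lambda>x. 1/2 + y x * w x * (drift x - A' x / 2)) \<longlongrightarrow> 1/2 + 1 / a 0 * (drift 0 - A' 0 / 2)) (at_right 0)"
    by (intro tendsto_intros y(5) tendsto_at_zero cdrift A'(1)) simp
  moreover have "1/2 + 1 / a 0 * (drift 0 - A' 0 / 2) = b 0 / a 0"
    using A'(3)[OF m] a_pos[of 0] m by (simp add: drift_def field_simps)
  ultimately have klim: "(k \<longlongrightarrow> b 0 / a 0) (at_right 0)" by (simp add: k_def)
  define k0 where "k0 = (\<lambda>x. if x = 0 then b 0 / a 0 else k x)"
  have "continuous_on {0<..<1} k"
    unfolding k_def using cy A'(1) cdrift
    by (intro continuous_intros) (auto intro: continuous_on_subset)
  have ck0: "continuous_on {0..1/2} k0"
    unfolding continuous_on_def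
  proof
    fix x :: real assume x: "x \<in> {0..1/2}"
    show "(k0 \<longlongrightarrow> k0 x) (at x within {0..1/2})"
    proof (cases "x = 0")
      case True
      have "eventually (\<lambda>x. k x = k0 x) (at_right 0)"
        unfolding eventually_at_right_field by (rule exI[of _ 1]) (auto simp: k0_def)
      from Lim_transform_eventually[OF klim this]
      show ?thesis using True by (simp add: at_within_Icc_at_right k0_def)
    next
      case False
      have "isCont k x"
        using \<open>continuous_on {0<..<1} k\<close> x False by (simp add: continuous_on_eq_continuous_at)
      then have "(k \<longlongrightarrow> k x) (at x within {0..1/2})"
        unfolding isCont_def by (rule tendsto_within_subset) simp
      moreover have "eventually (\<lambda>x. k x = k0 x) (at x within {0..1/2})"
        using eventually_neq_at_within[of 0 x "{0..1/2}"]
        by eventually_elim (simp add: k0_def)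
      ultimately have "(k0 \<longlongrightarrow> k x) (at x within {0..1/2})" by (rule Lim_transform_eventually)
      then show ?thesis using False by (simp add: k0_def)
    qed
  qed
  have cy2: "continuous_on {0..1/2} y" by (rule continuous_on_subset[OF y(4)]) auto
  then have cM: "continuous_on {0..1/2} M" unfolding M_def by (intro continuous_intros)
  define g where "g = (\<lambda>x. if x \<le> 1/4 then - 12 * M x ^ 2 * (y x)\<^sup>2 + 4 * M x ^ 3 * k0 x else 0)"
  have M_quarter: "M x = 0" if "x * 4 = 1" for x using M0[of x] that by auto
  have split: "{0..1} = {0..1/4} \<union> {1/4..1::real}" by auto
  show ?thesis
  proof (rule that[of f f' f'' f''' g])
    show "continuous_on {0..1} f"
      unfolding f_def split
      by (rule continuous_on_If) (use M_quarter in \<open>auto intro!: continuous_intros continuous_on_subset[OF cM]\<close>)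
    show "continuous_on {0..1} g"
      unfolding g_def split
      by (rule continuous_on_If) (use M_quarter in
          \<open>auto intro!: continuous_intros continuous_on_subset[OF cM] continuous_on_subset[OF cy2] continuous_on_subset[OF ck0]\<close>)
    show "f x = 0" if "x \<in> {1/4..1}" for x using M0[of x] that by (auto simp: f_def)
    have "M 0 = c" using y(3) cd by (simp add: M_def)
    then show "g 0 \<noteq> 0" using cd b a_pos[of 0] y(3) by (simp add: g_def k0_def)
    show "g 1 = 0" by (simp add: g_def)
    show "g x = diffusion x * f'' x + drift x * f' x" if "x \<in> {0<..<1}" for x
      unfolding Lf[OF that] using M0[of x] that by (auto simp: g_def k0_def)
    show "left_C2_holder a b m \<gamma> f"
      unfolding left_C2_holder_def
    proof (intro exI conjI bexI)
      show "left_heat_coordinate a b m {0<..<d} \<phi>" by (rule \<phi>(1))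
      show "c \<in> {0<..<d}" by (rule cd)
      have "kimura_C2_holder \<gamma> c (f \<circ> \<phi>)"
      proof (rule kimura_C2_holder_cong)
        show "kimura_C2_holder \<gamma> c (\<lambda>t. - 1 * (c - t) ^ 4 + 0)"
          by (rule kimura_C2_holder_polynomial[OF \<gamma>]) (use cd in auto)
        fix t assume t: "t \<in> {0..c}"
        show "(f \<circ> \<phi>) t = - 1 * (c - t) ^ 4 + 0"
        proof (cases "t = 0")
          case True
          then show ?thesis using \<phi>(2) y(3) cd by (simp add: f_def M_def)
        next
          case False
          then have tJ: "t \<in> {0<..<d}" using t cd by auto
          have "\<phi> ` {0<..<d} = {0<..<1/3}" using \<phi>(1) unfolding left_heat_coordinate_def by blast
          then have x: "\<phi> t \<in> {0<..<1/3}" using tJ by blast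
          have "(y (\<phi> t))\<^sup>2 = t"
          proof (rule ccontr)
            assume ne: "(y (\<phi> t))\<^sup>2 \<noteq> t"
            have "\<phi> ((y (\<phi> t))\<^sup>2) = \<phi> t" "(y (\<phi> t))\<^sup>2 \<in> {0<..<d}" using \<phi>(3)[OF x] by auto
            then show False
              using heat_coordinate_increasing[OF \<phi>(1)] ne tJ by (metis less_irrefl linorder_neqE_linordered_idom)
          qed
          then have "M (\<phi> t) = c - t" using t by (simp add: M_def)
          then show ?thesis using feq[of "\<phi> t"] x by simp
        qed
      qed
      then show "if kimura_end m 0 then kimura_C2_holder \<gamma> c (f \<circ> \<phi>)
               else quadratic_C2_holder \<gamma> (b 0 / a 0 = 1) c (f \<circ> \<phi>)"
        using m by (simp add: kimura_end_def)
    qed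
  qed (use df C2 in auto)
qed

end

section \<open>Reflection of the unit interval\<close>

lemma smooth_on_reflect:
  assumes "smooth_on {0..1} f"
  shows "smooth_on {0..1} (\<lambda>x. c * f (1 - x))"
proof -
  obtain D where D: "\<forall>x\<in>{0..1}. D 0 x = f x"
    "\<forall>n. \<forall>x\<in>{0..1}. (D n has_real_derivative D (Suc n) x) (at x within {0..1})"
    using assms unfolding smooth_on_def by blast
  show ?thesis
    unfolding smooth_on_def
  proof (intro exI[of _ "\<lambda>n x. c * ((- 1) ^ n * D n (1 - x))"] conjI ballI allI)
    fix x :: real assume x: "x \<in> {0..1}"
    then show "c * ((- 1) ^ 0 * D 0 (1 - x)) = c * f (1 - x)" using D(1) by simp
    fix n
    have "((\<lambda>x. 1 - x) has_real_derivative - 1) (at x within {0..1})"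
      by (auto intro!: derivative_eq_intros)
    moreover have "(D n has_real_derivative D (Suc n) (1 - x)) (at (1 - x) within (\<lambda>x. 1 - x) ` {0..1})"
      by (rule DERIV_subset[of _ _ _ "{0..1}"]) (use D(2) x in auto)
    ultimately have "((\<lambda>x. D n (1 - x)) has_real_derivative D (Suc n) (1 - x) * - 1) (at x within {0..1})"
      using DERIV_image_chain[of "D n" "D (Suc n) (1 - x)" "\<lambda>x. 1 - x" x "{0..1}" "- 1"]
      by (simp add: comp_def)
    then show "((\<lambda>x. c * ((- 1) ^ n * D n (1 - x))) has_real_derivative c * ((- 1) ^ Suc n * D (Suc n) (1 - x))) (at x within {0..1})"
      by (auto intro!: derivative_eq_intros)
  qed
qed

lemma has_real_derivative_reflect:
  assumes "(f has_real_derivative D) (at (1 - x))"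
  shows "((\<lambda>x. f (1 - x)) has_real_derivative - D) (at x)"
proof -
  have "((\<lambda>x. 1 - x) has_real_derivative - 1) (at x)"
    by (auto intro!: derivative_eq_intros)
  from DERIV_chain2[OF assms this] show ?thesis by simp
qed

lemma continuous_on_reflect:
  "continuous_on {0..1} f \<Longrightarrow> continuous_on {0..1} (\<lambda>x::real. f (1 - x) :: real)"
  by (rule continuous_on_compose2[of "{0..1}" f]) (auto intro!: continuous_intros)

lemma filterlim_reflect_at_left: "filterlim (\<lambda>x::real. 1 - x) (at_right 0) (at_left 1)"
  unfolding filterlim_at
  by (auto intro!: tendsto_eq_intros simp: eventually_at_left_field intro: exI[of _ 0])

context kimura_operator
begin

lemma reflected: "kimura_operator (\<lambda>x. a (1 - x)) (\<lambda>x. - b (1 - x)) (\<lambda>i. m (1 - i))"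
proof
  have "smooth_on {0..1} (\<lambda>x. a (1 - x))" "smooth_on {0..1} (\<lambda>x. - b (1 - x))"
    using smooth_on_reflect[of a 1] smooth_on_reflect[of b "- 1"] mixed
    by (auto simp: mixed_kimura_operator_def)
  then show "mixed_kimura_operator (\<lambda>x. a (1 - x)) (\<lambda>x. - b (1 - x)) (\<lambda>i. m (1 - i))"
    using mixed by (auto simp: mixed_kimura_operator_def)
qed

lemma reflected_coefficients:
  "kimura_operator.diffusion (\<lambda>x. a (1 - x)) (\<lambda>i. m (1 - i)) x = diffusion (1 - x)"
  "kimura_operator.drift (\<lambda>x. - b (1 - x)) (\<lambda>i. m (1 - i)) x = - drift (1 - x)"
  "kimura_operator.speed_density (\<lambda>x. a (1 - x)) (\<lambda>i. m (1 - i)) (\<lambda>x. W (1 - x)) x = speed_density W (1 - x)"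
proof -
  interpret R: kimura_operator "\<lambda>x. a (1 - x)" "\<lambda>x. - b (1 - x)" "\<lambda>i. m (1 - i)" by (rule reflected)
  show d: "R.diffusion x = diffusion (1 - x)" unfolding R.diffusion_def diffusion_def by simp
  show "R.drift x = - drift (1 - x)" unfolding R.drift_def drift_def by simp
  show "R.speed_density (\<lambda>x. W (1 - x)) x = speed_density W (1 - x)"
    unfolding R.speed_density_def speed_density_def d ..
qed

lemma reflected_transverse:
  "transverse_end (\<lambda>x. a (1 - x)) (\<lambda>x. - b (1 - x)) (\<lambda>i. m (1 - i)) 0 \<longleftrightarrow> transverse_end a b m 1"
  by (auto simp: transverse_end_def kimura_end_def)

lemma reflected_integrating_factor:
  assumes W: "integrating_factor a b W"
  shows "integrating_factor (\<lambda>x. a (1 - x)) (\<lambda>x. - b (1 - x)) (\<lambda>x. W (1 - x))"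
  unfolding integrating_factor_def
proof (intro ballI conjI)
  fix x :: real assume "x \<in> {0<..<1}"
  then have x: "1 - x \<in> {0<..<1}" by auto
  then have *: "0 < W (1 - x)" "(W has_real_derivative b (1 - x) / (a (1 - x) * (1 - x) * (1 - (1 - x))) * W (1 - x)) (at (1 - x))"
    using W unfolding integrating_factor_def by blast+
  show "0 < W (1 - x)" by (rule *(1))
  show "((\<lambda>x. W (1 - x)) has_real_derivative - b (1 - x) / (a (1 - x) * x * (1 - x)) * W (1 - x)) (at x)"
    using has_real_derivative_reflect[OF *(2)] by (simp add: mult_ac)
qed

lemma L_vanishes_right:
  assumes f: "right_C2_holder a b m \<gamma> f"
    and df: "\<And>x. x \<in> {0<..<1} \<Longrightarrow> (f has_real_derivative f' x) (at x)"
    and ddf: "\<And>x. x \<in> {0<..<1} \<Longrightarrow> (f' has_real_derivative f'' x) (at x)"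
    and g: "continuous_on {0..1} g"
    and eq: "\<And>x. x \<in> {0<..<1} \<Longrightarrow> g x = diffusion x * f'' x + drift x * f' x"
    and nt: "m 1 = 1 \<Longrightarrow> b 1 = 0"
  shows "g 1 = 0"
proof -
  interpret R: kimura_operator "\<lambda>x. a (1 - x)" "\<lambda>x. - b (1 - x)" "\<lambda>i. m (1 - i)" by (rule reflected)
  have "g (1 - 0) = 0"
  proof (rule R.L_vanishes_left[where f = "\<lambda>x. f (1 - x)" and f' = "\<lambda>x. - f' (1 - x)" and f'' = "\<lambda>x. f'' (1 - x)"])
    show "left_C2_holder (\<lambda>x. a (1 - x)) (\<lambda>x. - b (1 - x)) (\<lambda>i. m (1 - i)) \<gamma> (\<lambda>x. f (1 - x))"
      using f by (simp add: right_C2_holder_def)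
    fix x :: real assume "x \<in> {0<..<1}"
    then have x: "1 - x \<in> {0<..<1}" by auto
    show "((\<lambda>x. f (1 - x)) has_real_derivative - f' (1 - x)) (at x)"
      by (rule has_real_derivative_reflect[OF df[OF x]])
    show "((\<lambda>x. - f' (1 - x)) has_real_derivative f'' (1 - x)) (at x)"
      using DERIV_minus[OF has_real_derivative_reflect[OF ddf[OF x]]] by simp
    show "g (1 - x) = R.diffusion x * f'' (1 - x) + R.drift x * - f' (1 - x)"
      unfolding reflected_coefficients using eq[OF x] by simp
  qed (use g nt continuous_on_reflect in auto)
  then show ?thesis by simp
qed

lemma flux_vanishes_right:
  assumes f: "right_C2_holder a b m \<gamma> f"
    and df: "\<And>x. x \<in> {0<..<1} \<Longrightarrow> (f has_real_derivative f' x) (at x)"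
    and W: "integrating_factor a b W" and tr: "transverse_end a b m 1"
  shows "((\<lambda>x. W x * f' x) \<longlongrightarrow> 0) (at_left 1)"
proof -
  interpret R: kimura_operator "\<lambda>x. a (1 - x)" "\<lambda>x. - b (1 - x)" "\<lambda>i. m (1 - i)" by (rule reflected)
  have "((\<lambda>x. W (1 - x) * - f' (1 - x)) \<longlongrightarrow> 0) (at_right 0)"
  proof (rule R.flux_vanishes_left[where f = "\<lambda>x. f (1 - x)"])
    show "left_C2_holder (\<lambda>x. a (1 - x)) (\<lambda>x. - b (1 - x)) (\<lambda>i. m (1 - i)) \<gamma> (\<lambda>x. f (1 - x))"
      using f by (simp add: right_C2_holder_def)
    show "((\<lambda>x. f (1 - x)) has_real_derivative - f' (1 - x)) (at x)" if "x \<in> {0<..<1}" for x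
      by (rule has_real_derivative_reflect[OF df]) (use that in auto)
  qed (use reflected_integrating_factor[OF W] tr reflected_transverse in auto)
  from tendsto_minus[OF filterlim_compose[OF this filterlim_reflect_at_left]]
  show ?thesis by simp
qed

lemma speed_density_integrable_right:
  assumes W: "integrating_factor a b W" and tr: "transverse_end a b m 1"
  shows "speed_density W absolutely_integrable_on {1/2..1}"
proof -
  interpret R: kimura_operator "\<lambda>x. a (1 - x)" "\<lambda>x. - b (1 - x)" "\<lambda>i. m (1 - i)" by (rule reflected)
  have "(\<lambda>x. R.speed_density (\<lambda>x. W (1 - x)) x) absolutely_integrable_on {0..1/2}"
    by (rule R.speed_density_integrable_left[OF reflected_integrating_factor[OF W]])
      (simp only: reflected_transverse tr)
  then have "(\<lambda>x. speed_density W (1 - x)) absolutely_integrable_on {0..1/2}"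
    by (simp only: reflected_coefficients)
  then have "(\<lambda>x. speed_density W (1 - x)) integrable_on {0..1/2}"
    by (rule set_lebesgue_integral_eq_integral(1))
  then have cb: "(\<lambda>x. speed_density W (1 - x)) integrable_on cbox 0 (1/2)" by simp
  have "(\<lambda>x. speed_density W (1 - (- 1 *\<^sub>R x + 1))) integrable_on
      (\<lambda>x. (1 / - 1) *\<^sub>R x + - ((1 / - 1) *\<^sub>R 1)) ` cbox 0 (1/2)"
    using integrable_on_affinity[OF _ cb, of "- 1" 1] by simp
  moreover have "(\<lambda>x. (1 / - 1) *\<^sub>R x + - ((1 / - 1) *\<^sub>R 1)) ` cbox 0 (1/2) = {1/2..1::real}"
  proof (intro equalityI subsetI)
    fix x :: real assume "x \<in> {1/2..1}"
    then show "x \<in> (\<lambda>x. (1 / - 1) *\<^sub>R x + - ((1 / - 1) *\<^sub>R 1)) ` cbox 0 (1/2)"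
      by (intro image_eqI[of _ _ "1 - x"]) auto
  qed auto
  ultimately have "speed_density W integrable_on {1/2..1}" by simp
  then have "speed_density W integrable_on {1/2<..<1}"
    by (simp add: integrable_on_Icc_iff_Ioo)
  then have "speed_density W absolutely_integrable_on {1/2<..<1}"
    by (rule nonnegative_absolutely_integrable_1)
      (use speed_density_nonneg[OF W] in \<open>force intro: less_imp_le\<close>)
  then show ?thesis
    by (rule absolutely_integrable_spike_set) (auto intro: negligible_subset[of "{1/2,1}"])
qed

lemma right_C2_holder_const:
  assumes \<gamma>: "0 < \<gamma>" "\<gamma> < 1" and e: "e < 1" and f: "\<And>x. x \<in> {e..1} \<Longrightarrow> f x = C"
  shows "right_C2_holder a b m \<gamma> f"
proof -
  interpret R: kimura_operator "\<lambda>x. a (1 - x)" "\<lambda>x. - b (1 - x)" "\<lambda>i. m (1 - i)" by (rule reflected)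
  show ?thesis
    unfolding right_C2_holder_def
    by (rule R.left_C2_holder_const[OF \<gamma>, of "1 - e" _ C]) (use e f in auto)
qed

lemma integrating_factor_exists: obtains W where "integrating_factor a b W"
proof -
  have "continuous_on {0<..<1} a" "continuous_on {0<..<1} b"
    by (auto intro: continuous_on_subset[OF continuous_a] continuous_on_subset[OF continuous_b])
  moreover have "a x * x * (1 - x) \<noteq> 0" if "x \<in> {0<..<1}" for x
    using a_pos[of x] that by auto
  ultimately have "continuous_on {0<..<1} (\<lambda>x. b x / (a x * x * (1 - x)))"
    by (intro continuous_intros) auto
  then obtain H where H: "\<And>x. x \<in> {0<..<1} \<Longrightarrow> (H has_real_derivative b x / (a x * x * (1 - x))) (at x)"
    using antiderivative_exists by blast
  have "integrating_factor a b (\<lambda>x. exp (H x))"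
    unfolding integrating_factor_def
    using DERIV_chain2[OF DERIV_exp H] by (simp add: mult.commute)
  then show ?thesis by (rule that)
qed

end

section \<open>Values at the ends and the stationary measure\<close>

text \<open>The support is compact in the open interval. It is measured by \<open>x (1 - x)\<close> to make the condition
  symmetric under reflection.\<close>

definition compact_Lipschitz :: "(real \<Rightarrow> real) \<Rightarrow> bool" where
  "compact_Lipschitz h \<longleftrightarrow> (\<exists>K. K-lipschitz_on {0..1} h) \<and>
     (\<exists>\<delta>>0. \<forall>x\<in>{0..1}. x * (1 - x) \<le> \<delta> \<longrightarrow> h x = 0)"

lemma compact_Lipschitz_continuous: "compact_Lipschitz h \<Longrightarrow> continuous_on {0..1} h"
  unfolding compact_Lipschitz_def using lipschitz_on_continuous_on by blast

lemma compact_Lipschitz_diff: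
  assumes "compact_Lipschitz h" "compact_Lipschitz k"
  shows "compact_Lipschitz (\<lambda>x. h x - c * k x)"
proof -
  obtain K d where h: "K-lipschitz_on {0..1} h" "0 < d" "\<And>x. x \<in> {0..1} \<Longrightarrow> x * (1 - x) \<le> d \<Longrightarrow> h x = 0"
    using assms(1) unfolding compact_Lipschitz_def by blast
  obtain L e where k: "L-lipschitz_on {0..1} k" "0 < e" "\<And>x. x \<in> {0..1} \<Longrightarrow> x * (1 - x) \<le> e \<Longrightarrow> k x = 0"
    using assms(2) unfolding compact_Lipschitz_def by blast
  have "(K + \<bar>c\<bar> * L)-lipschitz_on {0..1} (\<lambda>x. h x - c * k x)"
    by (rule lipschitz_on_diff[OF h(1) lipschitz_on_cmult_real[OF k(1)]])
  moreover have "h x - c * k x = 0" if "x \<in> {0..1}" "x * (1 - x) \<le> min d e" for x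
    using h(3)[of x] k(3)[of x] that by simp
  ultimately show ?thesis
    unfolding compact_Lipschitz_def using h(2) k(2) by (metis min_less_iff_conj)
qed

lemma compact_Lipschitz_support:
  assumes "compact_Lipschitz h"
  obtains p q where "0 < p" "p < q" "q < 1" "\<And>x. x \<in> {0..p} \<Longrightarrow> h x = 0" "\<And>x. x \<in> {q..1} \<Longrightarrow> h x = 0"
proof -
  obtain d where d: "0 < d" "\<And>x. x \<in> {0..1} \<Longrightarrow> x * (1 - x) \<le> d \<Longrightarrow> h x = 0"
    using assms unfolding compact_Lipschitz_def by blast
  define p where "p = min d (1/4)"
  have p: "0 < p" "p \<le> d" "p \<le> 1/4" using d(1) by (auto simp: p_def)
  show ?thesis
  proof (rule that[of p "1 - p"])
    fix x assume x: "x \<in> {0..p}"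
    then have "x * (1 - x) \<le> x * 1" using p by (intro mult_left_mono) auto
    then show "h x = 0" using x p by (intro d(2)) auto
  next
    fix x assume x: "x \<in> {1 - p..1}"
    then have "x * (1 - x) \<le> 1 * (1 - x)" using p by (intro mult_right_mono) auto
    then show "h x = 0" using x p by (intro d(2)) auto
  qed (use p in auto)
qed

text \<open>Soft thresholding moves a Lipschitz function that vanishes at both ends by at most \<open>\<epsilon>\<close>
  and makes it vanish near the ends.\<close>

lemma compact_Lipschitz_approximation:
  assumes h: "K-lipschitz_on {0..1} h" "h 0 = 0" "h 1 = 0" and \<epsilon>: "0 < \<epsilon>"
  obtains k where "compact_Lipschitz k" "\<And>x. \<bar>h x - k x\<bar> \<le> \<epsilon>"
proof (rule that)
  define k where "k = (\<lambda>x. max (h x - \<epsilon>) 0 + min (h x + \<epsilon>) 0)"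
  show "\<bar>h x - k x\<bar> \<le> \<epsilon>" for x using \<epsilon> by (auto simp: k_def max_def min_def)
  have K: "0 \<le> K" by (rule lipschitz_on_nonneg[OF h(1)])
  have hL: "\<bar>h x - h y\<bar> \<le> K * \<bar>x - y\<bar>" if "x \<in> {0..1}" "y \<in> {0..1}" for x y
    using lipschitz_onD[OF h(1) that] by (simp add: dist_real_def)
  have "K-lipschitz_on {0..1} k"
  proof (rule lipschitz_onI[OF _ K])
    fix x y :: real assume xy: "x \<in> {0..1}" "y \<in> {0..1}"
    have "\<bar>k x - k y\<bar> \<le> \<bar>h x - h y\<bar>" using \<epsilon> by (auto simp: k_def max_def min_def)
    then show "dist (k x) (k y) \<le> K * dist x y" using hL[OF xy] by (simp add: dist_real_def)
  qed
  moreover have "k x = 0" if x: "x \<in> {0..1}" "x * (1 - x) \<le> \<epsilon> / (2 * (K + 1))" for x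
  proof -
    have "\<bar>h x\<bar> \<le> K * (2 * (x * (1 - x)))"
    proof (cases "x \<le> 1/2")
      case True
      have "\<bar>h x\<bar> \<le> K * x" using hL[of x 0] h(2) x by simp
      also have "\<dots> \<le> K * (2 * (x * (1 - x)))"
        using True x K mult_left_mono[of "1/2" "1 - x" x] by (intro mult_left_mono) auto
      finally show ?thesis .
    next
      case False
      have "\<bar>h x\<bar> \<le> K * (1 - x)" using hL[of x 1] h(3) x by simp
      also have "\<dots> \<le> K * (2 * (x * (1 - x)))"
        using False x K mult_right_mono[of "1/2" x "1 - x"] by (intro mult_left_mono) auto
      finally show ?thesis .
    qed
    also have "\<dots> \<le> K * (2 * (\<epsilon> / (2 * (K + 1))))"
      using x(2) K by (intro mult_left_mono) auto
    also have "\<dots> \<le> \<epsilon>" using K \<epsilon> by (simp add: field_simps)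
    finally show ?thesis using \<epsilon> by (auto simp: k_def max_def min_def)
  qed
  moreover have "0 < \<epsilon> / (2 * (K + 1))" using \<epsilon> K by simp
  ultimately show "compact_Lipschitz k" unfolding compact_Lipschitz_def by blast
qed

text \<open>A cutoff that is \<open>1\<close> where \<open>x (1 - x) \<ge> 2 \<delta>\<close> and vanishes where \<open>x (1 - x) \<le> \<delta>\<close>.\<close>

definition plateau :: "real \<Rightarrow> real \<Rightarrow> real" where
  "plateau \<delta> x = max 0 (min 1 (x * (1 - x) / \<delta> - 1))"

lemma plateau_bounds: "0 \<le> plateau \<delta> x" "plateau \<delta> x \<le> 1"
  by (auto simp: plateau_def)

lemma plateau_eq_1: "0 < \<delta> \<Longrightarrow> 2 * \<delta> \<le> x * (1 - x) \<Longrightarrow> plateau \<delta> x = 1"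
  by (simp add: plateau_def field_simps)

lemma compact_Lipschitz_plateau:
  assumes \<delta>: "0 < \<delta>"
  shows "compact_Lipschitz (plateau \<delta>)"
proof -
  have "(1 / \<delta>)-lipschitz_on {0..1} (plateau \<delta>)"
  proof (rule lipschitz_onI)
    fix x y :: real assume xy: "x \<in> {0..1}" "y \<in> {0..1}"
    have "\<bar>plateau \<delta> x - plateau \<delta> y\<bar> \<le> \<bar>x * (1 - x) / \<delta> - y * (1 - y) / \<delta>\<bar>"
      by (auto simp: plateau_def max_def min_def)
    also have "\<dots> = \<bar>1 - x - y\<bar> * \<bar>x - y\<bar> / \<delta>"
      using \<delta> by (simp add: abs_mult[symmetric] diff_divide_distrib[symmetric] algebra_simps)
    also have "\<dots> \<le> 1 * \<bar>x - y\<bar> / \<delta>"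
      using xy \<delta> by (intro divide_right_mono mult_right_mono) auto
    finally show "dist (plateau \<delta> x) (plateau \<delta> y) \<le> 1 / \<delta> * dist x y" by (simp add: dist_real_def)
  qed (use \<delta> in simp)
  moreover have "plateau \<delta> x = 0" if "x * (1 - x) \<le> \<delta>" for x
  proof -
    have "x * (1 - x) / \<delta> \<le> 1" using that \<delta> by (simp only: divide_le_eq_1_pos)
    then show ?thesis by (simp add: plateau_def)
  qed
  ultimately show ?thesis unfolding compact_Lipschitz_def using \<delta> by blast
qed

lemma finite_sup_norm_continuous:
  assumes "continuous_on {p..q} f"
  shows "finite_sup_norm {p..q} f"
proof -
  have "bounded (f ` {p..q})" using assms by (intro compact_imp_bounded compact_continuous_image) auto
  then show ?thesis unfolding finite_sup_norm_def bounded_iff by (metis imageI real_norm_def)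
qed

lemma finite_holder_norm_lipschitz_on:
  assumes \<gamma>: "0 < \<gamma>" "\<gamma> < 1" and h: "K-lipschitz_on {0..1} h" and pq: "{p..q} \<subseteq> {0..1}"
  shows "finite_holder_norm \<gamma> {p..q} h"
proof -
  have "continuous_on {p..q} h"
    using lipschitz_on_continuous_on[OF h] pq by (rule continuous_on_subset)
  then obtain M where M: "\<And>x. x \<in> {p..q} \<Longrightarrow> \<bar>h x\<bar> \<le> M"
    using finite_sup_norm_continuous unfolding finite_sup_norm_def by blast
  show ?thesis
    by (rule finite_holder_norm_Lipschitz[OF \<gamma> M, where K = K])
      (use lipschitz_onD[OF h] pq in \<open>auto simp: dist_real_def\<close>)
qed

lemma interior_C2_holder_deriv:
  assumes f: "interior_C2_holder \<gamma> f" and x: "x \<in> {0<..<1}"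
  shows "(f has_real_derivative deriv f x) (at x)"
    "(deriv f has_real_derivative deriv (deriv f) x) (at x)"
proof -
  have pq: "0 < x / 2 \<and> x / 2 < (1 + x) / 2 \<and> (1 + x) / 2 < 1" using x by auto
  then obtain f' f'' where "C2_on {x / 2..(1 + x) / 2} f f' f''"
    using f unfolding interior_C2_holder_def by blast
  then have C2: "C2_on {x / 2<..<(1 + x) / 2} f f' f''" by (rule C2_on_subset) auto
  have x': "x \<in> {x / 2<..<(1 + x) / 2}" using x by auto
  have o: "open {x / 2<..<(1 + x) / 2}" by simp
  note d = C2_on_open_deriv[OF o C2]
  show "(f has_real_derivative deriv f x) (at x)" using d(1,3)[OF x'] by simp
  have "(deriv f has_real_derivative f'' x) (at x)"
    by (rule has_field_derivative_transform_within_open[OF d(4)[OF x'] o x']) (simp add: d(1))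
  then show "(deriv f has_real_derivative deriv (deriv f) x) (at x)" using d(2)[OF x'] by simp
qed

context kimura_operator
begin

lemma graph_L_I:
  assumes f: "continuous_on {0..1} f" "left_C2_holder a b m \<gamma> f" "right_C2_holder a b m \<gamma> f"
    and C2: "C2_on {0<..<1} f f' f''"
    and hol: "\<And>p q. 0 < p \<Longrightarrow> p < q \<Longrightarrow> q < 1 \<Longrightarrow> finite_holder_norm \<gamma> {p..q} f''"
    and g: "continuous_on {0..1} g" "\<And>x. x \<in> {0<..<1} \<Longrightarrow> g x = diffusion x * f'' x + drift x * f' x"
  shows "(of_line f, of_line g) \<in> graph_L a b m \<gamma>"
proof -
  have eq: "on_line (of_line f) x = f x" if "x \<in> {0..1}" for x using on_line_of_line[OF f(1) that] .
  have C2': "C2_on {0<..<1} (on_line (of_line f)) f' f''"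
    by (rule C2_on_cong[OF C2]) (use eq in auto)
  have "interior_C2_holder \<gamma> (on_line (of_line f))"
    unfolding interior_C2_holder_def
  proof (intro allI impI exI conjI)
    fix p q :: real assume pq: "0 < p \<and> p < q \<and> q < 1"
    show c: "C2_on {p..q} (on_line (of_line f)) f' f''"
      by (rule C2_on_subset[OF C2']) (use pq in auto)
    show "finite_holder_norm \<gamma> {p..q} f''" using hol pq by blast
    have "continuous_on {p..q} (on_line (of_line f))" "continuous_on {p..q} f'"
      using c unfolding C2_on_def by (blast intro: DERIV_continuous_on)+
    then show "finite_sup_norm {p..q} (on_line (of_line f))" "finite_sup_norm {p..q} f'"
      by (auto intro: finite_sup_norm_continuous)
  qed
  moreover have "left_C2_holder a b m \<gamma> (on_line (of_line f))"
    by (rule left_C2_holder_cong[OF f(2)]) (rule eq)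
  moreover have "right_C2_holder a b m \<gamma> (on_line (of_line f))"
    using f(3) unfolding right_C2_holder_def by (rule left_C2_holder_cong) (rule eq, auto)
  moreover have "on_line (of_line g) x = kimura_L a b m (on_line (of_line f)) x" if x: "x \<in> {0<..<1}" for x
  proof -
    have "on_line (of_line g) x = g x" using on_line_of_line[OF g(1), of x] x by auto
    also have "\<dots> = kimura_L a b m (on_line (of_line f)) x"
      unfolding kimura_L_eq using C2_on_open_deriv(1,2)[OF open_greaterThanLessThan C2' x] g(2)[OF x] by simp
    finally show ?thesis .
  qed
  ultimately show ?thesis by (simp add: graph_L_def C2_holder_def)
qed

lemma graph_L_D:
  assumes "(f, g) \<in> graph_L a b m \<gamma>" and x: "x \<in> {0<..<1}"
  shows "(on_line f has_real_derivative deriv (on_line f) x) (at x)"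
    "(deriv (on_line f) has_real_derivative deriv (deriv (on_line f)) x) (at x)"
    "on_line g x = diffusion x * deriv (deriv (on_line f)) x + drift x * deriv (on_line f) x"
  using assms interior_C2_holder_deriv[of \<gamma> "on_line f" x]
  by (auto simp: graph_L_def C2_holder_def kimura_L_eq)

lemma graph_L_vanishes:
  assumes fg: "(f, g) \<in> graph_L a b m \<gamma>"
  shows "\<not> (m 0 = 1 \<and> transverse_end a b m 0) \<Longrightarrow> on_line g 0 = 0"
    "\<not> (m 1 = 1 \<and> transverse_end a b m 1) \<Longrightarrow> on_line g 1 = 0"
proof -
  have h: "left_C2_holder a b m \<gamma> (on_line f)" "right_C2_holder a b m \<gamma> (on_line f)"
    using fg by (auto simp: graph_L_def C2_holder_def)
  show "on_line g 0 = 0" if "\<not> (m 0 = 1 \<and> transverse_end a b m 0)"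
    by (rule L_vanishes_left[OF h(1) graph_L_D(1,2)[OF fg] continuous_on_line graph_L_D(3)[OF fg]])
      (use that kimura_not_transverse_left in auto)
  have b1: "b 1 = 0" if "m 1 = 1" "\<not> transverse_end a b m 1"
    using that mixed by (auto simp: mixed_kimura_operator_def transverse_end_def kimura_end_def)
  show "on_line g 1 = 0" if "\<not> (m 1 = 1 \<and> transverse_end a b m 1)"
    by (rule L_vanishes_right[OF h(2) graph_L_D(1,2)[OF fg] continuous_on_line graph_L_D(3)[OF fg]])
      (use that b1 in auto)
qed

lemma drift_eq: "x \<in> {0<..<1} \<Longrightarrow> b x / (a x * x * (1 - x)) * diffusion x = drift x"
  using a_pos[of x] m_cases
  by (auto simp: diffusion_def drift_def power2_eq_square)

text \<open>In divergence form, \<open>(W f')' = \<rho> L f\<close>.\<close>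

lemma flux_derivative:
  assumes W: "integrating_factor a b W" and x: "x \<in> {0<..<1}"
    and d: "(u has_real_derivative u' x) (at x)" and g: "g = diffusion x * u' x + drift x * u x"
  shows "((\<lambda>x. W x * u x) has_real_derivative g * speed_density W x) (at x)"
proof -
  define r where "r = b x / (a x * x * (1 - x))"
  have "(W has_real_derivative r * W x) (at x)"
    using W x unfolding integrating_factor_def r_def by blast
  from DERIV_mult[OF this d] show ?thesis
  proof (rule DERIV_cong)
    have p: "0 < diffusion x" by (rule diffusion_pos[OF x])
    have "drift x = r * diffusion x"
      unfolding r_def by (rule drift_eq[OF x, symmetric])
    then have "g = diffusion x * (u' x + r * u x)"
      by (simp add: g algebra_simps)
    then show "r * W x * u x + u' x * W x = g * speed_density W x"
      using p by (simp add: speed_density_def algebra_simps)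
  qed
qed

lemma speed_density_integrable:
  assumes W: "integrating_factor a b W" and "transverse_end a b m 0" "transverse_end a b m 1"
  shows "speed_density W absolutely_integrable_on {0..1}"
proof -
  have "{0..1/2} \<union> {1/2..1} = {0..1::real}" by auto
  then show ?thesis
    using absolutely_integrable_Un[OF speed_density_integrable_left[OF W assms(2)]
        speed_density_integrable_right[OF W assms(3)]] by simp
qed

text \<open>The flux \<open>W f'\<close> vanishes at transverse ends, so \<open>\<rho> dx\<close> is a stationary measure.\<close>

lemma stationary_measure:
  assumes fg: "(f, g) \<in> graph_L a b m \<gamma>" and W: "integrating_factor a b W"
    and tr: "transverse_end a b m 0" "transverse_end a b m 1"
  shows "integral {0..1} (\<lambda>x. on_line g x * speed_density W x) = 0"
proof -
  have h: "left_C2_holder a b m \<gamma> (on_line f)" "right_C2_holder a b m \<gamma> (on_line f)"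
    using fg by (auto simp: graph_L_def C2_holder_def)
  define F where "F = (\<lambda>x. if x \<in> {0<..<1} then W x * deriv (on_line f) x else 0)"
  have dF: "(F has_real_derivative on_line g x * speed_density W x) (at x)" if x: "x \<in> {0<..<1}" for x
  proof -
    have "((\<lambda>x. W x * deriv (on_line f) x) has_real_derivative on_line g x * speed_density W x) (at x)"
      by (rule flux_derivative[where u' = "deriv (deriv (on_line f))"])
        (use W x graph_L_D(2,3)[OF fg x] in auto)
    then show ?thesis
      by (rule has_field_derivative_transform_within_open[of _ _ _ "{0<..<1}"]) (use x in \<open>auto simp: F_def\<close>)
  qed
  have "(F \<longlongrightarrow> 0) (at_right 0)"
    by (rule Lim_transform_eventually[OF flux_vanishes_left[OF h(1) graph_L_D(1)[OF fg] W tr(1)]])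
      (auto simp: F_def eventually_at_right_field intro: exI[of _ 1])
  moreover have "(F \<longlongrightarrow> 0) (at_left 1)"
    by (rule Lim_transform_eventually[OF flux_vanishes_right[OF h(2) graph_L_D(1)[OF fg] W tr(2)]])
      (auto simp: F_def eventually_at_left_field intro: exI[of _ 0])
  moreover have "F 0 = 0" "F 1 = 0" by (auto simp: F_def)
  ultimately have "continuous_on {0..1} F"
    using DERIV_isCont[OF dF] by (intro continuous_on_IccI) (auto simp: isCont_def)
  then have "((\<lambda>x. on_line g x * speed_density W x) has_integral F 1 - F 0) {0..1}"
    using dF by (intro fundamental_theorem_of_calculus_interior)
      (auto simp: has_real_derivative_iff_has_vector_derivative[symmetric])
  then show ?thesis by (simp add: F_def integral_unique)
qed

text \<open>The antiderivative \<open>G\<close> will be the flux \<open>W f'\<close> of a solution of \<open>L f = h\<close>. Its value near \<open>1\<close> is the only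
  obstruction to \<open>f\<close> being constant near both ends.\<close>

lemma compact_antiderivative:
  assumes W: "integrating_factor a b W" and h: "compact_Lipschitz h"
  obtains G p q where "0 < p" "p < q" "q < 1" "\<And>x. x \<in> {0..p} \<Longrightarrow> h x = 0" "\<And>x. x \<in> {q..1} \<Longrightarrow> h x = 0"
    "\<And>x. x \<in> {0<..<1} \<Longrightarrow> (G has_real_derivative h x * speed_density W x) (at x)"
    "\<And>x. x \<in> {0<..p} \<Longrightarrow> G x = 0"
    "\<And>x. x \<in> {q..<1} \<Longrightarrow> G x = integral {0..1} (\<lambda>x. h x * speed_density W x)"
    "(\<lambda>x. h x * speed_density W x) integrable_on {0..1}"
proof -
  obtain p q where pq: "0 < p" "p < q" "q < 1" and hp: "\<And>x. x \<in> {0..p} \<Longrightarrow> h x = 0"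
    and hq: "\<And>x. x \<in> {q..1} \<Longrightarrow> h x = 0"
    by (rule compact_Lipschitz_support[OF h]) blast
  have "continuous_on {0<..<1} h"
    by (rule continuous_on_subset[OF compact_Lipschitz_continuous[OF h]]) auto
  then have "continuous_on {0<..<1} (\<lambda>x. h x * speed_density W x)"
    by (intro continuous_intros speed_density_continuous(1)[OF W])
  then obtain H where H: "\<And>x. x \<in> {0<..<1} \<Longrightarrow> (H has_real_derivative h x * speed_density W x) (at x)"
    using antiderivative_exists by blast
  have const: "H s = H t" if st: "0 < s" "s < t" "t < 1" "\<And>x. x \<in> {s<..<t} \<Longrightarrow> h x = 0" for s t
  proof -
    obtain z where "s < z" "z < t" "H t - H s = (t - s) * (h z * speed_density W z)"
      using MVT2[OF st(2), of H "\<lambda>x. h x * speed_density W x"] H st(1,3) by auto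
    then show ?thesis using st(4)[of z] by simp
  qed
  define I where "I = H q - H p"
  have "((\<lambda>x. h x * speed_density W x) has_integral I) {p..q}"
    unfolding I_def using pq H
    by (intro fundamental_theorem_of_calculus)
      (auto simp: has_real_derivative_iff_has_vector_derivative[symmetric] intro: has_field_derivative_at_within)
  moreover have "((\<lambda>x. h x * speed_density W x) has_integral 0) {0..p}"
    "((\<lambda>x. h x * speed_density W x) has_integral 0) {q..1}"
    using hp hq by (auto intro!: has_integral_is_0)
  ultimately have "((\<lambda>x. h x * speed_density W x) has_integral 0 + I + 0) {0..1}"
    using pq by (intro has_integral_combine[of 0 q 1] has_integral_combine[of 0 p q]) auto
  then have I: "((\<lambda>x. h x * speed_density W x) has_integral I) {0..1}" by simp
  show ?thesis
  proof (rule that[of p q "\<lambda>x. H x - H p"])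
    show "((\<lambda>x. H x - H p) has_real_derivative h x * speed_density W x) (at x)" if "x \<in> {0<..<1}" for x
      using DERIV_diff[OF H[OF that] DERIV_const] by simp
    show "H x - H p = 0" if "x \<in> {0<..p}" for x
      using const[of x p] hp that pq by (cases "x = p") auto
    show "H x - H p = integral {0..1} (\<lambda>x. h x * speed_density W x)" if "x \<in> {q..<1}" for x
      using const[of q x] hq that pq integral_unique[OF I] by (cases "x = q") (auto simp: I_def)
    show "(\<lambda>x. h x * speed_density W x) integrable_on {0..1}" using I by blast
  qed (use pq hp hq in auto)
qed

end

section \<open>The range of the operator\<close>

lemma integral_reflect_unit:
  fixes F :: "real \<Rightarrow> real"
  assumes "F integrable_on {0..1}"
  shows "integral {0..1} (\<lambda>x. F (1 - x)) = integral {0..1} F"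
proof -
  have "(F has_integral integral {0..1} F) (cbox 0 1)" using assms by (simp add: has_integral_integral)
  from has_integral_affinity[OF this, of "- 1" 1]
  have "((\<lambda>x. F (1 - x)) has_integral integral {0..1} F) ((\<lambda>x. 1 - x) ` {0..1})" by simp
  moreover have "(\<lambda>x. 1 - x) ` {0..1} = {0..1::real}" by simp
  ultimately show ?thesis by (simp add: integral_unique)
qed

lemma compact_Lipschitz_reflect:
  assumes "compact_Lipschitz h"
  shows "compact_Lipschitz (\<lambda>x. h (1 - x))"
proof -
  obtain K d where h: "K-lipschitz_on {0..1} h" "0 < d" "\<And>x. x \<in> {0..1} \<Longrightarrow> x * (1 - x) \<le> d \<Longrightarrow> h x = 0"
    using assms unfolding compact_Lipschitz_def by blast
  have "K-lipschitz_on {0..1} (\<lambda>x. h (1 - x))"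
  proof (rule lipschitz_onI[OF _ lipschitz_on_nonneg[OF h(1)]])
    fix x y :: real assume "x \<in> {0..1}" "y \<in> {0..1}"
    then show "dist (h (1 - x)) (h (1 - y)) \<le> K * dist x y"
      using lipschitz_onD[OF h(1), of "1 - x" "1 - y"] by (simp add: dist_real_def abs_minus_commute)
  qed
  moreover have "h (1 - x) = 0" if "x \<in> {0..1}" "x * (1 - x) \<le> d" for x
    using h(3)[of "1 - x"] that by (simp add: mult.commute)
  ultimately show ?thesis unfolding compact_Lipschitz_def using h(2) by blast
qed

lemma C0_eqI:
  assumes "\<And>x. x \<in> {0..1} \<Longrightarrow> on_line f x = on_line g x"
  shows "f = g"
proof -
  have "norm (f - g) \<le> 0" by (rule norm_le_of_on_line) (simp add: assms)
  then show ?thesis by simp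
qed

context kimura_operator
begin

lemma drift_C2: obtains B' B'' where "C2_on {0..1} drift B' B''"
proof -
  obtain b' b'' where "C2_on {0..1} b b' b''" by (rule C2_b)
  note C2 = C2_on_mult[OF C2_on_mult[OF this C2_on_power[of _ "m 0 - 1"]] C2_on_reflected_power[of _ "m 1 - 1"]]
  have eq: "drift = (\<lambda>x. b x * x ^ (m 0 - 1) * (1 - x) ^ (m 1 - 1))"
    by (rule ext) (rule drift_def)
  show ?thesis by (rule that[OF C2[folded eq]])
qed

text \<open>If \<open>\<integral> h \<rho> = 0\<close>, then \<open>f' = W\<^sup>-\<^sup>1 \<integral> h \<rho>\<close> vanishes near both ends, so that \<open>f\<close> is constant there and
  the boundary conditions hold at any type of end.\<close>

lemma compact_Lipschitz_in_range:
  assumes \<gamma>: "0 < \<gamma>" "\<gamma> < 1" and W: "integrating_factor a b W" and h: "compact_Lipschitz h"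
    and int: "integral {0..1} (\<lambda>x. h x * speed_density W x) = 0"
  obtains f where "(f, of_line h) \<in> graph_L a b m \<gamma>"
proof -
  obtain G p q where pq: "0 < p" "p < q" "q < 1"
    and dG: "\<And>x. x \<in> {0<..<1} \<Longrightarrow> (G has_real_derivative h x * speed_density W x) (at x)"
    and Gp: "\<And>x. x \<in> {0<..p} \<Longrightarrow> G x = 0" and Gq: "\<And>x. x \<in> {q..<1} \<Longrightarrow> G x = 0"
    by (rule compact_antiderivative[OF W h]) (rule that, assumption+, simp only: int)
  define r where "r = (\<lambda>x. b x / (a x * x * (1 - x)))"
  have Wpos: "0 < W x" and dW: "(W has_real_derivative r x * W x) (at x)" if "x \<in> {0<..<1}" for x
    using W that unfolding integrating_factor_def r_def by blast+
  define u where "u = (\<lambda>x. G x / W x)"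
  define u' where "u' = (\<lambda>x. (h x + - 1 * (drift x * u x)) * (1 / diffusion x))"
  have du: "(u has_real_derivative u' x) (at x)" if x: "x \<in> {0<..<1}" for x
  proof -
    have p: "0 < diffusion x" by (rule diffusion_pos[OF x])
    have dr: "drift x = r x * diffusion x" unfolding r_def by (rule drift_eq[OF x, symmetric])
    have "(u has_real_derivative (h x * speed_density W x * W x - G x * (r x * W x)) / (W x * W x)) (at x)"
      unfolding u_def by (rule DERIV_divide[OF dG[OF x] dW[OF x]]) (use Wpos[OF x] in simp)
    then show ?thesis
      by (rule DERIV_cong)
        (use p Wpos[OF x] in \<open>simp add: u'_def u_def dr speed_density_def field_simps\<close>)
  qed
  have cu: "continuous_on {0<..<1} u" using du by (meson DERIV_isCont continuous_at_imp_continuous_on)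
  obtain U where dU: "\<And>x. x \<in> {0<..<1} \<Longrightarrow> (U has_real_derivative u x) (at x)"
    using antiderivative_exists[OF cu] by blast
  have const: "U s = U t" if st: "0 < s" "s < t" "t < 1" "\<And>x. x \<in> {s<..<t} \<Longrightarrow> G x = 0" for s t
  proof -
    obtain z where "s < z" "z < t" "U t - U s = (t - s) * u z"
      using MVT2[OF st(2), of U u] dU st(1,3) by auto
    then show ?thesis using st(4)[of z] by (simp add: u_def)
  qed
  \<comment> \<open>Clamping extends \<open>U\<close> to the closed interval: \<open>U\<close> is constant on \<open>(0, p]\<close> and on \<open>[q, 1)\<close>.\<close>
  define f where "f = (\<lambda>x. U (max p (min q x)))"
  have feq: "f x = U x" if "x \<in> {0<..<1}" for x
  proof -
    consider "x < p" | "q < x" | "p \<le> x" "x \<le> q" by linarith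
    then show ?thesis
    proof cases
      case 1
      have "U x = U p" by (rule const) (use 1 Gp that pq in auto)
      then show ?thesis using 1 pq by (simp add: f_def)
    next
      case 2
      have "U q = U x" by (rule const) (use 2 Gq that pq in auto)
      then show ?thesis using 2 pq by (simp add: f_def)
    qed (simp add: f_def)
  qed
  have df: "(f has_real_derivative u x) (at x)" if x: "x \<in> {0<..<1}" for x
    by (rule has_field_derivative_transform_within_open[OF dU[OF x], of "{0<..<1}"]) (use x feq in auto)
  have ch: "continuous_on {0..1} h" by (rule compact_Lipschitz_continuous[OF h])
  have cA: "continuous_on {0<..<1} diffusion"
    by (rule continuous_on_subset[OF continuous_diffusion]) auto
  obtain B' B'' where B: "C2_on {0..1} drift B' B''" by (rule drift_C2)
  obtain A' A'' where A: "C2_on {0..1} diffusion A' A''" by (rule diffusion_C2) (rule that)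
  have cB: "continuous_on {0..1} drift" "continuous_on {0..1} B'" "continuous_on {0..1} A'"
    using A B unfolding C2_on_def by (blast intro: DERIV_continuous_on)+
  have "diffusion x \<noteq> 0" if "x \<in> {0<..<1}" for x using diffusion_pos[OF that] by simp
  moreover have "continuous_on {0<..<1} h" "continuous_on {0<..<1} drift"
    by (rule continuous_on_subset[OF ch], force) (rule continuous_on_subset[OF cB(1)], force)
  ultimately have cu': "continuous_on {0<..<1} u'"
    unfolding u'_def using cA cu by (intro continuous_intros) auto
  have "C2_on {0<..<1} f u u'"
    using df du cu' by (auto simp: C2_on_def intro: has_field_derivative_at_within)
  moreover have "finite_holder_norm \<gamma> {s..t} u'" if st: "0 < s" "s < t" "t < 1" for s t
  proof -
    have sub: "{s..t} \<subseteq> {0..1}" "{s..t} \<subseteq> {0<..<1}" using st by auto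
    have hh: "finite_holder_norm \<gamma> {s..t} h"
      using h finite_holder_norm_lipschitz_on[OF \<gamma> _ sub(1)] unfolding compact_Lipschitz_def by blast
    have hu: "finite_holder_norm \<gamma> {s..t} u"
      by (rule finite_holder_norm_C1[OF \<gamma> _ continuous_on_subset[OF cu' sub(2)]])
        (rule has_field_derivative_at_within[OF du], use st in auto)
    have hB: "finite_holder_norm \<gamma> {s..t} drift"
      using C2_on_subset[OF B sub(1)] continuous_on_subset[OF cB(2) sub(1)]
      by (intro finite_holder_norm_C1[OF \<gamma>, of _ _ _ B']) (auto simp: C2_on_def)
    have nz: "diffusion x \<noteq> 0" if "x \<in> {s..t}" for x
    proof -
      have "x \<in> {0<..<1}" using that st by auto
      from diffusion_pos[OF this] show ?thesis by simp
    qed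
    have hA: "finite_holder_norm \<gamma> {s..t} (\<lambda>x. 1 / diffusion x)"
    proof (rule finite_holder_norm_C1[OF \<gamma>])
      fix x assume x: "x \<in> {s..t}"
      have "(diffusion has_real_derivative A' x) (at x within {s..t})"
        using C2_on_subset[OF A sub(1)] x unfolding C2_on_def by blast
      from DERIV_divide[OF DERIV_const this nz[OF x]]
      show "((\<lambda>x. 1 / diffusion x) has_real_derivative - A' x / (diffusion x * diffusion x)) (at x within {s..t})"
        by (rule DERIV_cong) simp
    next
      have "diffusion x * diffusion x \<noteq> 0" if "x \<in> {s..t}" for x
        using nz[OF that] by simp
      then show "continuous_on {s..t} (\<lambda>x. - A' x / (diffusion x * diffusion x))"
        by (intro continuous_intros continuous_on_subset[OF cB(3) sub(1)]
            continuous_on_subset[OF continuous_diffusion sub(1)]) blast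
    qed
    have hc: "finite_holder_norm \<gamma> {s..t} (\<lambda>x. - 1)"
      by (rule finite_holder_norm_C1[OF \<gamma>, of _ _ _ "\<lambda>x. 0"]) simp_all
    show ?thesis
      unfolding u'_def
      by (rule finite_holder_norm_mult[OF finite_holder_norm_add[OF hh finite_holder_norm_mult[OF hc
              finite_holder_norm_mult[OF hB hu]]] hA])
  qed
  moreover have "continuous_on {p..q} U"
    using dU pq by (intro DERIV_continuous_on[of _ _ u]) (auto intro: has_field_derivative_at_within)
  then have "continuous_on {0..1} f"
    unfolding f_def by (rule continuous_on_compose2) (use pq in \<open>auto intro!: continuous_intros\<close>)
  moreover have "left_C2_holder a b m \<gamma> f"
    by (rule left_C2_holder_const[OF \<gamma> pq(1), of _ "U p"]) (use pq in \<open>auto simp: f_def\<close>)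
  moreover have "right_C2_holder a b m \<gamma> f"
    by (rule right_C2_holder_const[OF \<gamma> pq(3), of _ "U q"]) (use pq in \<open>auto simp: f_def\<close>)
  moreover have "h x = diffusion x * u' x + drift x * u x" if "x \<in> {0<..<1}" for x
    using diffusion_pos[OF that] by (simp add: u'_def)
  ultimately have "(of_line f, of_line h) \<in> graph_L a b m \<gamma>"
    using ch by (intro graph_L_I) auto
  then show ?thesis by (rule that)
qed

lemma kimura_transverse_in_range_left:
  assumes \<gamma>: "0 < \<gamma>" "\<gamma> < 1" and m: "m 0 = 1" and tr: "transverse_end a b m 0"
  obtains f g where "(f, g) \<in> graph_L a b m \<gamma>" "on_line g 0 \<noteq> 0" "on_line g 1 = 0"
proof -
  have b: "0 < b 0" using m tr by (simp add: transverse_end_def kimura_end_def)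
  show ?thesis
  proof (rule kimura_transverse_test_function[OF \<gamma> m b])
    fix f f' f'' f''' g assume f: "continuous_on {0..1} f" "left_C2_holder a b m \<gamma> f"
      and df: "\<And>x. x \<in> {0<..<1} \<Longrightarrow> (f has_real_derivative f' x) (at x)" and C2: "C2_on {0<..<1} f' f'' f'''"
      and z: "\<And>x. x \<in> {1/4..1} \<Longrightarrow> f x = 0"
      and g: "continuous_on {0..1} g" "g 0 \<noteq> 0" "g 1 = 0"
      and L: "\<And>x. x \<in> {0<..<1} \<Longrightarrow> g x = diffusion x * f'' x + drift x * f' x"
    have C2f: "C2_on {0<..<1} f f' f''"
      using df C2 unfolding C2_on_def by (auto intro: has_field_derivative_at_within DERIV_continuous_on)
    have "(of_line f, of_line g) \<in> graph_L a b m \<gamma>"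
    proof (rule graph_L_I[OF f _ C2f _ g(1) L])
      show "right_C2_holder a b m \<gamma> f"
        by (rule right_C2_holder_const[OF \<gamma>, of "1/4" _ 0]) (use z in auto)
      show "finite_holder_norm \<gamma> {p..q} f''" if "0 < p" "p < q" "q < 1" for p q
      proof -
        have "C2_on {p..q} f' f'' f'''" by (rule C2_on_subset[OF C2]) (use that in auto)
        then show ?thesis by (intro finite_holder_norm_C1[OF \<gamma>, of _ _ _ f''']) (auto simp: C2_on_def)
      qed
    qed
    then show ?thesis using g by (intro that[of "of_line f" "of_line g"]) auto
  qed
qed

lemma kimura_transverse_in_range_right:
  assumes \<gamma>: "0 < \<gamma>" "\<gamma> < 1" and m: "m 1 = 1" and tr: "transverse_end a b m 1"
  obtains f g where "(f, g) \<in> graph_L a b m \<gamma>" "on_line g 1 \<noteq> 0" "on_line g 0 = 0"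
proof -
  interpret R: kimura_operator "\<lambda>x. a (1 - x)" "\<lambda>x. - b (1 - x)" "\<lambda>i. m (1 - i)" by (rule reflected)
  have b: "m (1 - 0) = 1" "0 < - b (1 - 0)" using m tr by (auto simp: transverse_end_def kimura_end_def)
  show ?thesis
  proof (rule R.kimura_transverse_test_function[OF \<gamma> b])
    fix f f' f'' f''' g assume f: "continuous_on {0..1} f"
        "left_C2_holder (\<lambda>x. a (1 - x)) (\<lambda>x. - b (1 - x)) (\<lambda>i. m (1 - i)) \<gamma> f"
      and df: "\<And>x. x \<in> {0<..<1} \<Longrightarrow> (f has_real_derivative f' x) (at x)" and C2: "C2_on {0<..<1} f' f'' f'''"
      and z: "\<And>x. x \<in> {1/4..1} \<Longrightarrow> f x = 0"
      and g: "continuous_on {0..1} g" "g 0 \<noteq> 0" "g 1 = 0"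
      and L: "\<And>x. x \<in> {0<..<1} \<Longrightarrow> g x = R.diffusion x * f'' x + R.drift x * f' x"
    have flip: "1 - x \<in> {0<..<1}" if "x \<in> {0<..<1}" for x :: real using that by auto
    note d2 = C2_on_open_deriv(3,4)[OF open_greaterThanLessThan C2]
    have d0: "((\<lambda>x. f (1 - x)) has_real_derivative - f' (1 - x)) (at x)"
      and d1: "((\<lambda>x. - f' (1 - x)) has_real_derivative f'' (1 - x)) (at x)"
      and d2: "((\<lambda>x. f'' (1 - x)) has_real_derivative - f''' (1 - x)) (at x)" if "x \<in> {0<..<1}" for x
      using has_real_derivative_reflect[OF df[OF flip[OF that]]]
        DERIV_minus[OF has_real_derivative_reflect[OF d2(1)[OF flip[OF that]]]]
        has_real_derivative_reflect[OF d2(2)[OF flip[OF that]]] by simp_all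
    have c2: "continuous_on {0<..<1} (\<lambda>x. f'' (1 - x))"
      using d2 by (meson DERIV_isCont continuous_at_imp_continuous_on)
    have C2f: "C2_on {0<..<1} (\<lambda>x. f (1 - x)) (\<lambda>x. - f' (1 - x)) (\<lambda>x. f'' (1 - x))"
      using d0 d1 c2 unfolding C2_on_def by (auto intro: has_field_derivative_at_within)
    have "continuous_on {0<..<1} f'''" using C2 by (simp add: C2_on_def)
    then have c3: "continuous_on {0<..<1} (\<lambda>x. - f''' (1 - x))"
      by (intro continuous_intros continuous_on_compose2[of _ f''' _ "\<lambda>x. 1 - x"]) auto
    have "(of_line (\<lambda>x. f (1 - x)), of_line (\<lambda>x. g (1 - x))) \<in> graph_L a b m \<gamma>"
    proof (rule graph_L_I[OF continuous_on_reflect[OF f(1)] _ _ C2f _ continuous_on_reflect[OF g(1)]])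
      show "right_C2_holder a b m \<gamma> (\<lambda>x. f (1 - x))" using f(2) by (simp add: right_C2_holder_def)
      show "left_C2_holder a b m \<gamma> (\<lambda>x. f (1 - x))"
        by (rule left_C2_holder_const[OF \<gamma>, of "3/4" _ 0]) (use z in auto)
      show "finite_holder_norm \<gamma> {p..q} (\<lambda>x. f'' (1 - x))" if "0 < p" "p < q" "q < 1" for p q
        by (rule finite_holder_norm_C1[OF \<gamma> _ continuous_on_subset[OF c3]])
          (use d2 that in \<open>auto intro: has_field_derivative_at_within\<close>)
      show "g (1 - x) = diffusion x * f'' (1 - x) + drift x * - f' (1 - x)" if "x \<in> {0<..<1}" for x
        using L[OF flip[OF that]] unfolding reflected_coefficients by simp
    qed
    then show ?thesis
      using g continuous_on_reflect[OF g(1)]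
      by (intro that[of "of_line (\<lambda>x. f (1 - x))" "of_line (\<lambda>x. g (1 - x))"]) auto
  qed
qed

lemma weighted_plateau_nonneg:
  assumes W: "integrating_factor a b W" and x: "x \<in> {0..1}"
  shows "0 \<le> plateau \<delta> x * speed_density W x"
proof (cases "x \<in> {0<..<1}")
  case True
  then show ?thesis using speed_density_nonneg[OF W True] plateau_bounds(1)[of \<delta> x] by simp
next
  case False
  then have "x = 0 \<or> x = 1" using x by auto
  then show ?thesis by (auto simp: plateau_def)
qed

lemma plateau_integral_pos:
  assumes W: "integrating_factor a b W"
  obtains h where "compact_Lipschitz h" "0 < integral {0..1} (\<lambda>x. h x * speed_density W x)"
proof (rule that)
  define F where "F = (\<lambda>x. plateau (1/16) x * speed_density W x)"
  show pl: "compact_Lipschitz (plateau (1/16))" by (rule compact_Lipschitz_plateau) simp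
  have int: "F integrable_on {0..1}"
    unfolding F_def by (rule compact_antiderivative[OF W pl]) blast
  have sub: "{1/4..3/4} \<subseteq> {0..1::real}" "{1/4..3/4} \<subseteq> {0<..<1::real}" by auto
  have ne: "compact {1/4..3/4::real}" "{1/4..3/4::real} \<noteq> {}" by auto
  obtain y where y: "y \<in> {1/4..3/4}" "\<And>x. x \<in> {1/4..3/4} \<Longrightarrow> speed_density W y \<le> speed_density W x"
    using continuous_attains_inf[OF ne continuous_on_subset[OF speed_density_continuous(1)[OF W] sub(2)]] by blast
  define l where "l = speed_density W y"
  have l: "0 < l" unfolding l_def by (rule speed_density_nonneg[OF W]) (use y(1) sub(2) in blast)
  have le: "l \<le> F x" if x: "x \<in> {1/4..3/4}" for x
  proof -
    have "0 \<le> (x - 1/4) * (3/4 - x)" using x by (intro mult_nonneg_nonneg) auto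
    moreover have "x * (1 - x) = (x - 1/4) * (3/4 - x) + 3/16" by (simp add: field_simps)
    ultimately have "2 * (1/16) \<le> x * (1 - x)" by linarith
    then have "plateau (1/16) x = 1" by (intro plateau_eq_1) auto
    then show ?thesis using y(2)[OF x] by (simp add: F_def l_def)
  qed
  have int2: "F integrable_on {1/4..3/4}" by (rule integrable_on_subinterval[OF int sub(1)])
  have "0 < integral {1/4..3/4::real} (\<lambda>x. l)" using l by simp
  also have "\<dots> \<le> integral {1/4..3/4} F" by (rule integral_le) (use int2 le in auto)
  also have "\<dots> \<le> integral {0..1} F"
    by (rule integral_subset_le[OF sub(1) int2 int]) (use weighted_plateau_nonneg[OF W] in \<open>simp add: F_def\<close>)
  finally show "0 < integral {0..1} (\<lambda>x. plateau (1/16) x * speed_density W x)" unfolding F_def .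
qed

text \<open>The integral of a plateau is at least \<open>\<integral> c/x\<close> over \<open>[4 \<delta>, 1/2]\<close>, which diverges like \<open>- c ln \<delta>\<close>.\<close>

lemma unbounded_left:
  assumes W: "integrating_factor a b W" and nt: "\<not> transverse_end a b m 0"
  obtains h where "compact_Lipschitz h" "\<And>x. \<bar>h x\<bar> \<le> 1" "B < integral {0..1} (\<lambda>x. h x * speed_density W x)"
proof -
  obtain c where c: "0 < c" "\<And>x. x \<in> {0<..1/2} \<Longrightarrow> c / x \<le> speed_density W x"
    by (rule speed_density_large_left[OF W nt]) blast
  \<comment> \<open>Chosen such that \<open>c ln (1/2) - c ln (4 \<delta>) = max B 0 + c\<close>.\<close>
  define \<delta> where "\<delta> = exp (- (max B 0 / c + 1)) / 8"
  have \<delta>0: "0 < \<delta>" by (simp add: \<delta>_def)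
  have "0 \<le> max B 0 / c" using c(1) by simp
  then have "exp (- (max B 0 / c + 1)) \<le> 1" by simp
  then have \<delta>: "4 * \<delta> \<le> 1/2" by (simp add: \<delta>_def)
  define h where "h = plateau \<delta>"
  have h: "compact_Lipschitz h" unfolding h_def by (rule compact_Lipschitz_plateau[OF \<delta>0])
  have int: "(\<lambda>x. h x * speed_density W x) integrable_on {0..1}"
    by (rule compact_antiderivative[OF W h]) blast
  have nn: "0 \<le> h x * speed_density W x" if "x \<in> {0..1}" for x
    unfolding h_def by (rule weighted_plateau_nonneg[OF W that])
  have "((\<lambda>x. c / x) has_integral c * ln (1/2) - c * ln (4 * \<delta>)) {4 * \<delta>..1/2}"
  proof (rule fundamental_theorem_of_calculus[OF \<delta>])
    fix x assume "x \<in> {4 * \<delta>..1/2}"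
    then have "0 < x" using \<delta>0 by auto
    then have "((\<lambda>x. c * ln x) has_real_derivative c / x) (at x within {4 * \<delta>..1/2})"
      by (auto intro!: derivative_eq_intros)
    then show "((\<lambda>x. c * ln x) has_vector_derivative c / x) (at x within {4 * \<delta>..1/2})"
      by (simp add: has_real_derivative_iff_has_vector_derivative)
  qed
  moreover have "c * ln (1/2) - c * ln (4 * \<delta>) = max B 0 + c"
  proof -
    have "ln (4 * \<delta>) = ln (1/2) + - (max B 0 / c + 1)"
      using ln_mult[of "1/2" "exp (- (max B 0 / c + 1))"] by (simp add: \<delta>_def)
    then show ?thesis using c(1) by (simp add: field_simps)
  qed
  ultimately have I: "((\<lambda>x. c / x) has_integral max B 0 + c) {4 * \<delta>..1/2}" by simp
  have sub: "{4 * \<delta>..1/2} \<subseteq> {0..1}" using \<delta>0 by auto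
  have int2: "(\<lambda>x. h x * speed_density W x) integrable_on {4 * \<delta>..1/2}"
    by (rule integrable_on_subinterval[OF int sub])
  have le: "c / x \<le> h x * speed_density W x" if x: "x \<in> {4 * \<delta>..1/2}" for x
  proof -
    have "4 * \<delta> * (1/2) \<le> x * (1 - x)" using x \<delta>0 by (intro mult_mono) auto
    then have "h x = 1" unfolding h_def by (intro plateau_eq_1[OF \<delta>0]) simp
    then show ?thesis using c(2)[of x] x \<delta>0 by simp
  qed
  have "B < max B 0 + c" using c(1) by simp
  also have "max B 0 + c = integral {4 * \<delta>..1/2} (\<lambda>x. c / x)" using I by (rule integral_unique[symmetric])
  also have "\<dots> \<le> integral {4 * \<delta>..1/2} (\<lambda>x. h x * speed_density W x)"
    by (rule integral_le) (use I int2 le in auto)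
  also have "\<dots> \<le> integral {0..1} (\<lambda>x. h x * speed_density W x)"
    by (rule integral_subset_le[OF sub int2 int]) (use nn in blast)
  finally have "B < integral {0..1} (\<lambda>x. h x * speed_density W x)" .
  moreover have "\<bar>h x\<bar> \<le> 1" for x using plateau_bounds[of \<delta> x] by (simp add: h_def)
  ultimately show ?thesis using h that by blast
qed

lemma unbounded_right:
  assumes W: "integrating_factor a b W" and nt: "\<not> transverse_end a b m 1"
  obtains h where "compact_Lipschitz h" "\<And>x. \<bar>h x\<bar> \<le> 1" "B < integral {0..1} (\<lambda>x. h x * speed_density W x)"
proof -
  interpret R: kimura_operator "\<lambda>x. a (1 - x)" "\<lambda>x. - b (1 - x)" "\<lambda>i. m (1 - i)" by (rule reflected)
  have nt': "\<not> transverse_end (\<lambda>x. a (1 - x)) (\<lambda>x. - b (1 - x)) (\<lambda>i. m (1 - i)) 0"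
    using nt reflected_transverse by simp
  obtain h where h: "compact_Lipschitz h" "\<And>x. \<bar>h x\<bar> \<le> 1"
    and B: "B < integral {0..1} (\<lambda>x. h x * R.speed_density (\<lambda>x. W (1 - x)) x)"
    by (rule R.unbounded_left[OF reflected_integrating_factor[OF W] nt', of B]) (rule that, blast+)
  have int: "(\<lambda>x. h x * R.speed_density (\<lambda>x. W (1 - x)) x) integrable_on {0..1}"
    by (rule R.compact_antiderivative[OF reflected_integrating_factor[OF W] h(1)]) blast
  have "B < integral {0..1} (\<lambda>x. h (1 - x) * speed_density W x)"
    using B integral_reflect_unit[OF int] unfolding reflected_coefficients by simp
  then show ?thesis
    using compact_Lipschitz_reflect[OF h(1)] h(2) by (intro that[of "\<lambda>x. h (1 - x)"]) auto
qed

text \<open>On compactly supported functions an annihilator of the range is a multiple of \<open>\<rho> dx\<close>;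
  the multiple is zero if \<open>\<rho> dx\<close> is infinite near an end, i.e. if some end is not transverse.\<close>

lemma annihilator_on_compact:
  assumes \<gamma>: "0 < \<gamma>" "\<gamma> < 1" and W: "integrating_factor a b W"
    and \<mu>: "\<And>f g. (f, g) \<in> graph_L a b m \<gamma> \<Longrightarrow> blinfun_apply \<mu> g = 0"
  obtains c where "\<And>h. compact_Lipschitz h \<Longrightarrow>
      blinfun_apply \<mu> (of_line h) = c * integral {0..1} (\<lambda>x. h x * speed_density W x)"
    "\<not> (transverse_end a b m 0 \<and> transverse_end a b m 1) \<Longrightarrow> c = 0"
proof -
  define I where "I = (\<lambda>h. integral {0..1} (\<lambda>x. h x * speed_density W x))"
  obtain h0 where h0: "compact_Lipschitz h0" "0 < I h0"
    using plateau_integral_pos[OF W] unfolding I_def by blast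
  define c where "c = blinfun_apply \<mu> (of_line h0) / I h0"
  have rep: "blinfun_apply \<mu> (of_line h) = c * I h" if h: "compact_Lipschitz h" for h
  proof -
    define t where "t = I h / I h0"
    have k: "compact_Lipschitz (\<lambda>x. h x - t * h0 x)" by (rule compact_Lipschitz_diff[OF h h0(1)])
    have int: "(\<lambda>x. h x * speed_density W x) integrable_on {0..1}" "(\<lambda>x. h0 x * speed_density W x) integrable_on {0..1}"
      by (rule compact_antiderivative[OF W h], blast) (rule compact_antiderivative[OF W h0(1)], blast)
    have "I (\<lambda>x. h x - t * h0 x) = I h - t * I h0"
      using integral_diff[OF int(1) integrable_on_mult_right[OF int(2), of t]]
      by (simp add: I_def left_diff_distrib mult.assoc)
    also have "\<dots> = 0" using h0(2) by (simp add: t_def)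
    finally obtain f where "(f, of_line (\<lambda>x. h x - t * h0 x)) \<in> graph_L a b m \<gamma>"
      using compact_Lipschitz_in_range[OF \<gamma> W k] unfolding I_def by blast
    then have "blinfun_apply \<mu> (of_line (\<lambda>x. h x - t * h0 x)) = 0" by (rule \<mu>)
    moreover have "of_line (\<lambda>x. h x - t * h0 x) = of_line h - t *\<^sub>R of_line h0"
      by (rule C0_eqI) (use compact_Lipschitz_continuous h h0(1) k in auto)
    ultimately have "blinfun_apply \<mu> (of_line h) = t * blinfun_apply \<mu> (of_line h0)"
      by (simp add: blinfun.diff_right blinfun.scaleR_right)
    then show ?thesis using h0(2) by (simp add: c_def t_def)
  qed
  have "c = 0" if nt: "\<not> (transverse_end a b m 0 \<and> transverse_end a b m 1)"
  proof (rule ccontr)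
    assume c: "c \<noteq> 0"
    obtain h where h: "compact_Lipschitz h" "\<And>x. \<bar>h x\<bar> \<le> 1" "norm \<mu> / \<bar>c\<bar> < I h"
    proof (cases "transverse_end a b m 0")
      case False
      then show ?thesis
        by (rule unbounded_left[OF W, of "norm \<mu> / \<bar>c\<bar>"]) (rule that, unfold I_def)
    next
      case True
      then have "\<not> transverse_end a b m 1" using nt by simp
      then show ?thesis
        by (rule unbounded_right[OF W, of "norm \<mu> / \<bar>c\<bar>"]) (rule that, unfold I_def)
    qed
    have "norm (of_line h) \<le> 1"
      by (rule norm_le_of_on_line) (use h(2) compact_Lipschitz_continuous[OF h(1)] in auto)
    have "\<bar>c\<bar> * I h \<le> \<bar>c * I h\<bar>" unfolding abs_mult by (intro mult_left_mono) auto
    also have "\<dots> = norm (blinfun_apply \<mu> (of_line h))" by (simp only: rep[OF h(1)] real_norm_def)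
    also have "\<dots> \<le> norm \<mu> * norm (of_line h)" by (rule norm_blinfun)
    also have "\<dots> \<le> norm \<mu> * 1"
      by (rule mult_left_mono[OF \<open>norm (of_line h) \<le> 1\<close> norm_ge_zero])
    finally have "I h \<le> norm \<mu> / \<bar>c\<bar>" using c by (simp add: pos_le_divide_eq mult.commute)
    then show False using h(3) by simp
  qed
  then show ?thesis using rep that[of c] unfolding I_def by blast
qed

section \<open>The annihilator of the range\<close>

text \<open>Inside the interval \<open>\<mu>\<close> is \<open>c \<rho> dx\<close>. Subtracting this measure leaves a functional that vanishes on
  Lipschitz functions with value \<open>0\<close> at both ends, by approximation with compactly supported ones. Hence
  it depends on the two end values only. A function in the range whose only nonzero end value is at a
  Kimura transverse end excludes the point mass there.\<close>

lemma annihilator_decomposition: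
  assumes \<gamma>: "0 < \<gamma>" "\<gamma> < 1" and W: "integrating_factor a b W"
    and \<mu>: "\<And>f g. (f, g) \<in> graph_L a b m \<gamma> \<Longrightarrow> blinfun_apply \<mu> g = 0"
  obtains c c0 c1 where
    "\<mu> = c *\<^sub>R density_functional (speed_density W) + c0 *\<^sub>R point_mass 0 + c1 *\<^sub>R point_mass 1"
    "\<not> (transverse_end a b m 0 \<and> transverse_end a b m 1) \<Longrightarrow> c = 0"
    "m 0 = 1 \<Longrightarrow> transverse_end a b m 0 \<Longrightarrow> c0 = 0"
    "m 1 = 1 \<Longrightarrow> transverse_end a b m 1 \<Longrightarrow> c1 = 0"
proof (rule annihilator_on_compact[OF \<gamma> W \<mu>], assumption)
  fix c
  assume rep: "\<And>h. compact_Lipschitz h \<Longrightarrow>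
      blinfun_apply \<mu> (of_line h) = c * integral {0..1} (\<lambda>x. h x * speed_density W x)"
    and c0: "\<not> (transverse_end a b m 0 \<and> transverse_end a b m 1) \<Longrightarrow> c = 0"
  define \<kappa> where "\<kappa> = c *\<^sub>R density_functional (speed_density W)"
  have \<kappa>: "blinfun_apply \<kappa> g = c * integral {0..1} (\<lambda>x. on_line g x * speed_density W x)" for g
  proof (cases "transverse_end a b m 0 \<and> transverse_end a b m 1")
    case True
    then show ?thesis
      using density_functional_apply[OF speed_density_integrable[OF W]]
      by (simp add: \<kappa>_def blinfun.scaleR_left)
  next
    case False
    then show ?thesis using c0 by (simp add: \<kappa>_def)
  qed
  have \<kappa>0: "blinfun_apply \<kappa> g = 0" if "(f, g) \<in> graph_L a b m \<gamma>" for f g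
    using c0 stationary_measure[OF that W] unfolding \<kappa> by auto
  define e0 e1 where "e0 = of_line (\<lambda>x. 1 - x)" and "e1 = of_line (\<lambda>x. x)"
  have e0: "on_line e0 x = 1 - x" and e1: "on_line e1 x = x" if "x \<in> {0..1}" for x
    unfolding e0_def e1_def using that by (auto intro!: on_line_of_line continuous_intros)
  define k0 k1 where "k0 = blinfun_apply (\<mu> - \<kappa>) e0" and "k1 = blinfun_apply (\<mu> - \<kappa>) e1"
  have "\<mu> - \<kappa> - k0 *\<^sub>R point_mass 0 - k1 *\<^sub>R point_mass 1 = 0"
  proof (rule functional_zero_if_zero_on_Lipschitz)
    fix g C assume g: "C-lipschitz_on {0..1} (on_line g)"
    define p where "p = g - on_line g 0 *\<^sub>R e0 - on_line g 1 *\<^sub>R e1"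
    define l where "l = (\<lambda>x. on_line g x - on_line g 0 * (1 - x) - on_line g 1 * x)"
    have pl: "on_line p x = l x" if "x \<in> {0..1}" for x
      using that by (simp add: p_def l_def e0 e1)
    have "(1::real)-lipschitz_on {0..1} (\<lambda>x::real. 1 - x)" "(1::real)-lipschitz_on {0..1} (\<lambda>x::real. x)"
      by (auto intro!: lipschitz_onI simp: dist_real_def)
    from lipschitz_on_diff[OF lipschitz_on_diff[OF g lipschitz_on_cmult_real[OF this(1)]] lipschitz_on_cmult_real[OF this(2)]]
    have lip: "(C + \<bar>on_line g 0\<bar> * 1 + \<bar>on_line g 1\<bar> * 1)-lipschitz_on {0..1} l" unfolding l_def .
    have l0: "l 0 = 0" "l 1 = 0" by (auto simp: l_def)
    have small: "\<bar>blinfun_apply (\<mu> - \<kappa>) p\<bar> \<le> norm (\<mu> - \<kappa>) * \<epsilon>" if \<epsilon>: "0 < \<epsilon>" for \<epsilon>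
    proof (rule compact_Lipschitz_approximation[OF lip l0 \<epsilon>])
      fix k assume k: "compact_Lipschitz k" "\<And>x. \<bar>l x - k x\<bar> \<le> \<epsilon>"
      have ok: "on_line (of_line k) x = k x" if "x \<in> {0..1}" for x
        by (rule on_line_of_line[OF compact_Lipschitz_continuous[OF k(1)] that])
      have "integral {0..1} (\<lambda>x. on_line (of_line k) x * speed_density W x) = integral {0..1} (\<lambda>x. k x * speed_density W x)"
        by (rule integral_cong) (simp add: ok)
      then have "blinfun_apply (\<mu> - \<kappa>) (of_line k) = 0"
        using rep[OF k(1)] by (simp add: blinfun.diff_left \<kappa>)
      then have "\<bar>blinfun_apply (\<mu> - \<kappa>) p\<bar> = norm (blinfun_apply (\<mu> - \<kappa>) (p - of_line k))"
        by (simp add: blinfun.diff_right)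
      also have "\<dots> \<le> norm (\<mu> - \<kappa>) * norm (p - of_line k)" by (rule norm_blinfun)
      also have "\<dots> \<le> norm (\<mu> - \<kappa>) * \<epsilon>"
        by (rule mult_left_mono[OF norm_le_of_on_line norm_ge_zero]) (simp add: pl ok k(2))
      finally show ?thesis .
    qed
    have "eventually (\<lambda>\<epsilon>. \<bar>blinfun_apply (\<mu> - \<kappa>) p\<bar> \<le> norm (\<mu> - \<kappa>) * \<epsilon>) (at_right 0)"
      unfolding eventually_at_right_field by (intro exI[of _ 1]) (auto intro: small)
    moreover have "((\<lambda>\<epsilon>. norm (\<mu> - \<kappa>) * \<epsilon>) \<longlongrightarrow> norm (\<mu> - \<kappa>) * 0) (at_right 0)"
      by (intro tendsto_intros)
    ultimately have "\<bar>blinfun_apply (\<mu> - \<kappa>) p\<bar> \<le> norm (\<mu> - \<kappa>) * 0"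
      by (intro tendsto_lowerbound) auto
    then have "blinfun_apply (\<mu> - \<kappa>) p = 0" by simp
    moreover have "blinfun_apply (\<mu> - \<kappa>) p = blinfun_apply (\<mu> - \<kappa>) g - on_line g 0 * k0 - on_line g 1 * k1"
      by (simp only: p_def k0_def k1_def blinfun.diff_right blinfun.scaleR_right real_scaleR_def)
    moreover have step: "blinfun_apply (\<mu> - \<kappa> - k0 *\<^sub>R point_mass 0 - k1 *\<^sub>R point_mass 1) g
        = blinfun_apply (\<mu> - \<kappa>) g - on_line g 0 * k0 - on_line g 1 * k1"
      by (simp add: blinfun.diff_left blinfun.scaleR_left)
    ultimately show "blinfun_apply (\<mu> - \<kappa> - k0 *\<^sub>R point_mass 0 - k1 *\<^sub>R point_mass 1) g = 0"
      by (simp only: step)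
  qed
  then have eq: "\<mu> = \<kappa> + k0 *\<^sub>R point_mass 0 + k1 *\<^sub>R point_mass 1"
    by (simp add: algebra_simps)
  have test: "k0 * on_line g 0 + k1 * on_line g 1 = 0" if "(f, g) \<in> graph_L a b m \<gamma>" for f g
    using \<mu>[OF that] \<kappa>0[OF that] arg_cong[OF eq, of "\<lambda>\<nu>. blinfun_apply \<nu> g"]
    by (simp add: blinfun.add_left blinfun.scaleR_left)
  show thesis
  proof (rule that[OF eq[unfolded \<kappa>_def] c0])
    show "k0 = 0" if m: "m 0 = 1" and tr: "transverse_end a b m 0"
    proof (rule kimura_transverse_in_range_left[OF \<gamma> m tr])
      fix f g assume "(f, g) \<in> graph_L a b m \<gamma>" "on_line g 0 \<noteq> 0" "on_line g 1 = 0"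
      then show "k0 = 0" using test by fastforce
    qed
    show "k1 = 0" if m: "m 1 = 1" and tr: "transverse_end a b m 1"
    proof (rule kimura_transverse_in_range_right[OF \<gamma> m tr])
      fix f g assume "(f, g) \<in> graph_L a b m \<gamma>" "on_line g 1 \<noteq> 0" "on_line g 0 = 0"
      then show "k1 = 0" using test by fastforce
    qed
  qed
qed

lemma bP_ter_iff:
  "Endpoint i \<in> bP_ter a b m \<longleftrightarrow> (i = 0 \<or> i = 1) \<and> \<not> (m i = 1 \<and> transverse_end a b m i)"
  "Whole_Interval \<in> bP_ter a b m \<longleftrightarrow> transverse_end a b m 0 \<and> transverse_end a b m 1"
proof -
  have "m i = 1 \<or> m i = 2" if "i = 0 \<or> i = 1" using that m_cases by auto
  moreover have "tangent_end a b m i \<longleftrightarrow> \<not> transverse_end a b m i" if "i = 0 \<or> i = 1" "m i = 1"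
    using that mixed by (auto simp: mixed_kimura_operator_def tangent_end_def transverse_end_def kimura_end_def)
  ultimately show "Endpoint i \<in> bP_ter a b m \<longleftrightarrow> (i = 0 \<or> i = 1) \<and> \<not> (m i = 1 \<and> transverse_end a b m i)"
    unfolding bP_ter_def by (auto simp: quadratic_end_def kimura_end_def)
qed (auto simp: bP_ter_def)

text \<open>The dual family consists of a normalized bump \<open>w0\<close> for the measure \<open>\<rho> dx\<close> and of the affine
  functions with one nonzero end value, corrected by a multiple of \<open>w0\<close> so that \<open>\<rho> dx\<close> annihilates them.\<close>

lemma dim_annihilator:
  assumes \<gamma>: "0 < \<gamma>" "\<gamma> < 1"
  shows "dim (ker_graph (adjoint_graph (closure_L a b m \<gamma>))) = card (bP_ter a b m)"
proof -
  obtain W where W: "integrating_factor a b W" by (rule integrating_factor_exists)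
  define \<rho> where "\<rho> = speed_density W"
  define v where "v = (\<lambda>s. case s of Endpoint i \<Rightarrow> point_mass (real i) | Whole_Interval \<Rightarrow> density_functional \<rho>)"
  have v: "v (Endpoint i) = point_mass (real i)" "v Whole_Interval = density_functional \<rho>" for i
    by (auto simp: v_def)
  have fin: "finite (bP_ter a b m)" by (simp add: bP_ter_def)
  obtain h where h: "compact_Lipschitz h" "0 < integral {0..1} (\<lambda>x. h x * \<rho> x)"
    unfolding \<rho>_def by (rule plateau_integral_pos[OF W])
  define I where "I = (\<lambda>g. if transverse_end a b m 0 \<and> transverse_end a b m 1
    then blinfun_apply (density_functional \<rho>) g else 0)"
  define w0 where "w0 = (1 / integral {0..1} (\<lambda>x. h x * \<rho> x)) *\<^sub>R of_line h"
  define e where "e = (\<lambda>i::nat. if i = 0 then of_line (\<lambda>x. 1 - x) else of_line (\<lambda>x. x))"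
  define w where "w = (\<lambda>s. case s of Endpoint i \<Rightarrow> e i - I (e i) *\<^sub>R w0 | Whole_Interval \<Rightarrow> w0)"
  have w: "w (Endpoint i) = e i - I (e i) *\<^sub>R w0" "w Whole_Interval = w0" for i
    by (auto simp: w_def)
  have oh: "on_line (of_line h) x = h x" if "x \<in> {0..1}" for x
    by (rule on_line_of_line[OF compact_Lipschitz_continuous[OF h(1)] that])
  have "h 0 = 0" "h 1 = 0" using h(1) unfolding compact_Lipschitz_def by force+
  then have w0_ends: "on_line w0 0 = 0" "on_line w0 1 = 0" by (auto simp: w0_def oh)
  have e_ends: "on_line (e i) (real j) = (if i = j then 1 else 0)" if "i = 0 \<or> i = 1" "j = 0 \<or> j = 1" for i j
    using that by (auto simp: e_def continuous_intros)
  have w0_mass: "blinfun_apply (density_functional \<rho>) w0 = 1" if tr: "transverse_end a b m 0" "transverse_end a b m 1"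
  proof -
    have "integral {0..1} (\<lambda>x. on_line (of_line h) x * \<rho> x) = integral {0..1} (\<lambda>x. h x * \<rho> x)"
      by (rule integral_cong) (simp add: oh)
    then show ?thesis
      using density_functional_apply[OF speed_density_integrable[OF W tr]] h(2)
      by (simp add: w0_def blinfun.scaleR_right \<rho>_def)
  qed
  show ?thesis
  proof (rule dim_eq_card_biorthogonal[OF fin, where v = v and w = w])
    fix s t assume s: "s \<in> bP_ter a b m" and t: "t \<in> bP_ter a b m"
    show "blinfun_apply (v s) (w t) = (if s = t then 1 else 0)"
    proof (cases s; cases t)
      fix i j assume ij: "s = Endpoint i" "t = Endpoint j"
      then have "i = 0 \<or> i = 1" "j = 0 \<or> j = 1" using s t bP_ter_iff(1) by blast+
      then show ?thesis using ij e_ends[of j i] w0_ends by (auto simp: v w)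
    next
      fix i assume i: "s = Endpoint i" "t = Whole_Interval"
      then have "i = 0 \<or> i = 1" using s bP_ter_iff(1) by blast
      then show ?thesis using i w0_ends by (auto simp: v w)
    next
      fix j assume j: "s = Whole_Interval" "t = Endpoint j"
      then have tr: "transverse_end a b m 0" "transverse_end a b m 1" using s bP_ter_iff(2) by blast+
      then show ?thesis using j w0_mass[OF tr] by (simp add: v w I_def blinfun.diff_right blinfun.scaleR_right)
    next
      assume j: "s = Whole_Interval" "t = Whole_Interval"
      then have tr: "transverse_end a b m 0" "transverse_end a b m 1" using s bP_ter_iff(2) by blast+
      then show ?thesis using j w0_mass[OF tr] by (simp add: v w)
    qed
  next
    fix s assume s: "s \<in> bP_ter a b m"
    show "v s \<in> ker_graph (adjoint_graph (closure_L a b m \<gamma>))"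
      unfolding closure_L_def mem_ker_adjoint_closure_iff
    proof (intro ballI, clarify)
      fix f g assume fg: "(f, g) \<in> graph_L a b m \<gamma>"
      show "blinfun_apply (v s) g = 0"
      proof (cases s)
        case (Endpoint i)
        then have "i = 0 \<or> i = 1" "\<not> (m i = 1 \<and> transverse_end a b m i)" using s bP_ter_iff(1) by blast+
        then show ?thesis using Endpoint graph_L_vanishes[OF fg] by (auto simp: v)
      next
        case Whole_Interval
        then have tr: "transverse_end a b m 0" "transverse_end a b m 1" using s bP_ter_iff(2) by blast+
        then show ?thesis
          using Whole_Interval stationary_measure[OF fg W tr] density_functional_apply[OF speed_density_integrable[OF W tr]]
          by (simp add: v \<rho>_def)
      qed
    qed
  next
    fix \<mu> assume "\<mu> \<in> ker_graph (adjoint_graph (closure_L a b m \<gamma>))"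
    then have \<mu>: "blinfun_apply \<mu> g = 0" if "(f, g) \<in> graph_L a b m \<gamma>" for f g
      using that unfolding closure_L_def mem_ker_adjoint_closure_iff by blast
    show "\<exists>c. \<mu> = (\<Sum>s\<in>bP_ter a b m. c s *\<^sub>R v s)"
    proof (rule annihilator_decomposition[OF \<gamma> W \<mu>], assumption)
      fix c c0 c1
      assume eq: "\<mu> = c *\<^sub>R density_functional (speed_density W) + c0 *\<^sub>R point_mass 0 + c1 *\<^sub>R point_mass 1"
        and z: "\<not> (transverse_end a b m 0 \<and> transverse_end a b m 1) \<Longrightarrow> c = 0"
        "m 0 = 1 \<Longrightarrow> transverse_end a b m 0 \<Longrightarrow> c0 = 0" "m 1 = 1 \<Longrightarrow> transverse_end a b m 1 \<Longrightarrow> c1 = 0"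
      define C where "C = (\<lambda>s. case s of Endpoint i \<Rightarrow> if i = 0 then c0 else c1 | Whole_Interval \<Rightarrow> c)"
      let ?U = "{Endpoint 0, Endpoint 1, Whole_Interval}"
      have sub: "bP_ter a b m \<subseteq> ?U" by (auto simp: bP_ter_def)
      have C: "C (Endpoint 0) = c0" "C (Endpoint 1) = c1" "C Whole_Interval = c"
        by (simp_all add: C_def)
      have zero: "C s = 0" if s: "s \<in> ?U - bP_ter a b m" for s
      proof -
        consider "s = Endpoint 0" "Endpoint 0 \<notin> bP_ter a b m" | "s = Endpoint 1" "Endpoint 1 \<notin> bP_ter a b m"
          | "s = Whole_Interval" "Whole_Interval \<notin> bP_ter a b m" using s by blast
        then show ?thesis
        proof cases
          case 1 then show ?thesis using z(2) C bP_ter_iff(1)[of 0] by simp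
        next
          case 2 then show ?thesis using z(3) C bP_ter_iff(1)[of 1] by simp
        next
          case 3 then show ?thesis using z(1) C bP_ter_iff(2) by simp
        qed
      qed
      have "\<mu> = (\<Sum>s\<in>?U. C s *\<^sub>R v s)"
        using eq by (simp add: C_def v \<rho>_def add_ac)
      also have "\<dots> = (\<Sum>s\<in>bP_ter a b m. C s *\<^sub>R v s)"
        by (rule sum.mono_neutral_right) (use sub zero in auto)
      finally show ?thesis by blast
    qed
  qed
qed

end

theorem proposition3p2:
  fixes a b :: "real \<Rightarrow> real" and m :: "nat \<Rightarrow> nat" and \<gamma> :: real
  assumes "mixed_kimura_operator a b m"
    and "0 < \<gamma>" and "\<gamma> < 1"
  shows "dim (ker_graph (adjoint_graph (closure_L a b m \<gamma>))) = card (bP_ter a b m)"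
proof -
  interpret kimura_operator a b m by unfold_locales (rule assms(1))
  show ?thesis by (rule dim_annihilator[OF assms(2,3)])
qed

end
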